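(* Let $\Lambda$ be a domestic string algebra and let $u$ be a weak bridge with $u=u_n\circ(\cdots\circ(u_2\circ u_1)\cdots)$, where $u_j$ is an abnormal bridge for each $1\le j<n$ and $u_n$ is a bridge. Then the factorization of $u$ into bridges is unique; that is, if $u=w_m\circ(\cdots\circ(w_2\circ w_1)\cdots)$ with every $w_j$ a bridge, then $m=n$ and $w_j=u_j$ for all $1\le j\le n$.
   Context: STRINGS. $\mathcal K$ is an algebraically closed field. A string algebra is $\Lambda=\mathcal K\mathcal Q/\langle\rho\rangle$ with $\mathcal Q=(Q_0,Q_1,s,t)$ a finite quiver and $\rho$ a set of paths of length $\ge2$, none a subpath of another, such that: every vertex is the source of at most two and the target of at most two arrows; for every arrow $b$ there is at most one arrow $a$ with $s(a)=t(b)$, $ab\notin\rho$, and at most one arrow $c$ with $t(c)=s(b)$, $bc\notin\rho$; all sufficiently long paths have a subpath in $\rho$. Words are composed from right to left. Fix $\sigma,\varepsilon:Q_1\to\{1,-1\}$ with $\sigma(a)=-\sigma(b)$ for distinct arrows with the same source, $\varepsilon(a)=-\varepsilon(b)$ for distinct arrows with the same target, and $\sigma(a)=-\varepsilon(b)$ whenever $s(a)=t(b)$ and $ab\notin\rho$. Syllables are arrows (direct) and their formal inverses (inverse), with $s(a^{-1})=t(a)$, $t(a^{-1})=s(a)$, $\sigma(a^{-1})=\varepsilon(a)$, $\varepsilon(a^{-1})=\sigma(a)$. A string of length $n>0$ is a word $\alpha_n\cdots\alpha_1$ of syllables with $s(\alpha_{i+1})=t(\alpha_i)$, $\alpha_{i+1}\ne\alpha_i^{-1}$,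 and no subword in $\rho\cup\rho^{-1}$; its first syllable is $\alpha_1$ (determining $s,\sigma$) and its last is $\alpha_n$ (determining $t,\varepsilon$). For each vertex $v$ and $i\in\{1,-1\}$ there is a length-$0$ string $1_{(v,i)}$ with $s=t=v$, $\sigma=-i$, $\varepsilon=i$; $x1_{(v,i)}=x$ is defined iff $s(x)=v,\sigma(x)=-i$, and $1_{(v,i)}x=x$ is defined iff $t(x)=v,\varepsilon(x)=i$. A band is a string $b$ with $s(b)=t(b)$ whose first syllable is inverse and last syllable is direct, such that $b^n$ is a string for all $n\ge1$ and $b$ is not a proper power of a string. $\Lambda$ is domestic if it has only finitely many bands. A string is band-free if no substring of it is a cyclic permutation of a band. WEAK BRIDGES AND COMPOSITION. Fix a set $Q_0^{\mathrm{Ba}}$ of representatives of bands up to cyclic permutation. For $b_1,b_2\in Q_0^{\mathrm{Ba}}$, a weak bridge $u:b_1\to b_2$ is a band-free string $u$ (together with its source $\mathfrak s(u)=b_1$ and target $\mathfrak t(u)=b_2$) such that $b_2ub_1$ is a string, excluding the trivial ones $1_{(t(b),\varepsilon(b))}:b\to b$. For a band $b$ and string $y$, $N(b,y)$ is the largest $n$ with $y=y_2(b')^ny_1$, $b'$ a cyclic permutation of $b$; and $\mathrm R_b(y)$ denotes, if it exists, a string of the form $y_2y_1$ with $y=y_2b'y_1$, $b'$ a cyclic permutation of $b$. For weak bridges $u,u'$ with $\mathfrak t(u)=\mathfrak s(u')=b$: if $u'u$ is a weak bridge $\mathfrak s(u)\to\mathfrak t(u')$ then $u'\circ u:=u'u$;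 if $N(b,u'u)=1$ and $\mathrm R_b(u'u)$ exists and is a weak bridge $\mathfrak s(u)\to\mathfrak t(u')$ then $u'\circ u:=\mathrm R_b(u'u)$; otherwise $u'\circ u$ is undefined. A bridge is a weak bridge that cannot be written as $u_2\circ u_1$ with $u_1,u_2$ (non-trivial) weak bridges. NORMAL/ABNORMAL. For a weak bridge $u:b_1\to b_2$, write $b_2ub_1=\beta_n\cdots\beta_1b_1$. The exit $\beta(u)$ is the syllable $\beta_k$ with $k$ minimal such that $\beta_k\cdots\beta_1b_1$ is not a substring of a power of $b_1$. The entry is $\alpha(u):=(\beta(u^{-1}))^{-1}$, where $u^{-1}$ is the weak bridge $b_2^{-1}\to b_1^{-1}$. (Both are considered as occurrences in $b_2ub_1$.) The weak bridge $u$ is normal if there is a positive-length substring of $\mathfrak t(u)u\mathfrak s(u)$ whose first syllable is $\beta(u)$ and whose last syllable is $\alpha(u)$; otherwise it is abnormal. *)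

theory Defs
  imports
    "Graph_Theory.Digraph"
    "HOL-Algebra.Algebraic_Closure"
    "HOL-Library.Sublist"
begin

text \<open>
  Words are lists in the order in which they are written, composed from right to left: the
  word \<open>\<alpha>\<^sub>n \<dots> \<alpha>\<^sub>1\<close> is the list \<open>[\<alpha>\<^sub>n, \<dots>, \<alpha>\<^sub>1]\<close>.  Hence concatenation of words is \<open>@\<close>,
  the first syllable of a word is the last element of the list, and its last syllable is the
  head of the list.

  A string algebra \<open>K Q / \<langle>\<rho>\<rangle>\<close> is represented by its presentation \<open>(K, Q, \<rho>)\<close> together with the
  sign functions \<open>\<sigma>\<close>, \<open>\<epsilon>\<close>.  The quiver \<open>Q\<close> is a directed multigraph, with \<open>tail\<close> as source and
  \<open>head\<close> as target map.  Strings, bands and weak bridges do not depend on \<open>K\<close>.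
\<close>

record ('k, 'v, 'a) presentation =
  ground_field :: "'k ring"
  quiver :: "('v, 'a) pre_digraph"
  rels :: "'a list set"
  arr_sig :: "'a \<Rightarrow> int"
  arr_eps :: "'a \<Rightarrow> int"

definition quiver_path :: "('v, 'a) pre_digraph \<Rightarrow> 'a list \<Rightarrow> bool" where
  "quiver_path Q p \<longleftrightarrow>
     p \<noteq> [] \<and> set p \<subseteq> arcs Q \<and> successively (\<lambda>a b. tail Q a = head Q b) p"

definition string_algebra :: "('k, 'v, 'a) presentation \<Rightarrow> bool" where
  "string_algebra A \<longleftrightarrow> (let Q = quiver A; \<rho> = rels A in
     algebraically_closed (ground_field A) \<and> fin_digraph Q \<and>
     (\<forall>r\<in>\<rho>. quiver_path Q r \<and> length r \<ge> 2) \<and>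
     (\<forall>r\<in>\<rho>. \<forall>r'\<in>\<rho>. sublist r r' \<longrightarrow> r = r') \<and>
     (\<forall>v\<in>verts Q. out_degree Q v \<le> 2 \<and> in_degree Q v \<le> 2) \<and>
     (\<forall>b\<in>arcs Q. card {a \<in> arcs Q. tail Q a = head Q b \<and> [a, b] \<notin> \<rho>} \<le> 1) \<and>
     (\<forall>b\<in>arcs Q. card {c \<in> arcs Q. head Q c = tail Q b \<and> [b, c] \<notin> \<rho>} \<le> 1) \<and>
     (\<exists>N. \<forall>p. quiver_path Q p \<and> length p \<ge> N \<longrightarrow> (\<exists>r\<in>\<rho>. sublist r p)))"

definition sign_functions :: "('k, 'v, 'a) presentation \<Rightarrow> bool" where
  "sign_functions A \<longleftrightarrow> (let Q = quiver A; \<sigma> = arr_sig A; \<epsilon> = arr_eps A in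
     (\<forall>a\<in>arcs Q. \<sigma> a \<in> {1, -1} \<and> \<epsilon> a \<in> {1, -1}) \<and>
     (\<forall>a\<in>arcs Q. \<forall>b\<in>arcs Q. a \<noteq> b \<and> tail Q a = tail Q b \<longrightarrow> \<sigma> a = - \<sigma> b) \<and>
     (\<forall>a\<in>arcs Q. \<forall>b\<in>arcs Q. a \<noteq> b \<and> head Q a = head Q b \<longrightarrow> \<epsilon> a = - \<epsilon> b) \<and>
     (\<forall>a\<in>arcs Q. \<forall>b\<in>arcs Q. tail Q a = head Q b \<and> [a, b] \<notin> rels A \<longrightarrow> \<sigma> a = - \<epsilon> b))"


section \<open>Strings\<close>

datatype 'a syllable = Dir (arrow: 'a) | Inv (arrow: 'a)

fun syl_inv :: "'a syllable \<Rightarrow> 'a syllable" where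
  "syl_inv (Dir a) = Inv a"
| "syl_inv (Inv a) = Dir a"

fun syl_src :: "('k, 'v, 'a) presentation \<Rightarrow> 'a syllable \<Rightarrow> 'v" where
  "syl_src A (Dir a) = tail (quiver A) a"
| "syl_src A (Inv a) = head (quiver A) a"

fun syl_tgt :: "('k, 'v, 'a) presentation \<Rightarrow> 'a syllable \<Rightarrow> 'v" where
  "syl_tgt A (Dir a) = head (quiver A) a"
| "syl_tgt A (Inv a) = tail (quiver A) a"

fun syl_sig :: "('k, 'v, 'a) presentation \<Rightarrow> 'a syllable \<Rightarrow> int" where
  "syl_sig A (Dir a) = arr_sig A a"
| "syl_sig A (Inv a) = arr_eps A a"

fun syl_eps :: "('k, 'v, 'a) presentation \<Rightarrow> 'a syllable \<Rightarrow> int" where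
  "syl_eps A (Dir a) = arr_eps A a"
| "syl_eps A (Inv a) = arr_sig A a"

text \<open>\<open>Triv v i\<close> is the length-0 string \<open>1\<^sub>(\<^sub>v\<^sub>,\<^sub>i\<^sub>)\<close>; \<open>Word\<close> is for strings of positive length.\<close>

datatype ('v, 'a) str = Triv 'v int | Word "'a syllable list"

fun syls :: "('v, 'a) str \<Rightarrow> 'a syllable list" where
  "syls (Triv v i) = []"
| "syls (Word xs) = xs"

fun is_string :: "('k, 'v, 'a) presentation \<Rightarrow> ('v, 'a) str \<Rightarrow> bool" where
  "is_string A (Triv v i) \<longleftrightarrow> v \<in> verts (quiver A) \<and> i \<in> {1, -1}"
| "is_string A (Word xs) \<longleftrightarrow>
     xs \<noteq> [] \<and> arrow ` set xs \<subseteq> arcs (quiver A) \<and>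
     successively (\<lambda>\<beta> \<alpha>. syl_src A \<beta> = syl_tgt A \<alpha> \<and> \<beta> \<noteq> syl_inv \<alpha>) xs \<and>
     (\<forall>r\<in>rels A. \<not> sublist (map Dir r) xs \<and> \<not> sublist (rev (map Inv r)) xs)"

fun str_src :: "('k, 'v, 'a) presentation \<Rightarrow> ('v, 'a) str \<Rightarrow> 'v" where
  "str_src A (Triv v i) = v"
| "str_src A (Word xs) = syl_src A (last xs)"

fun str_tgt :: "('k, 'v, 'a) presentation \<Rightarrow> ('v, 'a) str \<Rightarrow> 'v" where
  "str_tgt A (Triv v i) = v"
| "str_tgt A (Word xs) = syl_tgt A (hd xs)"

fun str_sig :: "('k, 'v, 'a) presentation \<Rightarrow> ('v, 'a) str \<Rightarrow> int" where
  "str_sig A (Triv v i) = - i"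
| "str_sig A (Word xs) = syl_sig A (last xs)"

fun str_eps :: "('k, 'v, 'a) presentation \<Rightarrow> ('v, 'a) str \<Rightarrow> int" where
  "str_eps A (Triv v i) = i"
| "str_eps A (Word xs) = syl_eps A (hd xs)"

fun str_inv :: "('v, 'a) str \<Rightarrow> ('v, 'a) str" where
  "str_inv (Triv v i) = Triv v (- i)"
| "str_inv (Word xs) = Word (rev (map syl_inv xs))"

text \<open>The product \<open>xy\<close> of two strings, when it is defined and is a string.\<close>

fun str_mult :: "('k, 'v, 'a) presentation \<Rightarrow> ('v, 'a) str \<Rightarrow> ('v, 'a) str \<Rightarrow> ('v, 'a) str option" where
  "str_mult A x (Triv v i) = (if str_src A x = v \<and> str_sig A x = - i then Some x else None)"
| "str_mult A (Triv v i) (Word ys) =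
     (if str_tgt A (Word ys) = v \<and> str_eps A (Word ys) = i then Some (Word ys) else None)"
| "str_mult A (Word xs) (Word ys) =
     (if is_string A (Word (xs @ ys)) then Some (Word (xs @ ys)) else None)"

definition str_mult3 ::
  "('k, 'v, 'a) presentation \<Rightarrow> ('v, 'a) str \<Rightarrow> ('v, 'a) str \<Rightarrow> ('v, 'a) str \<Rightarrow> ('v, 'a) str option" where
  "str_mult3 A x y z = Option.bind (str_mult A y z) (str_mult A x)"


section \<open>Bands\<close>

definition list_pow :: "'b list \<Rightarrow> nat \<Rightarrow> 'b list" where
  "list_pow xs n = concat (replicate n xs)"

definition band :: "('k, 'v, 'a) presentation \<Rightarrow> ('v, 'a) str \<Rightarrow> bool" where
  "band A b \<longleftrightarrow>
     is_string A b \<and> syls b \<noteq> [] \<and> str_src A b = str_tgt A b \<and>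
     (\<exists>a. last (syls b) = Inv a) \<and> (\<exists>a. hd (syls b) = Dir a) \<and>
     (\<forall>n\<ge>1. is_string A (Word (list_pow (syls b) n))) \<and>
     \<not> (\<exists>c n. is_string A c \<and> n \<ge> 2 \<and> syls b = list_pow (syls c) n)"

definition domestic :: "('k, 'v, 'a) presentation \<Rightarrow> bool" where
  "domestic A \<longleftrightarrow> finite {b. band A b}"

definition cyclic_perm :: "('v, 'a) str \<Rightarrow> ('v, 'a) str \<Rightarrow> bool" where
  "cyclic_perm b' b \<longleftrightarrow> (\<exists>n xs. b = Word xs \<and> b' = Word (rotate n xs))"

definition band_free :: "('k, 'v, 'a) presentation \<Rightarrow> ('v, 'a) str \<Rightarrow> bool" where
  "band_free A u \<longleftrightarrow> \<not> (\<exists>b b'. band A b \<and> cyclic_perm b' b \<and> sublist (syls b') (syls u))"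

definition band_representatives :: "('k, 'v, 'a) presentation \<Rightarrow> ('v, 'a) str set \<Rightarrow> bool" where
  "band_representatives A B \<longleftrightarrow>
     (\<forall>b\<in>B. band A b) \<and> (\<forall>b. band A b \<longrightarrow> (\<exists>!b'. b' \<in> B \<and> cyclic_perm b' b))"


section \<open>Weak bridges and their composition\<close>

datatype ('v, 'a) arrow_of_bands =
  WB (wb_src: "('v, 'a) str") (wb_str: "('v, 'a) str") (wb_tgt: "('v, 'a) str")

definition weak_bridge ::
  "('k, 'v, 'a) presentation \<Rightarrow> ('v, 'a) str set \<Rightarrow> ('v, 'a) arrow_of_bands \<Rightarrow> bool" where
  "weak_bridge A B w \<longleftrightarrow> (case w of WB b\<^sub>1 u b\<^sub>2 \<Rightarrow>
     b\<^sub>1 \<in> B \<and> b\<^sub>2 \<in> B \<and> is_string A u \<and> band_free A u \<and>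
     str_mult3 A b\<^sub>2 u b\<^sub>1 \<noteq> None \<and>
     \<not> (b\<^sub>1 = b\<^sub>2 \<and> u = Triv (str_tgt A b\<^sub>1) (str_eps A b\<^sub>1)))"

definition band_count :: "('v, 'a) str \<Rightarrow> ('v, 'a) str \<Rightarrow> nat" where
  "band_count b y = Max {n. \<exists>b'. cyclic_perm b' b \<and> sublist (list_pow (syls b') n) (syls y)}"

text \<open>
  \<open>band_removal A b y z\<close> states that \<open>z\<close> is a value of \<open>R\<^sub>b(y)\<close>.  This is a relation, since the
  definition of \<open>R\<^sub>b(y)\<close> by itself fixes neither the existence nor the choice of the
  decomposition of \<open>y\<close>.
\<close>

definition band_removal ::
  "('k, 'v, 'a) presentation \<Rightarrow> ('v, 'a) str \<Rightarrow> ('v, 'a) str \<Rightarrow> ('v, 'a) str \<Rightarrow> bool" where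
  "band_removal A b y z \<longleftrightarrow>
     (\<exists>y\<^sub>1 y\<^sub>2 b'. is_string A y\<^sub>1 \<and> is_string A y\<^sub>2 \<and> cyclic_perm b' b \<and>
        str_mult3 A y\<^sub>2 b' y\<^sub>1 = Some y \<and> str_mult A y\<^sub>2 y\<^sub>1 = Some z)"

text \<open>\<open>is_comp A B u' u w\<close> states that \<open>u' \<circ> u\<close> is defined and equal to \<open>w\<close>.\<close>

definition is_comp ::
  "('k, 'v, 'a) presentation \<Rightarrow> ('v, 'a) str set \<Rightarrow> ('v, 'a) arrow_of_bands \<Rightarrow>
     ('v, 'a) arrow_of_bands \<Rightarrow> ('v, 'a) arrow_of_bands \<Rightarrow> bool" where
  "is_comp A B u' u w \<longleftrightarrow>
     weak_bridge A B u \<and> weak_bridge A B u' \<and> wb_tgt u = wb_src u' \<and>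
     weak_bridge A B w \<and> wb_src w = wb_src u \<and> wb_tgt w = wb_tgt u' \<and>
     (\<exists>y. str_mult A (wb_str u') (wb_str u) = Some y \<and>
        (wb_str w = y \<or>
         band_count (wb_tgt u) y = 1 \<and> band_removal A (wb_tgt u) y (wb_str w)))"

definition bridge ::
  "('k, 'v, 'a) presentation \<Rightarrow> ('v, 'a) str set \<Rightarrow> ('v, 'a) arrow_of_bands \<Rightarrow> bool" where
  "bridge A B u \<longleftrightarrow> weak_bridge A B u \<and>
     \<not> (\<exists>u\<^sub>1 u\<^sub>2. weak_bridge A B u\<^sub>1 \<and> weak_bridge A B u\<^sub>2 \<and> is_comp A B u\<^sub>2 u\<^sub>1 u)"

text \<open>
  \<open>iterated_comp A B [u\<^sub>1, \<dots>, u\<^sub>n] w\<close> states that \<open>u\<^sub>n \<circ> (\<dots> \<circ> (u\<^sub>2 \<circ> u\<^sub>1) \<dots>)\<close> is defined and equal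
  to \<open>w\<close>; here \<open>n \<ge> 1\<close>.
\<close>

inductive iterated_comp ::
  "('k, 'v, 'a) presentation \<Rightarrow> ('v, 'a) str set \<Rightarrow> ('v, 'a) arrow_of_bands list \<Rightarrow>
     ('v, 'a) arrow_of_bands \<Rightarrow> bool" for A B where
  single: "weak_bridge A B u \<Longrightarrow> iterated_comp A B [u] u"
| step: "iterated_comp A B us v \<Longrightarrow> is_comp A B u v w \<Longrightarrow> iterated_comp A B (us @ [u]) w"


section \<open>Normal and abnormal weak bridges\<close>

definition full_word :: "('v, 'a) arrow_of_bands \<Rightarrow> 'a syllable list" where
  "full_word w = syls (wb_tgt w) @ syls (wb_str w) @ syls (wb_src w)"

text \<open>
  For \<open>b\<^sub>2 u b\<^sub>1 = \<beta>\<^sub>n \<dots> \<beta>\<^sub>1 b\<^sub>1\<close> the list \<open>initial_part w k\<close> is \<open>\<beta>\<^sub>k \<dots> \<beta>\<^sub>1 b\<^sub>1\<close>.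
  Occurrences of syllables are given by the number of syllables on one side of them: the exit
  of \<open>w\<close> is the syllable of \<open>full_word w\<close> that has \<open>exit_offset w\<close> syllables to its right.
  Inversion reverses \<open>full_word w\<close>, so the entry of \<open>w\<close> is the syllable of
  \<open>full_word w\<close> that has \<open>entry_offset w\<close> syllables to its left.
\<close>

definition initial_part :: "('v, 'a) arrow_of_bands \<Rightarrow> nat \<Rightarrow> 'a syllable list" where
  "initial_part w k =
     (let l = full_word w in drop (length l - (length (syls (wb_src w)) + k)) l)"

definition exit_index :: "('v, 'a) arrow_of_bands \<Rightarrow> nat" where
  "exit_index w =
     (LEAST k. 1 \<le> k \<and> length (syls (wb_src w)) + k \<le> length (full_word w) \<and>
        \<not> (\<exists>m. sublist (initial_part w k) (list_pow (syls (wb_src w)) m)))"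

definition exit_offset :: "('v, 'a) arrow_of_bands \<Rightarrow> nat" where
  "exit_offset w = length (syls (wb_src w)) + exit_index w - 1"

definition wb_inv :: "('v, 'a) arrow_of_bands \<Rightarrow> ('v, 'a) arrow_of_bands" where
  "wb_inv w = WB (str_inv (wb_tgt w)) (str_inv (wb_str w)) (str_inv (wb_src w))"

definition entry_offset :: "('v, 'a) arrow_of_bands \<Rightarrow> nat" where
  "entry_offset w = exit_offset (wb_inv w)"

definition normal_weak_bridge :: "('v, 'a) arrow_of_bands \<Rightarrow> bool" where
  "normal_weak_bridge w \<longleftrightarrow>
     (\<exists>y\<^sub>1 x y\<^sub>2. full_word w = y\<^sub>2 @ x @ y\<^sub>1 \<and> x \<noteq> [] \<and>
        length y\<^sub>1 = exit_offset w \<and> length y\<^sub>2 = entry_offset w)"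

abbreviation abnormal_weak_bridge :: "('v, 'a) arrow_of_bands \<Rightarrow> bool" where
  "abnormal_weak_bridge w \<equiv> \<not> normal_weak_bridge w"

end

theory Submission
  imports Defs
begin

text \<open>
  A weak bridge \<open>u : b\<^sub>1 \<rightarrow> b\<^sub>2\<close> is identified with the bi-infinite string
  \<open>W = \<dots> b\<^sub>2 b\<^sub>2 u b\<^sub>1 b\<^sub>1 \<dots>\<close>, from which it can be recovered.  Relations are monotone, hence two strings
  can be spliced wherever they share a turn, and a splice can fail only because of a long monotone
  window.  Domesticity means that periodic strings \<open>X \<noteq> Y\<close> cannot be spliced in both orders, as
  \<open>x\<^sup>k y\<close> would otherwise produce infinitely many bands.  A factorization of \<open>u\<close> through \<open>b\<close> is a
  position at which the periodic string \<open>X\<close> of \<open>b\<close> can be spliced with \<open>W\<close> in both orders; looking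
  at a position where \<open>X\<close> follows \<open>W\<close> for as long as possible, one finds that such a position exists
  if and only if \<open>u\<close> is not a bridge.  The string of an abnormal bridge is a splice of two periodic
  strings, and that of a composite of abnormal bridges is a succession of such splices.  Let
  \<open>u = u\<^sub>n \<circ> v\<close>, where \<open>v\<close> is such a composite, and let \<open>u = w\<^sub>m \<circ> v'\<close> be another factorization
  with bridges \<open>u\<^sub>n\<close>, \<open>w\<^sub>m\<close>.  If the two periodic strings differed, the one would provide a
  factorization of \<open>u\<^sub>n\<close> or of \<open>w\<^sub>m\<close> unless a monotone window obstructs it, and the splices that make
  up \<open>v\<close> exclude this.  So the last factors agree, and induction applies to \<open>v = v'\<close>.
\<close>

(* HOL-Algebra declares X followed by an index as notation for a polynomial variable. *)
no_notation var (\<open>X\<index>\<close>)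

section \<open>Bi-infinite strings\<close>

text \<open>A composition may delete a copy of the band, and its definition does not say which copy.
  In bi-infinite words products and removals become the same datum: a periodic word X touching W,
  with factors X | W and W | X, where X | W stands for \<open>join p X W\<close>. A band starts and
  ends at a turn, so the ends of a weak bridge sit at turns of its two tails, the cuts. The
  composition is a plain product or a removal according to whether a cut of X lies in the stretch on
  which X follows W; taking a longest stretch keeps both factors band-free. Abnormality is assumed
  for one of the two factorizations only, so the two touching words play different roles. For X one
  also knows the periodic word C to which X gives way at f, and C turns there. Comparing the other
  touching word Y with C is what refutes the monotone windows.\<close>

lemma first_diff:
  fixes r h :: int
  assumes "r \<le> h" "P h"
  obtains k where "r \<le> k" "k \<le> h" "P k" "\<And>i. r \<le> i \<Longrightarrow> i < k \<Longrightarrow> \<not> P i"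
proof -
  define n where "n = (LEAST n. P (r + int n))"
  have ex: "P (r + int (nat (h - r)))" using assms by simp
  have 1: "P (r + int n)" unfolding n_def using ex by (rule LeastI)
  have 2: "n \<le> nat (h - r)" unfolding n_def using ex by (rule Least_le)
  have 3: "\<not> P i" if "r \<le> i" "i < r + int n" for i
  proof
    assume "P i"
    then have "P (r + int (nat (i - r)))" using that by simp
    then have "n \<le> nat (i - r)" unfolding n_def by (rule Least_le)
    then show False using that by linarith
  qed
  show thesis using that[of "r + int n"] 1 2 3 assms by auto
qed

lemma last_diff:
  fixes r h :: int
  assumes "h \<le> r" "P h"
  obtains k where "h \<le> k" "k \<le> r" "P k" "\<And>i. k < i \<Longrightarrow> i \<le> r \<Longrightarrow> \<not> P i"
proof -
  obtain k where k: "- r \<le> k" "k \<le> - h" "P (- k)"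
      "\<And>i. - r \<le> i \<Longrightarrow> i < k \<Longrightarrow> \<not> P (- i)"
    using first_diff[of "- r" "- h" "\<lambda>i. P (- i)"] assms by auto
  show thesis
  proof (rule that[of "- k"])
    show "\<not> P i" if "- k < i" "i \<le> r" for i
      using k(4)[of "- i"] that by simp
  qed (use k in auto)
qed

section \<open>Periodic functions on the integers\<close>

lemma periodic_mult:
  fixes X :: "int \<Rightarrow> 'l"
  assumes "\<forall>i. X (i + n) = X i"
  shows "X (i + n * k) = X i"
proof -
  have nat: "X (i + n * int m) = X i" for m i
  proof (induction m)
    case (Suc m)
    have "X (i + n * int (Suc m)) = X ((i + n * int m) + n)" by (simp add: algebra_simps)
    then show ?case using assms Suc by simp
  qed simp
  show ?thesis
  proof (cases "k \<ge> 0")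
    case True
    then show ?thesis using nat[of i "nat k"] by simp
  next
    case False
    then have "X ((i + n * k) + n * int (nat (- k))) = X (i + n * k)" by (intro nat)
    then show ?thesis using False by (simp add: algebra_simps)
  qed
qed

text \<open>A multiple of the common period \<open>n * m\<close> moves any position beyond
  \<open>a\<close>.\<close>

lemma periodic_eq:
  fixes X Y :: "int \<Rightarrow> 'l"
  assumes "n > 0" "\<forall>i. X (i + n) = X i" "m > 0" "\<forall>i. Y (i + m) = Y i"
    and eq: "\<And>i. a \<le> i \<Longrightarrow> X i = Y i"
  shows "X = Y"
proof
  fix i
  define k where "k = \<bar>a\<bar> + \<bar>i\<bar>"
  have "n * m \<ge> 1" using assms by (simp add: pos_zmult_eq_1_iff int_one_le_iff_zero_less)
  moreover have "k \<ge> 0" unfolding k_def by simp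
  ultimately have "k * 1 \<le> k * (n * m)" by (intro mult_left_mono)
  then have "i + n * (m * k) \<ge> a" unfolding k_def by (simp add: algebra_simps)
  then have "X (i + n * (m * k)) = Y (i + m * (n * k))" using eq by (simp add: algebra_simps)
  then show "X i = Y i" unfolding periodic_mult[OF assms(2)] periodic_mult[OF assms(4)] .
qed

lemma periodic_eq_left:
  fixes X Y :: "int \<Rightarrow> 'l"
  assumes "n > 0" "\<forall>i. X (i + n) = X i" "m > 0" "\<forall>i. Y (i + m) = Y i"
    and eq: "\<And>i. i < a \<Longrightarrow> X i = Y i"
  shows "X = Y"
proof
  fix i
  define k where "k = \<bar>a\<bar> + \<bar>i\<bar> + 1"
  have "n * m \<ge> 1" using assms by (simp add: pos_zmult_eq_1_iff int_one_le_iff_zero_less)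
  moreover have "k \<ge> 0" unfolding k_def by simp
  ultimately have "k * 1 \<le> k * (n * m)" by (intro mult_left_mono)
  then have "i + n * (m * (- k)) < a" unfolding k_def by (simp add: algebra_simps)
  then have "X (i + n * (m * (- k))) = Y (i + m * (n * (- k)))" using eq by (simp add: algebra_simps)
  then show "X i = Y i" unfolding periodic_mult[OF assms(2)] periodic_mult[OF assms(4)] .
qed

text \<open>Positions increase from left to right in the written order of words, so that the source end
  of a bi-infinite word is at \<open>+\<infinity>\<close> and its target end at \<open>-\<infinity>\<close>.\<close>

definition join :: "int \<Rightarrow> (int \<Rightarrow> 'l) \<Rightarrow> (int \<Rightarrow> 'l) \<Rightarrow> int \<Rightarrow> 'l" where
  "join p X Y = (\<lambda>i. if i < p then X i else Y i)"

lemma join_left [simp]: "i < p \<Longrightarrow> join p X Y i = X i"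
  and join_right [simp]: "p \<le> i \<Longrightarrow> join p X Y i = Y i"
  by (auto simp: join_def)

lemma join_move:
  assumes "\<And>i. p \<le> i \<Longrightarrow> i < q \<Longrightarrow> X i = Y i" "p \<le> q"
  shows "join p X Y = join q X Y"
proof
  fix i show "join p X Y i = join q X Y i" using assms by (cases "i < p"; cases "i < q") auto
qed

text \<open>\<open>T a b\<close> allows \<open>a\<close> to stand immediately left of \<open>b\<close>, \<open>dir\<close> separates direct from inverse
  syllables, and \<open>Rel\<close> collects the relations and their inverses.\<close>

locale words =
  fixes T :: "'l \<Rightarrow> 'l \<Rightarrow> bool" and dir :: "'l \<Rightarrow> bool" and Rel :: "'l list set"
  assumes succ_unique: "T a b \<Longrightarrow> T a b' \<Longrightarrow> dir b = dir b' \<Longrightarrow> b = b'"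
    and pred_unique: "T a b \<Longrightarrow> T a' b \<Longrightarrow> dir a = dir a' \<Longrightarrow> a = a'"
    and cross: "T a x \<Longrightarrow> T c x \<Longrightarrow> T c b \<Longrightarrow> dir a \<noteq> dir b \<Longrightarrow> T a b"
    and rel_mono: "r \<in> Rel \<Longrightarrow> a \<in> set r \<Longrightarrow> b \<in> set r \<Longrightarrow> dir a = dir b"
begin

section \<open>Strings and their splices\<close>

definition Str :: "(int \<Rightarrow> 'l) \<Rightarrow> bool" where
  "Str W \<longleftrightarrow> (\<forall>i. T (W i) (W (i + 1))) \<and>
     (\<forall>r\<in>Rel. \<forall>i. \<not> (\<forall>k<length r. W (i + int k) = r ! k))"

definition periodic :: "(int \<Rightarrow> 'l) \<Rightarrow> bool" where
  "periodic X \<longleftrightarrow> Str X \<and> (\<exists>n>0. \<forall>i. X (i + n) = X i)"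

lemma periodic_Str [simp]: "periodic X \<Longrightarrow> Str X"
  by (simp add: periodic_def)

lemma Str_T: "Str W \<Longrightarrow> T (W (i - 1)) (W i)"
  unfolding Str_def by (metis diff_add_cancel)

lemma Str_spl_T: "Str (join p X Y) \<Longrightarrow> T (X (p - 1)) (Y p)"
  using Str_T[of "join p X Y" p] by simp

text \<open>An occurrence of a relation is monotone by \<open>rel_mono\<close>, so it lies in a
  monotone window. It is enough that each such window occurs in some string, possibly a different
  one each time.\<close>

lemma Str_local:
  assumes pair: "\<And>i. T (Z i) (Z (i + 1))"
    and win: "\<And>i j. i < j \<Longrightarrow> (\<And>k. i \<le> k \<Longrightarrow> k < j \<Longrightarrow> dir (Z k) = dir (Z i)) \<Longrightarrow>
       \<exists>A. Str A \<and> (\<forall>k. i \<le> k \<and> k < j \<longrightarrow> A k = Z k)"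
  shows "Str Z"
proof -
  have False if r: "r \<in> Rel" and oc: "\<forall>k<length r. Z (i + int k) = r ! k" for r i
  \<comment> \<open>The locale does not exclude an empty relation. It would occur in every word, so
    the string that \<open>win\<close> supplies for the one-letter window at 0 already contradicts
    it.\<close>
  proof (cases "r = []")
    case True
    have "\<exists>A. Str A \<and> (\<forall>k. 0 \<le> k \<and> k < 1 \<longrightarrow> A k = Z k)"
    proof (rule win)
      fix k :: int assume "0 \<le> k" "k < 1"
      then have "k = 0" by simp
      then show "dir (Z k) = dir (Z 0)" by simp
    qed simp
    then show False using r True unfolding Str_def by fastforce
  next
    case False
    have *: "Z k \<in> set r" if "i \<le> k" "k < i + int (length r)" for k
    proof -
      have "nat (k - i) < length r" using that by linarith
      then have "Z (i + int (nat (k - i))) \<in> set r" using oc nth_mem by metis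
      moreover have "i + int (nat (k - i)) = k" using that by simp
      ultimately show ?thesis by metis
    qed
    have "\<exists>A. Str A \<and> (\<forall>k. i \<le> k \<and> k < i + int (length r) \<longrightarrow> A k = Z k)"
    proof (rule win)
      fix k assume "i \<le> k" "k < i + int (length r)"
      then show "dir (Z k) = dir (Z i)" by (intro rel_mono[OF r] *) (use False in auto)
    qed (use False in auto)
    then obtain A where A: "Str A" "\<forall>k. i \<le> k \<and> k < i + int (length r) \<longrightarrow> A k = Z k"
      by blast
    then have "\<forall>k<length r. A (i + int k) = r ! k" using oc by auto
    then show False using A(1) r unfolding Str_def by blast
  qed
  then show ?thesis unfolding Str_def using pair by blast
qed

lemma Str_shift:
  assumes "Str W" shows "Str (\<lambda>i. W (i + n))"
  unfolding Str_def
proof (intro conjI allI ballI notI)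
  fix i
  have "T (W (i + n)) (W ((i + n) + 1))" using assms unfolding Str_def by blast
  then show "T (W (i + n)) (W (i + 1 + n))" by (simp add: algebra_simps)
next
  fix r i assume r: "r \<in> Rel" and "\<forall>k<length r. W (i + int k + n) = r ! k"
  then have "\<forall>k<length r. W ((i + n) + int k) = r ! k" by (simp add: algebra_simps)
  then show False using assms r unfolding Str_def by blast
qed

lemma periodic_shift: "periodic X \<Longrightarrow> periodic (\<lambda>i. X (i + n))"
proof -
  assume X: "periodic X"
  then obtain m where m: "m > 0" "\<forall>i. X (i + m) = X i" unfolding periodic_def by blast
  have "X (i + m + n) = X (i + n)" for i using m(2)[rule_format, of "i + n"] by (simp add: algebra_simps)
  then show ?thesis using X m(1) Str_shift unfolding periodic_def by blast
qed

text \<open>The turn at t keeps every monotone window on one side of the cut, hence inside D or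
  inside E.\<close>

lemma glue:
  assumes "Str D" "Str E" "dir (D (t - 1)) \<noteq> dir (E t)" "T (D (t - 1)) (E t)"
  shows "Str (join t D E)"
proof (rule Str_local)
  fix i
  show "T (join t D E i) (join t D E (i + 1))"
  proof (cases "i + 1 = t")
    case True
    then have "i = t - 1" by simp
    then show ?thesis using assms(4) by simp
  next
    case False
    then consider "i + 1 < t" | "t \<le> i" by linarith
    then show ?thesis using assms(1,2) unfolding Str_def by cases auto
  qed
next
  fix i j :: int
  assume "i < j" and m: "\<And>k. i \<le> k \<Longrightarrow> k < j \<Longrightarrow> dir (join t D E k) = dir (join t D E i)"
  show "\<exists>A. Str A \<and> (\<forall>k. i \<le> k \<and> k < j \<longrightarrow> A k = join t D E k)"
  proof (cases "i < t \<and> t < j")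
    case True
    then have "dir (join t D E (t - 1)) = dir (join t D E t)" using m[of "t - 1"] m[of t] by simp
    then show ?thesis using assms(3) by simp
  next
    case False
    then show ?thesis
    proof (cases "t \<le> i")
      case True then show ?thesis using assms(2) by (auto simp: join_def intro!: exI[of _ E])
    next
      case False
      then have "j \<le> t" using \<open>\<not> (i < t \<and> t < j)\<close> by simp
      then show ?thesis using assms(1) by (auto simp: join_def intro!: exI[of _ D])
    qed
  qed
qed

text \<open>One common letter next to the cut makes the junction an existing pair: a pair of E here,
  a pair of D in \<open>glue_turn'\<close>.\<close>

lemma glue_turn:
  assumes "Str D" "Str E" "D (t - 1) = E (t - 1)" "dir (E (t - 1)) \<noteq> dir (E t)"
  shows "Str (join t D E)"
  using glue[of D E t] assms(1,2,4) Str_T[of E t] unfolding assms(3) by blast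

lemma glue_turn':
  assumes "Str D" "Str E" "D t = E t" "dir (D (t - 1)) \<noteq> dir (D t)"
  shows "Str (join t D E)"
  using glue[of D E t] assms(1,2,4) Str_T[of D t] unfolding assms(3) by blast

lemma succ_neq: "T a b \<Longrightarrow> T a b' \<Longrightarrow> b \<noteq> b' \<Longrightarrow> dir b' = (\<not> dir b)"
  using succ_unique by blast

lemma pred_neq: "T a b \<Longrightarrow> T a' b \<Longrightarrow> a \<noteq> a' \<Longrightarrow> dir a' = (\<not> dir a)"
  using pred_unique by blast

text \<open>A failing splice is always witnessed by a monotone window that spans the whole middle part,
  because relations are monotone and turns at the splice points are harmless by the assumption \<open>cross\<close>.\<close>

lemma obstruction3:
  assumes "Str W" "Str (join q Y W)" "Str (join p W X)" "q \<le> p"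
    and n: "\<not> Str (join q Y (join p W X))"
  obtains g h d where "g < q" "p < h" "\<And>k. g \<le> k \<Longrightarrow> k < q \<Longrightarrow> dir (Y k) = d"
    "\<And>k. q \<le> k \<Longrightarrow> k < p \<Longrightarrow> dir (W k) = d" "\<And>k. p \<le> k \<Longrightarrow> k < h \<Longrightarrow> dir (X k) = d"
    "\<And>A. Str A \<Longrightarrow> (\<And>k. g \<le> k \<Longrightarrow> k < q \<Longrightarrow> A k = Y k) \<Longrightarrow>
      (\<And>k. q \<le> k \<Longrightarrow> k < p \<Longrightarrow> A k = W k) \<Longrightarrow>
      (\<And>k. p \<le> k \<Longrightarrow> k < h \<Longrightarrow> A k = X k) \<Longrightarrow> False"
proof -
  define Z where "Z = join q Y (join p W X)"
  have Zl: "Z i = join q Y W i" if "i < p" for i using that by (simp add: Z_def join_def)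
  have Zr: "Z i = join p W X i" if "q \<le> i" for i using that by (simp add: Z_def join_def)
  have "\<exists>g h d. g < q \<and> p < h \<and> (\<forall>k. g \<le> k \<and> k < h \<longrightarrow> dir (Z k) = d) \<and>
     (\<forall>A. Str A \<longrightarrow> \<not> (\<forall>k. g \<le> k \<and> k < h \<longrightarrow> A k = Z k))"
  proof (rule ccontr)
    assume neg0: "\<not> ?thesis"
    have neg: "\<exists>A. Str A \<and> (\<forall>k. g \<le> k \<and> k < h \<longrightarrow> A k = Z k)"
      if "g < q" "p < h" "\<And>k. g \<le> k \<Longrightarrow> k < h \<Longrightarrow> dir (Z k) = d" for g h d
    proof (rule ccontr)
      assume c: "\<not> ?thesis"
      show False by (rule neg0[THEN notE], intro exI[of _ g] exI[of _ h] exI[of _ d]) (use that c in blast)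
    qed
    have "Str Z"
    proof (rule Str_local)
      fix i
      show "T (Z i) (Z (i + 1))"
      proof (rule ccontr)
        \<comment> \<open>A bad pair belongs to neither of the two given splices, so it straddles
          both cuts and the middle part is empty. By \<open>cross\<close> its two letters have the
          same direction, hence they form a monotone window themselves.\<close>
        assume nT: "\<not> T (Z i) (Z (i + 1))"
        have "\<not> i + 1 < p"
        proof
          assume "i + 1 < p"
          then have "Z i = join q Y W i" "Z (i + 1) = join q Y W (i + 1)" by (simp_all add: Zl)
          then show False using nT assms(2) unfolding Str_def by metis
        qed
        moreover have "\<not> q \<le> i"
        proof
          assume "q \<le> i"
          then have "Z i = join p W X i" "Z (i + 1) = join p W X (i + 1)" by (simp_all add: Zr)
          then show False using nT assms(3) unfolding Str_def by metis
        qed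
        ultimately have qp: "q = p" "i = p - 1" using assms(4) by auto
        have e: "Z i = Y (p - 1)" "Z (i + 1) = X p" using qp by (auto simp: Z_def)
        have "T (Y (p - 1)) (W p)" "T (W (p - 1)) (W p)" "T (W (p - 1)) (X p)"
          using Str_T[OF assms(1)] Str_spl_T[OF assms(2)] Str_spl_T[OF assms(3)] qp by auto
        then have "dir (Z i) = dir (Z (i + 1))" using cross nT unfolding e by blast
        have same: "dir (Z k) = dir (Z i)" if "p - 1 \<le> k" "k < p + 1" for k
        proof -
          have "k = i \<or> k = i + 1" using that qp by linarith
          then show ?thesis using \<open>dir (Z i) = dir (Z (i + 1))\<close> by metis
        qed
        obtain A where A: "Str A" "\<forall>k. p - 1 \<le> k \<and> k < p + 1 \<longrightarrow> A k = Z k"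
          using neg[of "p - 1" "p + 1", OF _ _ same] qp(1) by force
        have "A i = Z i" "A (i + 1) = Z (i + 1)" using A(2) qp(2) by simp_all
        then have "T (Z i) (Z (i + 1))" using A(1) unfolding Str_def by metis
        then show False using nT by simp
      qed
    next
      fix i j :: int
      assume "i < j" and m: "\<And>k. i \<le> k \<Longrightarrow> k < j \<Longrightarrow> dir (Z k) = dir (Z i)"
      consider "j \<le> p" | "q \<le> i" | "i < q" "p < j" by linarith
      then show "\<exists>A. Str A \<and> (\<forall>k. i \<le> k \<and> k < j \<longrightarrow> A k = Z k)"
      proof cases
        case 1 then show ?thesis using assms(2) Zl by (intro exI[of _ "join q Y W"]) auto
      next
        case 2 then show ?thesis using assms(3) Zr by (intro exI[of _ "join p W X"]) auto
      next
        case 3 show ?thesis by (rule neg[OF 3, of "dir (Z i)"]) (rule m)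
      qed
    qed
    then show False using n Z_def by simp
  qed
  then obtain g h d where 1: "g < q" "p < h" "\<forall>k. g \<le> k \<and> k < h \<longrightarrow> dir (Z k) = d"
     and 2: "\<And>A. Str A \<Longrightarrow> \<not> (\<forall>k. g \<le> k \<and> k < h \<longrightarrow> A k = Z k)" by blast
  show thesis
  proof (rule that[OF 1(1,2)])
    show "dir (Y k) = d" if "g \<le> k" "k < q" for k
      using 1(3)[rule_format, of k] that 1 assms(4) by (simp add: Z_def)
    show "dir (W k) = d" if "q \<le> k" "k < p" for k
      using 1(3)[rule_format, of k] that 1 assms(4) by (simp add: Z_def)
    show "dir (X k) = d" if "p \<le> k" "k < h" for k
      using 1(3)[rule_format, of k] that 1 assms(4) by (simp add: Z_def)
    show False if "Str A" "\<And>k. g \<le> k \<Longrightarrow> k < q \<Longrightarrow> A k = Y k"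
      "\<And>k. q \<le> k \<Longrightarrow> k < p \<Longrightarrow> A k = W k" "\<And>k. p \<le> k \<Longrightarrow> k < h \<Longrightarrow> A k = X k" for A
    proof -
      have "A k = Z k" if "g \<le> k" "k < h" for k
        using \<open>\<And>k. g \<le> k \<Longrightarrow> k < q \<Longrightarrow> A k = Y k\<close> \<open>\<And>k. q \<le> k \<Longrightarrow> k < p \<Longrightarrow> A k = W k\<close>
          \<open>\<And>k. p \<le> k \<Longrightarrow> k < h \<Longrightarrow> A k = X k\<close> that by (auto simp: Z_def join_def)
      then show False using 2[OF that(1)] by blast
    qed
  qed
qed

text \<open>The case of an empty middle part. The splice X | C in the other order serves as the
  middle word, because putting C on its left or X on its right gives back the strings C and
  X.\<close>

lemma obstruction2:
  assumes "Str X" "Str C" "Str (join p X C)" "\<not> Str (join p C X)"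
  obtains g h d where "g < p" "p < h" "\<And>k. g \<le> k \<Longrightarrow> k < p \<Longrightarrow> dir (C k) = d"
    "\<And>k. p \<le> k \<Longrightarrow> k < h \<Longrightarrow> dir (X k) = d"
    "\<And>A. Str A \<Longrightarrow> (\<And>k. g \<le> k \<Longrightarrow> k < p \<Longrightarrow> A k = C k) \<Longrightarrow>
      (\<And>k. p \<le> k \<Longrightarrow> k < h \<Longrightarrow> A k = X k) \<Longrightarrow> False"
proof -
  have e: "join p C (join p X C) = C" "join p (join p X C) X = X"
    "join p C (join p (join p X C) X) = join p C X" by (auto simp: join_def)
  have 1: "Str (join p C (join p X C))" "Str (join p (join p X C) X)"
    "\<not> Str (join p C (join p (join p X C) X))" using assms e by simp_all
  show thesis
  proof (rule obstruction3[OF assms(3) 1(1,2) order_refl 1(3)])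
    fix g h d
    assume a: "g < p" "p < h" "\<And>k. g \<le> k \<Longrightarrow> k < p \<Longrightarrow> dir (C k) = d"
      "\<And>k. p \<le> k \<Longrightarrow> k < h \<Longrightarrow> dir (X k) = d"
     and b: "\<And>A. Str A \<Longrightarrow> (\<And>k. g \<le> k \<Longrightarrow> k < p \<Longrightarrow> A k = C k) \<Longrightarrow>
      (\<And>k. p \<le> k \<Longrightarrow> k < p \<Longrightarrow> A k = join p X C k) \<Longrightarrow>
      (\<And>k. p \<le> k \<Longrightarrow> k < h \<Longrightarrow> A k = X k) \<Longrightarrow> False"
    show thesis
    proof (rule that[OF a])
      fix A assume "Str A" "\<And>k. g \<le> k \<Longrightarrow> k < p \<Longrightarrow> A k = C k" "\<And>k. p \<le> k \<Longrightarrow> k < h \<Longrightarrow> A k = X k"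
      then show False by (intro b[of A]) simp_all
    qed
  qed
qed

end

section \<open>Periodic strings in the domestic case\<close>

locale domestic_words = words T dir Rel
  for T :: "'l \<Rightarrow> 'l \<Rightarrow> bool" and dir :: "'l \<Rightarrow> bool" and Rel :: "'l list set" +
  assumes mono_bound: "\<exists>N>0. \<forall>W i. Str W \<longrightarrow> (\<exists>k. i < k \<and> k < i + N \<and> dir (W k) \<noteq> dir (W i))"
    and dom: "\<exists>L. \<forall>W m. Str W \<longrightarrow> m > 0 \<longrightarrow> (\<forall>i. W (i + m) = W i) \<longrightarrow>
       (\<exists>n>0. n \<le> L \<and> (\<forall>i. W (i + n) = W i))"
begin

lemma turn_between:
  assumes "a < b" "dir (W a) \<noteq> dir (W b)"
  obtains t :: int where "a < t" "t \<le> b" "dir (W (t - 1)) = dir (W a)" "dir (W t) = dir (W b)"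
proof -
  obtain k where k: "a \<le> k" "k \<le> b" "dir (W k) \<noteq> dir (W a)"
    "\<And>i. a \<le> i \<Longrightarrow> i < k \<Longrightarrow> \<not> dir (W i) \<noteq> dir (W a)"
    by (rule first_diff[of a b "\<lambda>i. dir (W i) \<noteq> dir (W a)"]) (use assms in auto)
  have "k \<noteq> a" using k(3) by auto
  then have "dir (W (k - 1)) = dir (W a)" using k(4)[of "k - 1"] k(1) by simp
  moreover have "dir (W k) = dir (W b)" using k(3) assms(2) by (cases "dir (W k)") simp_all
  moreover have "a < k" using \<open>k \<noteq> a\<close> k(1) by simp
  ultimately show thesis using that k(2) by blast
qed

lemma turn_after:
  assumes "Str W"
  obtains t where "p < t" "dir (W (t - 1)) \<noteq> dir (W t)"
proof -
  obtain N where N: "\<forall>W i. Str W \<longrightarrow> (\<exists>k. i < k \<and> k < i + N \<and> dir (W k) \<noteq> dir (W i))"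
    using mono_bound by (elim exE conjE)
  obtain k where k: "p < k" "dir (W k) \<noteq> dir (W p)" using N[rule_format, OF assms, of p] by (elim exE conjE)
  show thesis by (rule turn_between[OF k(1), of W]) (use k that in auto)
qed

text \<open>With \<open>x\<close> a period of \<open>X\<close> and \<open>y\<close> the way back to \<open>X\<close> along \<open>W\<close>, all words
  \<open>(x\<^sup>k y)\<^sup>\<infinity>\<close> are strings.  Their minimal periods are bounded, so for large \<open>k\<close> the period of the part
  \<open>x\<^sup>k\<close> spreads to the whole word.\<close>

lemma loop:
  assumes X: "periodic X" and W: "Str W" and l: "\<And>i. i < p \<Longrightarrow> W i = X i"
    and r: "\<And>i. q \<le> i \<Longrightarrow> W (i + e) = X i"
  shows "W = X"
proof
  fix i0
  obtain n where n: "n > 0" "\<forall>i. X (i + n) = X i" using X unfolding periodic_def by blast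
  obtain N where N: "N > 0" "\<forall>W i. Str W \<longrightarrow> (\<exists>k. i < k \<and> k < i + N \<and> dir (W k) \<noteq> dir (W i))"
    using mono_bound by (elim exE conjE)
  obtain L where L: "\<forall>W m. Str W \<longrightarrow> m > 0 \<longrightarrow> (\<forall>i. W (i + m) = W i) \<longrightarrow>
       (\<exists>n>0. n \<le> L \<and> (\<forall>i. W (i + n) = W i))" using dom by (elim exE)
  have Xp: "X (i + n * k) = X i" for i k by (rule periodic_mult[OF n(2)])
  \<comment> \<open>K is a multiple of the period n, so the K letters left of p are c full periods
    of X. \<open>K \<ge> L + n\<close> will let a period of size at most L inherit the period n, and
    \<open>K \<ge> N\<close> bounds the monotone windows.\<close>
  define c where "c = \<bar>L\<bar> + n + N + 2"
  define K where "K = n * c"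
  have "1 * c \<le> n * c" using n N unfolding c_def by (intro mult_right_mono) auto
  then have K: "K \<ge> L + n" "K \<ge> N" "K \<ge> 2" unfolding K_def using n N by (auto simp: c_def)
  define m where "m = \<bar>q\<bar> + \<bar>p\<bar> + \<bar>e\<bar> + \<bar>i0\<bar> + 1"
  \<comment> \<open>From s on, W repeats what X reads from p on. The multiple of n pushes s beyond
    i0, so that i0 lies in the left tail or inside the loop.\<close>
  define s where "s = p + n * m + e"
  have "1 * m \<le> n * m" using n unfolding m_def by (intro mult_right_mono) auto
  then have nm: "n * m \<ge> m" by simp
  have s: "s > i0" "s > p" "p + n * m \<ge> q" unfolding s_def using nm unfolding m_def by linarith+
  have Ws: "W (s + j) = X (p + j)" if "j \<ge> 0" for j
  proof -
    have "W ((p + n * m + j) + e) = X (p + n * m + j)" using s(3) that by (intro r) simp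
    moreover have "X (p + n * m + j) = X (p + j)" using Xp[of "p + j" m] by (simp add: algebra_simps)
    ultimately show ?thesis unfolding s_def by (simp add: algebra_simps)
  qed
  have Wp: "W (p - K + j) = X (p + j)" if "j < K" for j
  proof -
    have "X (p + j) = X (p - K + j)" using Xp[of "p - K + j" c] unfolding K_def by (simp add: algebra_simps)
    then show ?thesis using l[of "p - K + j"] that by simp
  qed
  define P where "P = K + s - p"
  have P: "P > K" "P > 0" unfolding P_def using s K by auto
  \<comment> \<open>F repeats the stretch of W from \<open>p - K\<close> to s: c periods of X,
    followed by the way back along W.\<close>
  define F where "F i = W (p - K + (i mod P))" for i
  \<comment> \<open>Running past the end of a period of F by fewer than K letters still reads W,
    since both continuations follow X there. So every short window of F occurs in W.\<close>
  have Fw: "F (i + k) = W (p - K + (i mod P) + k)" if "0 \<le> k" "(i mod P) + k < P + K" for i k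
  proof (cases "(i mod P) + k < P")
    case True
    have "(i + k) mod P = (i mod P + k) mod P" by (simp add: mod_simps)
    also have "\<dots> = i mod P + k" using True that P by (intro mod_pos_pos_trivial) auto
    finally show ?thesis unfolding F_def by (simp add: algebra_simps)
  next
    case False
    have "(i + k) mod P = (i mod P + k) mod P" by (simp add: mod_simps)
    also have "\<dots> = (i mod P + k - P) mod P" by (metis minus_mod_self2)
    also have "\<dots> = i mod P + k - P" using False that P by (intro mod_pos_pos_trivial) auto
    finally have 1: "(i + k) mod P = i mod P + k - P" .
    have "W (p - K + (i mod P + k - P)) = X (p + (i mod P + k - P))" using that by (intro Wp) auto
    also have "\<dots> = W (s + (i mod P + k - P))" using False by (intro Ws[symmetric]) auto
    also have "s + (i mod P + k - P) = p - K + (i mod P) + k" unfolding P_def by simp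
    finally show ?thesis unfolding F_def 1 .
  qed
  have mP: "0 \<le> i mod P" "i mod P < P" for i using P by auto
  have "Str F"
  proof (rule Str_local)
    fix i
    have "F i = W (p - K + (i mod P))" by (simp add: F_def)
    moreover have "F (i + 1) = W (p - K + (i mod P) + 1)" using mP[of i] K P by (intro Fw) linarith+
    ultimately show "T (F i) (F (i + 1))" using W unfolding Str_def by metis
  next
    fix i j assume ij: "i < j" and mo: "\<And>k. i \<le> k \<Longrightarrow> k < j \<Longrightarrow> dir (F k) = dir (F i)"
    define b where "b = p - K + (i mod P)"
    have Fb: "F k = W (b + (k - i))" if "i \<le> k" "k - i < K" for k
      using Fw[of "k - i" i] that mP[of i] unfolding b_def by simp
    have "j - i \<le> K"
    proof (rule ccontr)
      assume "\<not> j - i \<le> K"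
      obtain k where k: "b < k" "k < b + N" "dir (W k) \<noteq> dir (W b)"
        using N(2)[rule_format, OF W, of b] by (elim exE conjE)
      have "dir (F (i + (k - b))) = dir (F i)" using k \<open>\<not> j - i \<le> K\<close> K by (intro mo) linarith+
      moreover have "F i = W b" using Fb[of i] K by simp
      moreover have "F (i + (k - b)) = W k" using Fb[of "i + (k - b)"] k K by simp
      ultimately show False using k by simp
    qed
    have "W (k + (b - i)) = F k" if "i \<le> k" "k < j" for k
    proof -
      have "F k = W (b + (k - i))" using that \<open>j - i \<le> K\<close> by (intro Fb) linarith+
      also have "b + (k - i) = k + (b - i)" by simp
      finally show ?thesis by simp
    qed
    then show "\<exists>A. Str A \<and> (\<forall>k. i \<le> k \<and> k < j \<longrightarrow> A k = F k)"
      by (intro exI[of _ "\<lambda>k. W (k + (b - i))"] conjI Str_shift[OF W]) simp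
  qed
  moreover have "\<forall>i. F (i + P) = F i" unfolding F_def by simp
  ultimately obtain t where t: "t > 0" "t \<le> L" "\<forall>i. F (i + t) = F i" 
    using L[rule_format, of F P] P by (metis (no_types))
  have Ft: "F (i + t * k) = F i" for i k by (rule periodic_mult[OF t(3)])
  have FX: "F i = X (p + i)" if "0 \<le> i" "i < K" for i
    unfolding F_def using that P Wp[of i] by (simp add: mod_pos_pos_trivial)
  \<comment> \<open>Every residue modulo t \<le> L has a representative among the first L letters of
    F. These, and the letters n further on, lie in the part that reads X, so n is a period of F
    everywhere.\<close>
  have Fn1: "\<forall>i. F (i + n) = F i"
  proof
    fix i
    define a where "a = i mod t"
    have ia: "i = a + t * (i div t)" unfolding a_def by simp
    have a: "0 \<le> a" "a < t" unfolding a_def using t by auto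
    have "i + n = (a + n) + t * (i div t)" using ia by linarith
    then have "F (i + n) = F (a + n)" by (simp only: Ft)
    also have "\<dots> = X (p + (a + n))" using a t n K by (intro FX) linarith+
    also have "\<dots> = X (p + a)" using n(2)[rule_format, of "p + a"] by (simp add: algebra_simps)
    also have "\<dots> = F a" using a t n K by (intro FX[symmetric]) linarith+
    also have "\<dots> = F i" using Ft[of a "i div t"] by (simp only: ia[symmetric])
    finally show "F (i + n) = F i" .
  qed
  have Fn: "F (i + n * k) = F i" for i k by (rule periodic_mult[OF Fn1])
  have FX': "F j = X (p + j)" for j
  proof -
    have j: "j = j mod n + n * (j div n)" by simp
    have "F j = F (j mod n)" using Fn[of "j mod n" "j div n"] by simp
    also have "\<dots> = X (p + j mod n)"
      using n t K pos_mod_bound[of n j] pos_mod_sign[of n j] by (intro FX) linarith+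
    also have "\<dots> = X (p + j mod n + n * (j div n))" by (simp only: Xp)
    also have "p + j mod n + n * (j div n) = p + j" by simp
    finally show ?thesis .
  qed
  show "W i0 = X i0"
  proof (cases "i0 < p")
    case False
    define j where "j = i0 - p + K"
    have j: "0 \<le> j" "j < P" unfolding j_def P_def using False K s by auto
    have "W (p - K + j) = F j" using j unfolding F_def by (simp add: mod_pos_pos_trivial)
    also have "\<dots> = X (p + j)" by (rule FX')
    also have "\<dots> = X i0" using Xp[of i0 c] unfolding j_def K_def by (simp add: algebra_simps)
    finally show ?thesis unfolding j_def by simp
  qed (rule l)
qed

lemma loop0:
  assumes "periodic X" "Str W" "\<And>i. i < a \<Longrightarrow> W i = X i" "\<And>i. b \<le> i \<Longrightarrow> W i = X i"
  shows "W = X"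
  using loop[of X W a b 0] assms by auto

lemma periodic_agree_right: "periodic X \<Longrightarrow> periodic Y \<Longrightarrow> (\<And>i. a \<le> i \<Longrightarrow> X i = Y i) \<Longrightarrow> X = Y"
proof -
  assume "periodic X" "periodic Y" "\<And>i. a \<le> i \<Longrightarrow> X i = Y i"
  moreover obtain n m where "n > 0" "\<forall>i. X (i + n) = X i" "m > 0" "\<forall>i. Y (i + m) = Y i"
    using \<open>periodic X\<close> \<open>periodic Y\<close> unfolding periodic_def by blast
  ultimately show ?thesis using periodic_eq[of n X m Y a] by blast
qed

lemma periodic_agree_left: "periodic X \<Longrightarrow> periodic Y \<Longrightarrow> (\<And>i. i < a \<Longrightarrow> X i = Y i) \<Longrightarrow> X = Y"
proof -
  assume "periodic X" "periodic Y" "\<And>i. i < a \<Longrightarrow> X i = Y i"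
  moreover obtain n m where "n > 0" "\<forall>i. X (i + n) = X i" "m > 0" "\<forall>i. Y (i + m) = Y i"
    using \<open>periodic X\<close> \<open>periodic Y\<close> unfolding periodic_def by blast
  ultimately show ?thesis using periodic_eq_left[of n X m Y a] by blast
qed

text \<open>This is \<open>loop\<close> itself, applied to X shifted by e: then the left tail agrees
  exactly and the right tail up to a shift.\<close>

lemma loop_right:
  assumes X: "periodic X" and W: "Str W" and r: "\<And>i. p \<le> i \<Longrightarrow> W i = X i"
    and l: "\<And>i. i < q \<Longrightarrow> W (i + e) = X i"
  shows "W = X"
proof -
  define X' where "X' = (\<lambda>i. X (i + (- e)))"
  have X': "periodic X'" unfolding X'_def by (rule periodic_shift[OF X])
  have "W = X'"
  proof (rule loop[OF X' W, where p = "q + e" and q = "p + e" and e = "- e"])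
    show "W i = X' i" if "i < q + e" for i using l[of "i - e"] that unfolding X'_def by simp
    show "W (i + - e) = X' i" if "p + e \<le> i" for i using r[of "i - e"] that unfolding X'_def by simp
  qed
  moreover have "X = X'" by (rule periodic_agree_right[OF X X', of p]) (use r calculation in simp)
  ultimately show ?thesis by simp
qed

text \<open>If both orders are strings, one can leave X for arbitrarily many periods of Y and come
  back to X. By \<open>loop\<close> such a word is X, so X follows Y from p on.\<close>

lemma splice_both:
  assumes X: "periodic X" and Y: "periodic Y" and XY: "Str (join p X Y)" and YX: "Str (join p Y X)"
  shows "X = Y"
proof -
  obtain m where m: "m > 0" "\<forall>i. Y (i + m) = Y i" using Y unfolding periodic_def by blast
  obtain t where t: "p < t" "dir (Y (t - 1)) \<noteq> dir (Y t)" using turn_after[OF periodic_Str[OF Y]] by metis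
  have Ym: "Y (i + m * k) = Y i" for i k by (rule periodic_mult[OF m(2)])
  have eq: "X i = Y i" if i: "p \<le> i" for i
  proof -
    define j where "j = \<bar>t\<bar> + \<bar>p\<bar> + \<bar>i\<bar> + 1"
    define s where "s = m * j"
    have "1 * j \<le> m * j" using m unfolding j_def by (intro mult_right_mono) auto
    then have "j \<le> s" unfolding s_def by simp
    moreover have "t - p < j" "i - p < j" unfolding j_def by linarith+
    ultimately have s: "p + s > t" "p + s > i" by linarith+
    \<comment> \<open>The second splice, moved right by a multiple s of the period of Y. It follows
      Y around the turn t, where it can be glued to the first splice.\<close>
    define Q where "Q = (\<lambda>i. join p Y X (i + (- s)))"
    have Q: "Str Q" unfolding Q_def by (rule Str_shift[OF YX])
    have QY: "Q i = Y i" if "i < p + s" for i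
      using that Ym[of "i - s" j] unfolding Q_def s_def by simp
    define Z where "Z = join t (join p X Y) Q"
    have "Str Z" unfolding Z_def
      by (rule glue_turn[OF XY Q]) (use QY[of t] QY[of "t - 1"] t s in simp_all)
    moreover have "Z i = X i" if "i < p" for i using that t unfolding Z_def by simp
    moreover have "Z (i + s) = X i" if "p \<le> i" for i using that t s unfolding Z_def Q_def by simp
    ultimately have "Z = X" by (intro loop[OF X, of Z p p s])
    moreover have "Z i = Y i" using i s QY unfolding Z_def by (simp add: join_def)
    ultimately show ?thesis by simp
  qed
  then show ?thesis by (rule periodic_agree_right[OF X Y])
qed

text \<open>Across a common turn the two words can be glued in both orders. Hence distinct periodic
  words agree only along monotone stretches; most contradictions below come from this.\<close>

lemma turn_eq:
  assumes X: "periodic X" and Y: "periodic Y" and "X (t - 1) = Y (t - 1)" "X t = Y t" "dir (X (t - 1)) \<noteq> dir (X t)"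
  shows "X = Y"
proof (rule splice_both[OF X Y])
  show "Str (join t X Y)" by (rule glue_turn) (use assms in auto)
  show "Str (join t Y X)" by (rule glue_turn) (use assms in auto)
qed

end

section \<open>Chains of abnormal splices\<close>

context words begin

text \<open>Left of a common letter a string is determined by its directions, by
  \<open>pred_unique\<close>.\<close>

lemma agree_left:
  assumes "Str A" "Str E" "A b = E b" "\<And>i. a \<le> i \<Longrightarrow> i < b \<Longrightarrow> dir (A i) = dir (E i)"
    "a \<le> i" "i \<le> b"
  shows "A i = E i"
proof -
  have "A (b - int n) = E (b - int n)" if "a \<le> b - int n" for n
    using that
  proof (induction n)
    case (Suc n)
    have "T (A (b - int n - 1)) (A (b - int n))" "T (E (b - int n - 1)) (E (b - int n))"
      using Str_T assms by blast+
    moreover have "A (b - int n) = E (b - int n)" using Suc by simp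
    moreover have "dir (A (b - int n - 1)) = dir (E (b - int n - 1))" using Suc by (intro assms) auto
    ultimately have "A (b - int n - 1) = E (b - int n - 1)" using pred_unique by metis
    moreover have "b - int n - 1 = b - int (Suc n)" by simp
    ultimately show ?case by metis
  qed (use assms in simp)
  from this[of "nat (b - i)"] show ?thesis using assms by simp
qed

lemma join_nothing: "(\<And>i. i < p \<Longrightarrow> D i = E i) \<Longrightarrow> join p D E = E"
  by (auto simp: join_def)

lemma join_nothing': "(\<And>i. p \<le> i \<Longrightarrow> E i = D i) \<Longrightarrow> join p D E = D"
  by (auto simp: join_def)

end

context domestic_words begin

text \<open>\<open>chain V X\<close>: read from the left, \<open>V\<close> follows \<open>X\<close>, then a second periodic word, and so on.
  Every change is at a strictly later position than the one before, and at each of them the two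
  periodic words could be spliced in this order.  Composites of abnormal bridges have such words
  (\<open>chain_step\<close>), even if their overlaps are not ordered in this way.\<close>

inductive chain :: "(int \<Rightarrow> 'l) \<Rightarrow> (int \<Rightarrow> 'l) \<Rightarrow> bool" where
  base: "periodic C \<Longrightarrow> chain C C"
| step: "chain V C \<Longrightarrow> periodic X \<Longrightarrow> Str (join f X C) \<Longrightarrow> Str (join f X V) \<Longrightarrow> X f \<noteq> C f \<Longrightarrow>
    (\<And>i. i \<le> f \<Longrightarrow> V i = C i) \<Longrightarrow> chain (join f X V) X"

lemma chain_pw: "chain V C \<Longrightarrow> periodic C"
  by (induction rule: chain.induct) auto

lemma chain_Str: "chain V C \<Longrightarrow> Str V"
  by (induction rule: chain.induct) auto

text \<open>A window blocking Y | C must reach beyond the position k at which V passes from C to the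
  next word C2, since Y | V is a string. The window blocking C2 | C then makes C2 agree with C on
  [f, k), and C2 agrees with Y at \<open>f - 1\<close>; so Y and C2 could be spliced in both
  orders.\<close>

lemma chain_next:
  assumes "chain V C" and Y: "periodic Y" and C1: "dir (C (f - 1)) = d" "dir (C f) = (\<not> d)"
    and Y1: "dir (Y (f - 1)) = (\<not> d)" "dir (Y f) = d"
    and VC: "\<And>i. i \<le> f \<Longrightarrow> V i = C i" and YV: "Str (join f Y V)"
  shows "Str (join f Y C)"
  using assms(1)
proof cases
  case base
  then show ?thesis using YV by simp
next
  case (step V' C2 k)
  have C: "Str C" "periodic C" and C2: "periodic C2" "Str C2"
    using step assms(1) chain_pw periodic_Str by blast+
  have kf: "f < k"
  proof (rule ccontr)
    assume "\<not> f < k"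
    then have "V k = C k" using VC by simp
    then show False using step by simp
  qed
  have Vk: "V i = C i" if "i < k" for i using that step by simp
  show ?thesis
  proof (rule ccontr)
    assume n: "\<not> Str (join f Y C)"
    have VCC: "join f V C = C" by (rule join_nothing) (simp add: VC)
    have o1: "Str V" "Str (join f Y V)" "Str (join f V C)" "\<not> Str (join f Y (join f V C))"
      using chain_Str[OF assms(1)] YV VCC C n by simp_all
    obtain g h d' where g: "g < f" "f < h" "\<And>k. g \<le> k \<Longrightarrow> k < f \<Longrightarrow> dir (Y k) = d'"
       "\<And>k. f \<le> k \<Longrightarrow> k < h \<Longrightarrow> dir (C k) = d'"
      and gA: "\<And>A. Str A \<Longrightarrow> (\<And>k. g \<le> k \<Longrightarrow> k < f \<Longrightarrow> A k = Y k) \<Longrightarrow>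
         (\<And>k. f \<le> k \<Longrightarrow> k < f \<Longrightarrow> A k = V k) \<Longrightarrow> (\<And>k. f \<le> k \<Longrightarrow> k < h \<Longrightarrow> A k = C k) \<Longrightarrow> False"
      by (rule obstruction3[OF o1(1,2,3) order_refl o1(4)]) blast
    have d': "d' = (\<not> d)" using g(3)[of "f - 1"] g(1) Y1 by simp
    have kh: "k < h"
    proof (rule ccontr)
      assume "\<not> k < h"
      show False by (rule gA[OF YV]) (use \<open>\<not> k < h\<close> Vk in auto)
    qed
    have Cd: "dir (C i) = (\<not> d)" if "f \<le> i" "i \<le> k" for i using g(4)[of i] that kh d' by simp
    have "T (C (k - 1)) (C k)" "T (C (k - 1)) (C2 k)"
      using Str_T C Str_spl_T step by blast+
    then have C2k: "dir (C2 k) = d" using succ_neq[of "C (k - 1)" "C k" "C2 k"] step Cd[of k] kf by simp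
    have "\<not> Str (join k C2 C)"
      using splice_both[of C C2 k] C C2 step by metis
    then obtain g4 h4 d2 where g4: "g4 < k" "k < h4" "\<And>i. g4 \<le> i \<Longrightarrow> i < k \<Longrightarrow> dir (C2 i) = d2"
       "\<And>i. k \<le> i \<Longrightarrow> i < h4 \<Longrightarrow> dir (C i) = d2"
      and gA4: "\<And>A. Str A \<Longrightarrow> (\<And>i. g4 \<le> i \<Longrightarrow> i < k \<Longrightarrow> A i = C2 i) \<Longrightarrow>
        (\<And>i. k \<le> i \<Longrightarrow> i < h4 \<Longrightarrow> A i = C i) \<Longrightarrow> False"
      by (rule obstruction2[OF C(1) C2(2) step(4)]) blast
    have d2: "d2 = (\<not> d)" using g4(4)[of k] g4(2) Cd[of k] kf by simp
    have eq: "C i = C2 i" if "max g4 f \<le> i" "i < k" for i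
    proof -
      have "join k C C2 i = C2 i"
        by (rule agree_left[OF step(4) C2(2), of k "max g4 f"])
           (use that kf g4(3) Cd d2 in auto)
      then show ?thesis using that by simp
    qed
    \<comment> \<open>Otherwise the string C itself would read the window of C2 | C.\<close>
    have g4f: "g4 < f"
    proof (rule ccontr)
      assume "\<not> g4 < f"
      show False by (rule gA4[OF C(1)]) (use eq \<open>\<not> g4 < f\<close> in auto)
    qed
    have e2: "C i = C2 i" if "f \<le> i" "i < k" for i using eq that g4f by simp
    have "T (Y (f - 1)) (C2 f)" using Str_spl_T[OF YV] VC[of f] e2[of f] kf by simp
    moreover have "T (C2 (f - 1)) (C2 f)" using Str_T C2 by blast
    moreover have "dir (C2 (f - 1)) = (\<not> d)" using g4(3)[of "f - 1"] g4f d2 kf by simp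
    ultimately have Yf: "Y (f - 1) = C2 (f - 1)" using pred_unique Y1 by blast
    have a: "Str (join f C2 Y)" by (rule glue_turn) (use Y C2 Yf Y1 in auto)
    have "Str (join k (join f Y V) C2)"
      by (rule glue_turn[OF YV C2(2)]) (use kf Vk e2[of "k - 1"] Cd[of "k - 1"] C2k in auto)
    moreover have "join k (join f Y V) C2 = join f Y C2"
      using kf Vk e2 by (auto simp: join_def)
    ultimately have "Y = C2" using splice_both[OF Y C2(1)] a by metis
    then show False using Y1 C1 e2[of f] kf by simp
  qed
qed

text \<open>Given Y | X, the other order fails and has a window. X and Y differ in the right part of
  the window, since otherwise X itself would read it; s is where Y is really left for X.\<close>

lemma divergence:
  assumes X: "periodic X" and Y: "periodic Y" and "Y \<noteq> X" and YX: "Str (join r Y X)"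
  obtains g h d s where "g < r" "r \<le> s" "s < h" "\<And>k. g \<le> k \<Longrightarrow> k < r \<Longrightarrow> dir (X k) = d"
    "\<And>k. r \<le> k \<Longrightarrow> k < h \<Longrightarrow> dir (Y k) = d" "X s \<noteq> Y s" "\<And>i. r \<le> i \<Longrightarrow> i < s \<Longrightarrow> X i = Y i"
    "\<And>A. Str A \<Longrightarrow> (\<And>k. g \<le> k \<Longrightarrow> k < r \<Longrightarrow> A k = X k) \<Longrightarrow>
      (\<And>k. r \<le> k \<Longrightarrow> k < h \<Longrightarrow> A k = Y k) \<Longrightarrow> False"
proof -
  have n: "\<not> Str (join r X Y)" using splice_both[OF X Y] YX assms(3) by metis
  obtain g h d where g: "g < r" "r < h" "\<And>k. g \<le> k \<Longrightarrow> k < r \<Longrightarrow> dir (X k) = d"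
       "\<And>k. r \<le> k \<Longrightarrow> k < h \<Longrightarrow> dir (Y k) = d"
      and gA: "\<And>A. Str A \<Longrightarrow> (\<And>k. g \<le> k \<Longrightarrow> k < r \<Longrightarrow> A k = X k) \<Longrightarrow>
        (\<And>k. r \<le> k \<Longrightarrow> k < h \<Longrightarrow> A k = Y k) \<Longrightarrow> False"
    by (rule obstruction2[OF periodic_Str[OF Y] periodic_Str[OF X] YX n]) blast
  have "\<exists>i. r \<le> i \<and> i < h \<and> X i \<noteq> Y i"
  proof (rule ccontr)
    assume c: "\<not> ?thesis"
    show False by (rule gA[OF periodic_Str[OF X]]) (use c in auto)
  qed
  then obtain i where i: "r \<le> i" "i < h" "X i \<noteq> Y i" by blast
  obtain s where s: "r \<le> s" "s \<le> i" "X s \<noteq> Y s" "\<And>j. r \<le> j \<Longrightarrow> j < s \<Longrightarrow> \<not> X j \<noteq> Y j"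
    by (rule first_diff[of r i "\<lambda>i. X i \<noteq> Y i"]) (use i in auto)
  have s4: "X j = Y j" if "r \<le> j" "j < s" for j using s(4) that by blast
  have sh: "s < h" using s(2) i(2) by simp
  show thesis by (rule that) (fact g(1) s(1) sh g(3) g(4) s(3) s4 gA)+
qed

text \<open>The inductive rule needs a cut at which Y differs from X while V has not left X yet.
  Moving the cut to the first difference s may reach or overtake the position f at which V leaves X.
  Then the part of X is swallowed, and Y is attached to the rest V' of the chain instead.\<close>

lemma chain_step:
  assumes "chain V X" and Y: "periodic Y" and "Y \<noteq> X" "Str (join r Y X)" "Str (join r Y V)"
    "\<And>i. i < r \<Longrightarrow> V i = X i"
  shows "chain (join r Y V) Y"
  using assms(1,3-)
proof (induction arbitrary: r rule: chain.induct)
  case (base X)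
  obtain g h d s where s: "r \<le> s" "X s \<noteq> Y s" "\<And>i. r \<le> i \<Longrightarrow> i < s \<Longrightarrow> X i = Y i"
    by (rule divergence[OF base(1) Y base(2,3)]) blast
  have e: "join r Y X = join s Y X" by (rule join_move) (use s in auto)
  show ?case unfolding e
    by (rule chain.step[OF chain.base Y]) (use base s e in auto)
next
  case (step V' C X f)
  note X = \<open>periodic X\<close>
  have C: "periodic C" using chain_pw step.hyps(1) .
  define V where "V = join f X V'"
  have V: "chain V X" unfolding V_def by (rule chain.step) (use step.hyps in auto)
  obtain g h d s where g: "g < r" and s: "r \<le> s" "s < h"     and gY: "\<And>k. r \<le> k \<Longrightarrow> k < h \<Longrightarrow> dir (Y k) = d"
    and s2: "X s \<noteq> Y s" "\<And>i. r \<le> i \<Longrightarrow> i < s \<Longrightarrow> X i = Y i"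
    and gA: "\<And>A. Str A \<Longrightarrow> (\<And>k. g \<le> k \<Longrightarrow> k < r \<Longrightarrow> A k = X k) \<Longrightarrow>
      (\<And>k. r \<le> k \<Longrightarrow> k < h \<Longrightarrow> A k = Y k) \<Longrightarrow> False"
    by (rule divergence[OF X Y \<open>Y \<noteq> X\<close> \<open>Str (join r Y X)\<close>]) blast
  have rf: "r \<le> f"
  proof (rule ccontr)
    assume "\<not> r \<le> f"
    then have "V f = X f" using step.prems(4)[of f] unfolding V_def by simp
    then show False using step.hyps(5,6) unfolding V_def by simp
  qed
  have Ve: "V i = X i" if "i < f" for i using that unfolding V_def by simp
  have eX: "join r Y X = join s Y X" by (rule join_move) (use s s2 in auto)
  consider "s < f" | "s = f" | "f < s" by linarith
  then show ?case
  proof cases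
    case 1
    have e: "join r Y V = join s Y V" by (rule join_move) (use s s2 1 Ve in auto)
    have "chain (join s Y V) Y"
      by (rule chain.step[OF V Y]) (use e eX s s2 1 Ve step.prems V_def in auto)
    then show ?thesis using e V_def by simp
  next
    case 2
    \<comment> \<open>Y f and C f both differ in direction from X f, so they coincide. The window of
      X and Y forces C and Y apart further right, at a turn of C, and there Y can be glued to
      C.\<close>
    have e: "join r Y V = join f Y V'"
      using s s2 2 unfolding V_def by (auto simp: join_def)
    have YV': "Str (join f Y V')" using step.prems(3) e V_def by simp
    have YX: "Str (join f Y X)" using step.prems(2) eX 2 by simp
    have Cf: "V' f = C f" using step.hyps(6) by simp
    have "T (X (f - 1)) (X f)" "T (X (f - 1)) (C f)" using Str_T X periodic_Str Str_spl_T step.hyps(3) by blast+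
    then have dC: "dir (C f) = (\<not> dir (X f))" using succ_neq step.hyps(5) by blast
    have "T (Y (f - 1)) (Y f)" "T (Y (f - 1)) (X f)" using Str_T Y periodic_Str Str_spl_T YX by blast+
    then have "dir (X f) = (\<not> dir (Y f))" using succ_neq s2(1) 2 by metis
    moreover have dY: "dir (Y f) = d" using gY s 2 by simp
    ultimately have "dir (C f) = dir (Y f)" using dC by simp
    moreover have "T (Y (f - 1)) (C f)" using Str_spl_T[OF YV'] Cf by simp
    ultimately have CY: "C f = Y f" using succ_unique \<open>T (Y (f - 1)) (Y f)\<close> by blast
    have "\<exists>k. f \<le> k \<and> k < h \<and> C k \<noteq> Y k"
    proof (rule ccontr)
      assume c: "\<not> ?thesis"
      show False by (rule gA[OF step.hyps(3)]) (use c s2(2) rf 2 in \<open>auto simp: join_def\<close>)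
    qed
    then obtain k0 where k0: "f \<le> k0" "k0 < h" "C k0 \<noteq> Y k0" by blast
    obtain k where k: "f \<le> k" "k \<le> k0" "C k \<noteq> Y k" "\<And>j. f \<le> j \<Longrightarrow> j < k \<Longrightarrow> \<not> C j \<noteq> Y j"
      by (rule first_diff[of f k0 "\<lambda>i. C i \<noteq> Y i"]) (use k0 in auto)
    have fk: "f < k" using k CY by (cases "f = k") auto
    have k1: "C (k - 1) = Y (k - 1)" using k(4)[of "k - 1"] fk by simp
    have "T (Y (k - 1)) (Y k)" "T (C (k - 1)) (C k)" using Str_T Y C periodic_Str by blast+
    then have "dir (C k) = (\<not> dir (Y k))" using succ_neq k(3) k1 by metis
    moreover have "dir (Y k) = d" "dir (Y (k - 1)) = d" using gY k k0 rf fk by simp_all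
    ultimately have "Str (join k Y C)" by (intro glue_turn) (use Y C k1 in auto)
    moreover have "join f Y C = join k Y C" by (rule join_move) (use k fk in auto)
    ultimately have "Str (join f Y C)" by simp
    moreover have "Y \<noteq> C" using k(3) by auto
    ultimately have "chain (join f Y V') Y"
      by (intro step.IH) (use YV' step.hyps(6) in auto)
    then show ?thesis using e V_def by simp
  next
    case 3
    \<comment> \<open>Y still follows X at f, where X and C differ. If Y is monotone across f, the
      passage to C is a turn; otherwise Y and C turn in opposite senses at f, the situation of
      \<open>chain_next\<close>.\<close>
    have e: "join r Y V = join f Y V'"
      using s s2 3 rf unfolding V_def by (auto simp: join_def)
    have YV': "Str (join f Y V')" using step.prems(3) e V_def by simp
    have XYf: "X f = Y f" using s2(2) rf 3 by simp
    have Cf: "V' f = C f" using step.hyps(6) by simp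
    have "T (X (f - 1)) (X f)" "T (X (f - 1)) (C f)" using Str_T X periodic_Str Str_spl_T step.hyps(3) by blast+
    then have dC: "dir (C f) = (\<not> dir (X f))" using succ_neq step.hyps(5) by blast
    have dY: "dir (Y f) = d" using gY rf 3 s by simp
    have TYC: "T (Y (f - 1)) (C f)" using Str_spl_T[OF YV'] Cf by simp
    have "Str (join f Y C)"
    proof (cases "dir (Y (f - 1)) = d")
      case True
      show ?thesis by (rule glue) (use Y C True dC dY XYf TYC in auto)
    next
      case False
      have "\<not> Str (join f C X)" using splice_both[OF X C] step.hyps(3,5) by metis
      then obtain g' h' d' where g': "g' < f" "f < h'" "\<And>i. g' \<le> i \<Longrightarrow> i < f \<Longrightarrow> dir (C i) = d'"
       "\<And>i. f \<le> i \<Longrightarrow> i < h' \<Longrightarrow> dir (X i) = d'"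
        by (rule obstruction2[OF periodic_Str[OF X] periodic_Str[OF C] step.hyps(3)]) blast
      have "dir (C (f - 1)) = d" using g'(3)[of "f - 1"] g'(4)[of f] g' XYf dY by simp
      then show ?thesis
        by (intro chain_next[OF step.hyps(1) Y, where d = d]) (use False dC XYf dY step.hyps(6) YV' in auto)
    qed
    then have "chain (join f Y V') Y"
      by (intro chain.step[OF step.hyps(1) Y]) (use YV' XYf step.hyps(5,6) in auto)
    then show ?thesis using e V_def by simp
  qed
qed

end

section \<open>Obstructions\<close>

context domestic_words begin

text \<open>C | X is not a string, and its monotone window contains \<open>C (f - 1)\<close> and
  \<open>X f\<close>. Moreover \<open>X f\<close> and \<open>C f\<close> are distinct successors of
  \<open>X (f - 1)\<close>. So C turns at f.\<close>

lemma turn_left_of_obstruction: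
  assumes X: "periodic X" and C: "periodic C" and XC: "Str (join f X C)" and "X f \<noteq> C f"
  shows "dir (C (f - 1)) = dir (X f)" "dir (C f) = (\<not> dir (X f))"
proof -
  have "\<not> Str (join f C X)" using splice_both[OF X C] XC assms(4) by metis
  then obtain g' h' d' where g': "g' < f" "f < h'" "\<And>i. g' \<le> i \<Longrightarrow> i < f \<Longrightarrow> dir (C i) = d'"
     "\<And>i. f \<le> i \<Longrightarrow> i < h' \<Longrightarrow> dir (X i) = d'"
    by (rule obstruction2[OF periodic_Str[OF X] periodic_Str[OF C] XC]) blast
  show "dir (C (f - 1)) = dir (X f)" using g'(3)[of "f - 1"] g'(4)[of f] g' by simp
  have "T (X (f - 1)) (X f)" "T (X (f - 1)) (C f)" using Str_T X periodic_Str Str_spl_T XC by blast+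
  then show "dir (C f) = (\<not> dir (X f))" using succ_neq assms(4) by blast
qed

text \<open>A blocking window makes W monotone from e' to f, in the direction of the window of C |
  X. Comparing leftwards from f, W follows C on the whole stretch and C agrees with Y at
  \<open>e' - 1\<close>. Then C and Y can be spliced in both orders, although they differ at
  f'.\<close>

lemma no_obstruction_right:
  assumes W: "Str W" and X: "periodic X" and Y: "periodic Y" and C: "periodic C"
    and XC: "Str (join f X C)" "X f \<noteq> C f" "W f = C f"
    and WX: "Str (join f W X)"
    and YW: "Str (join e' Y W)" "Str (join f' W Y)" "e' \<le> f'" "\<And>i. e' \<le> i \<Longrightarrow> i < f' \<Longrightarrow> Y i = W i"
      "Y (e' - 1) \<noteq> W (e' - 1)" "Y f' \<noteq> W f'"
    and "f' < f"
  shows "Str (join e' Y (join f W X))"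
proof (rule ccontr)
  assume n: "\<not> ?thesis"
  have e'f: "e' \<le> f" using YW(3) \<open>f' < f\<close> by simp
  obtain g h d where g: "g < e'" "f < h" "\<And>k. g \<le> k \<Longrightarrow> k < e' \<Longrightarrow> dir (Y k) = d"
    "\<And>k. e' \<le> k \<Longrightarrow> k < f \<Longrightarrow> dir (W k) = d" "\<And>k. f \<le> k \<Longrightarrow> k < h \<Longrightarrow> dir (X k) = d"
    by (rule obstruction3[OF W YW(1) WX e'f n]) blast
  have Xf: "dir (X f) = d" using g(5)[of f] g(2) by simp
  have C1: "dir (C (f - 1)) = d" and Cf: "dir (C f) = (\<not> d)"
    using turn_left_of_obstruction[OF X C XC(1,2)] Xf by simp_all
  have "\<not> Str (join f C X)" using splice_both[OF X C] XC(1,2) by metis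
  then obtain g' h' d' where g': "g' < f" "f < h'" "\<And>i. g' \<le> i \<Longrightarrow> i < f \<Longrightarrow> dir (C i) = d'"
     "\<And>i. f \<le> i \<Longrightarrow> i < h' \<Longrightarrow> dir (X i) = d'"
     and gA: "\<And>A. Str A \<Longrightarrow> (\<And>i. g' \<le> i \<Longrightarrow> i < f \<Longrightarrow> A i = C i) \<Longrightarrow>
        (\<And>i. f \<le> i \<Longrightarrow> i < h' \<Longrightarrow> A i = X i) \<Longrightarrow> False"
    by (rule obstruction2[OF periodic_Str[OF X] periodic_Str[OF C] XC(1)]) blast
  have d': "d' = d" using g'(3)[of "f - 1"] g'(1) C1 by simp
  have Wd: "dir (W i) = d" if "e' \<le> i" "i < f" for i using g(4) that by simp
  have WC: "W i = C i" if "max g' e' \<le> i" "i \<le> f" for i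
    by (rule agree_left[OF W periodic_Str[OF C] XC(3), of "max g' e'"]) (use that g'(3) d' Wd in auto)
  have g'e: "g' < e'"
  proof (rule ccontr)
    assume "\<not> g' < e'"
    show False by (rule gA[OF WX]) (use WC \<open>\<not> g' < e'\<close> in auto)
  qed
  have WC: "W i = C i" if "e' \<le> i" "i \<le> f" for i using WC that g'e by simp
  have "T (Y (e' - 1)) (C e')" using Str_spl_T[OF YW(1)] WC[of e'] e'f by simp
  moreover have "T (C (e' - 1)) (C e')" using Str_T C periodic_Str by blast
  moreover have "dir (Y (e' - 1)) = d" "dir (C (e' - 1)) = d" using g(3)[of "e' - 1"] g'(3)[of "e' - 1"] g(1) g'e d' e'f by simp_all
  ultimately have Y1: "Y (e' - 1) = C (e' - 1)" using pred_unique by metis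
  have "T (W (f' - 1)) (W f')" "T (W (f' - 1)) (Y f')" using Str_T W Str_spl_T YW(2) by blast+
  then have Yf': "dir (Y f') = (\<not> d)" using succ_neq[of "W (f' - 1)" "W f'" "Y f'"] YW(6) Wd[of f'] YW(3) \<open>f' < f\<close> by simp
  have "Str (join f (join e' Y W) C)"
    by (rule glue_turn'[OF YW(1) periodic_Str[OF C]]) (use XC(3) e'f Wd[of "f - 1"] Cf \<open>f' < f\<close> YW(3) in auto)
  moreover have "join f (join e' Y W) C = join e' Y C" using WC e'f by (auto simp: join_def)
  ultimately have YC: "Str (join e' Y C)" by simp
  have CY: "Y i = C i" if "e' - 1 \<le> i" "i < f'" for i
  proof (cases "i = e' - 1")
    case False
    then show ?thesis using that YW(4)[of i] WC[of i] \<open>f' < f\<close> by simp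
  qed (simp add: Y1)
  have "dir (Y (f' - 1)) = d"
    using \<open>dir (Y (e' - 1)) = d\<close> YW(4)[of "f' - 1"] Wd[of "f' - 1"] YW(3) \<open>f' < f\<close> by (cases "e' = f'") auto
  then have "Str (join f' C Y)"
    by (intro glue_turn) (use C Y Yf' CY[of "f' - 1"] YW(3) in auto)
  moreover have "join f' C Y = join e' C Y"
    by (rule join_move[symmetric]) (use CY YW(3) in auto)
  ultimately have "C = Y" using splice_both[OF C Y, of e'] YC by simp
  then show False using YW(6) WC[of f'] YW(3) \<open>f' < f\<close> by simp
qed

text \<open>Failure of both orders yields two windows. If their directions differ, Y and C share a
  turn at f and coincide. If they are equal, X and Y agree to the left of f, and the window that
  reaches less far to the left is read by X or by Y alone.\<close>

lemma no_obstruction_same: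
  assumes W: "Str W" and X: "periodic X" and Y: "periodic Y" and C: "periodic C"
    and XC: "Str (join f X C)" "X f \<noteq> C f" "W f = C f"
    and XW: "Str (join f X W)" and WX: "Str (join f W X)"
    and YW: "Str (join f Y W)" and WY: "Str (join f W Y)"
  shows "Str (join f X Y) \<or> Str (join f Y X)"
proof (rule ccontr)
  assume "\<not> ?thesis"
  then have nXY: "\<not> Str (join f X Y)" and nYX: "\<not> Str (join f Y X)" by auto
  have e: "join f X (join f W Y) = join f X Y" "join f Y (join f W X) = join f Y X" by (auto simp: join_def)
  have nXY': "\<not> Str (join f X (join f W Y))" and nYX': "\<not> Str (join f Y (join f W X))"
    using nXY nYX e by simp_all
  obtain g h d where g: "g < f" "f < h" "\<And>k. g \<le> k \<Longrightarrow> k < f \<Longrightarrow> dir (X k) = d"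
    "\<And>k. f \<le> k \<Longrightarrow> k < h \<Longrightarrow> dir (Y k) = d"
   and gA: "\<And>A. Str A \<Longrightarrow> (\<And>i. g \<le> i \<Longrightarrow> i < f \<Longrightarrow> A i = X i) \<Longrightarrow> (\<And>k. f \<le> k \<Longrightarrow> k < f \<Longrightarrow> A k = W k) \<Longrightarrow>
        (\<And>i. f \<le> i \<Longrightarrow> i < h \<Longrightarrow> A i = Y i) \<Longrightarrow> False"
    by (rule obstruction3[OF W XW WY order_refl nXY']) blast
  obtain g' h' d' where g': "g' < f" "f < h'" "\<And>k. g' \<le> k \<Longrightarrow> k < f \<Longrightarrow> dir (Y k) = d'"
    "\<And>k. f \<le> k \<Longrightarrow> k < h' \<Longrightarrow> dir (X k) = d'"
   and gA': "\<And>A. Str A \<Longrightarrow> (\<And>i. g' \<le> i \<Longrightarrow> i < f \<Longrightarrow> A i = Y i) \<Longrightarrow> (\<And>k. f \<le> k \<Longrightarrow> k < f \<Longrightarrow> A k = W k) \<Longrightarrow>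
        (\<And>i. f \<le> i \<Longrightarrow> i < h' \<Longrightarrow> A i = X i) \<Longrightarrow> False"
    by (rule obstruction3[OF W YW WX order_refl nYX']) blast
  have X1: "dir (X (f - 1)) = d" and Yf: "dir (Y f) = d" and Y1: "dir (Y (f - 1)) = d'" and Xf: "dir (X f) = d'"
    using g(3)[of "f - 1"] g(4)[of f] g'(3)[of "f - 1"] g'(4)[of f] g(1,2) g'(1,2) by simp_all
  have T1: "T (X (f - 1)) (W f)" "T (Y (f - 1)) (W f)" "T (W (f - 1)) (X f)" "T (W (f - 1)) (Y f)"
     "T (W (f - 1)) (W f)" "T (C (f - 1)) (C f)"
    using Str_spl_T XW YW WX WY Str_T W periodic_Str[OF C] by blast+
  have "dir (C (f - 1)) = d'" "dir (C f) = (\<not> d')"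
    using turn_left_of_obstruction[OF X C XC(1,2)] Xf by simp_all
  show False
  proof (cases "d = d'")
    case False
    have "C f = Y f"
    proof -
      have "X f \<noteq> W f" using XC by simp
      then have "dir (W f) = (\<not> dir (X f))" using succ_neq T1 by blast
      then show ?thesis using succ_unique[OF T1(5) T1(4)] False Xf Yf XC(3) by auto
    qed
    moreover have "C (f - 1) = Y (f - 1)"
      using pred_unique[of "C (f - 1)" "C f" "Y (f - 1)"] T1 XC(3) \<open>dir (C (f - 1)) = d'\<close> Y1 by simp
    ultimately have "C = Y" by (intro turn_eq[OF C Y]) (use Y1 Yf False in auto)
    then show False using XC(1) nXY by simp
  next
    case True
    have XY1: "X (f - 1) = Y (f - 1)" using pred_unique[OF T1(1,2)] X1 Y1 True by simp
    have l: "X i = Y i" if "max g g' \<le> i" "i < f" for i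
      by (rule agree_left[OF periodic_Str[OF X] periodic_Str[OF Y] XY1, of "max g g'"]) (use that g(3) g'(3) True in auto)
    have "g < g'"
    proof (rule ccontr)
      assume "\<not> g < g'"
      show False by (rule gA[OF periodic_Str[OF Y]]) (use l \<open>\<not> g < g'\<close> in auto)
    qed
    show False by (rule gA'[OF periodic_Str[OF X]]) (use l \<open>g < g'\<close> in auto)
  qed
qed

end

context domestic_words begin

text \<open>Between the two touches W follows the chain V, which may leave C at some k. If k < f',
  then C touches W | Y and \<open>nb\<close> leaves only C = Lf or C = Y, each of which contradicts
  a disagreement. If k \<ge> f' or V = C, then C and Y can be spliced in both orders.\<close>

lemma no_obstruction_left:
  assumes W: "Str W" and X: "periodic X" and Y: "periodic Y" and Lf: "periodic Lf"
    and V: "chain V C" and XC: "Str (join f X C)" "X f \<noteq> C f" "\<And>i. i \<le> f \<Longrightarrow> V i = C i"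
      "\<And>i. f \<le> i \<Longrightarrow> W i = V i"
    and XV: "Str (join f X V)" and WX: "Str (join f W X)"
    and YW: "Str (join e' Y W)" "Str (join f' W Y)" "e' \<le> f'" "\<And>i. e' \<le> i \<Longrightarrow> i < f' \<Longrightarrow> Y i = W i"
      "Y (e' - 1) \<noteq> W (e' - 1)" "Y f' \<noteq> W f'"
    and "f < e'"
    and left: "\<And>i. i < a \<Longrightarrow> W i = Lf i"
    and nb: "\<And>Z p. periodic Z \<Longrightarrow> Str (join p Z (join f' W Y)) \<Longrightarrow> Str (join p (join f' W Y) Z) \<Longrightarrow> Z = Lf \<or> Z = Y"
  shows "Str (join f X (join f' W Y))"
proof (rule ccontr)
  assume n: "\<not> ?thesis"
  have C: "periodic C" using V chain_pw by simp
  have XW: "Str (join f X W)"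
  proof -
    have "join f X V = join f X W" using XC(4) by (auto simp: join_def)
    then show ?thesis using XV by simp
  qed
  have ff': "f \<le> f'" "f < f'" using YW(3) \<open>f < e'\<close> by simp_all
  obtain g h d where g: "g < f" "f' < h" "\<And>k. g \<le> k \<Longrightarrow> k < f \<Longrightarrow> dir (X k) = d"
    "\<And>k. f \<le> k \<Longrightarrow> k < f' \<Longrightarrow> dir (W k) = d" "\<And>k. f' \<le> k \<Longrightarrow> k < h \<Longrightarrow> dir (Y k) = d"
    by (rule obstruction3[OF W XW YW(2) ff'(1) n]) blast
  note Wd = g(4)
  have Wf: "W f = C f" using XC(3,4) by simp
  have Cf: "dir (C f) = d" using Wf Wd[of f] ff' by simp
  have C1: "dir (C (f - 1)) = (\<not> d)"
    using turn_left_of_obstruction[OF X C XC(1,2)] Cf by simp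
  have Yf': "dir (Y f') = d" using g(5)[of f'] g(2) by simp
  have Tf: "T (W (f' - 1)) (W f')" "T (W (f' - 1)) (Y f')" using Str_T W Str_spl_T YW(2) by blast+
  then have Wf': "dir (W f') = (\<not> d)" using succ_neq[of "W (f' - 1)" "Y f'" "W f'"] YW(6) Yf' by simp
  have Te: "T (Y (e' - 1)) (W e')" "T (W (e' - 1)) (W e')" using Str_T W Str_spl_T YW(1) by blast+
  have Ye: "dir (Y (e' - 1)) = (\<not> d)"
    using pred_neq[OF Te(2,1)] YW(5) Wd[of "e' - 1"] \<open>f < e'\<close> YW(3) by simp
  have CYa: "Str (join f' C Y)" if "\<And>i. f \<le> i \<Longrightarrow> i < f' \<Longrightarrow> W i = C i"
  proof -
    have "Str (join f C (join f' W Y))"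
      by (rule glue_turn') (use C YW(2) Wf C1 Cf ff' in auto)
    moreover have "join f C (join f' W Y) = join f' C Y" using that ff' by (auto simp: join_def)
    ultimately show ?thesis by simp
  qed
  have full: False if WC: "\<And>i. f \<le> i \<Longrightarrow> i \<le> f' \<Longrightarrow> W i = C i" and VC: "\<And>i. i \<le> f' \<Longrightarrow> V i = C i"
  proof -
    have Cf': "dir (C f') = (\<not> d)" using WC Wf' ff' by simp
    have "Str (join f' Y C)"
    proof (cases "e' = f'")
      case True
      have "join f' Y V = join f' Y W" using XC(4) ff' by (auto simp: join_def)
      then have "Str (join f' Y V)" using YW(1) True by simp
      then show ?thesis
        by (intro chain_next[OF V Y, where d = d]) (use True Ye Yf' VC Cf' WC[of "f' - 1"] Wd[of "f' - 1"] ff' in auto)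
    next
      case False
      then have "Y (f' - 1) = C (f' - 1)" "dir (C (f' - 1)) = d"
        using YW(3,4) WC[of "f' - 1"] Wd[of "f' - 1"] ff' by auto
      then show ?thesis by (intro glue_turn) (use Y C Cf' in auto)
    qed
    then have "C = Y" using splice_both[OF C Y] CYa WC by simp
    then show False using Cf' Yf' by simp
  qed
  from V show False
  proof cases
    case base
    show False by (rule full) (use base XC(4) in auto)
  next
    case (step V'' C2 k)
    have kf: "f < k"
    proof (rule ccontr)
      assume "\<not> f < k"
      then have "V k = C k" using XC(3) by simp
      then show False using step by simp
    qed
    have VC: "V i = C i" if "i < k" for i using that step by simp
    have Vk: "V k = C2 k" using step by simp
    have WC: "W i = C i" if "f \<le> i" "i < k" for i using VC XC(4) that by simp
    have Wk: "W k = C2 k" using Vk XC(4) kf by simp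
    have "T (C (k - 1)) (C k)" "T (C (k - 1)) (C2 k)" using Str_T C periodic_Str Str_spl_T step(4) by blast+
    then have dCk: "dir (C k) = (\<not> dir (W k))" using succ_neq step(6) Wk by metis
    consider "f' < k" | "k < f'" | "k = f'" by linarith
    then show False
    proof cases
      case 1 then show False using full WC VC by auto
    next
      case 2
      have Wk1: "W (k - 1) = C (k - 1)" using WC[of "k - 1"] kf by simp
      have dC: "dir (C (k - 1)) = d" "dir (C k) = (\<not> d)" using Wk1 Wd[of "k - 1"] Wd[of k] kf 2 dCk by simp_all
      have "Str (join k W C)" by (rule glue_turn) (use W C Wk1 dC in auto)
      moreover have "join k (join f' W Y) C = join k W C" using 2 by (auto simp: join_def)
      ultimately have a: "Str (join k (join f' W Y) C)" by simp
      have "Str (join f C (join f' W Y))"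
        by (rule glue_turn') (use C YW(2) Wf C1 Cf ff' in auto)
      moreover have "join f C (join f' W Y) = join k C (join f' W Y)"
        by (rule join_move) (use WC 2 kf in auto)
      ultimately have b: "Str (join k C (join f' W Y))" by simp
      from nb[OF C b a] show False
      proof
        \<comment> \<open>Then W follows C up to k, so W | X equals C | X at f, and X and C can be
          spliced in both orders.\<close>
        assume "C = Lf"
        then have "join k W C = C" by (intro loop0[OF C \<open>Str (join k W C)\<close>, of "min a k" k]) (use left in auto)
        then have "W i = C i" if "i < k" for i using that by (metis join_left)
        then have "join f W X = join f C X" using kf by (auto simp: join_def)
        then show False using splice_both[OF X C XC(1)] WX XC(2) by metis
      next
        assume "C = Y"
        then have "join k C (join f' W Y) = C" using loop0[OF C b, of k f'] 2 by simp
        then have "W k = C k" using 2 by (metis join_left join_right order_refl)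
        then show False using Wk step(6) by simp
      qed
    next
      case 3
      have Cf': "dir (C f') = d" using dCk Wf' 3 by simp
      have "T (W (f' - 1)) (C f')" using \<open>T (C (k - 1)) (C k)\<close> WC[of "k - 1"] kf 3 by simp
      then have CYf': "C f' = Y f'" using succ_unique Tf(2) Cf' Yf' by blast
      have "Y e' = C e'" "dir (Y e') = d"
        using CYf' Yf' YW(3) YW(4)[of e'] WC[of e'] Wd[of e'] \<open>f < e'\<close> 3 by (cases "e' = f'"; simp)+
      then have "Str (join e' Y C)" by (intro glue_turn') (use Y C Ye in auto)
      moreover have "join e' Y C = join f' Y C"
        by (rule join_move) (use YW WC 3 \<open>f < e'\<close> in auto)
      ultimately have "C = Y" using splice_both[OF C Y CYa] WC 3 by simp
      have "Y (e' - 1) = C (e' - 1)" using \<open>C = Y\<close> by simp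
      moreover have "C (e' - 1) = W (e' - 1)" using WC[of "e' - 1"] \<open>f < e'\<close> YW(3) 3 by simp
      ultimately show False using YW(5) by simp
    qed
  qed
qed

text \<open>W leaves X at f, and [e', f') is the whole stretch around q on which Y follows W. If f
  lies outside [e', f'], one of the words touches the target factor of the other; this makes them
  equal, against a known disagreement with W. If f lies inside, the words can be spliced in one of
  the two orders, and \<open>nbX\<close> or \<open>nbY\<close> makes them equal.\<close>

lemma touch_unique:
  assumes W: "Str W" and X: "periodic X" and Y: "periodic Y" and Lf: "periodic Lf"
    and left: "\<And>i. i < a \<Longrightarrow> W i = Lf i"
    and ch: "chain (join p X W) X" "join p X W \<noteq> X" and WX: "Str (join p W X)"
    and YW: "Str (join q Y W)" "Str (join q W Y)" "join q Y W \<noteq> Y"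
    and XL: "X \<noteq> Lf" and YL: "Y \<noteq> Lf"
    and nbX: "\<And>Z r. periodic Z \<Longrightarrow> Str (join r Z (join p W X)) \<Longrightarrow> Str (join r (join p W X) Z) \<Longrightarrow> Z = Lf \<or> Z = X"
    and nbY: "\<And>Z r. periodic Z \<Longrightarrow> Str (join r Z (join q W Y)) \<Longrightarrow> Str (join r (join q W Y) Z) \<Longrightarrow> Z = Lf \<or> Z = Y"
  shows "X = Y \<and> join p X W = join q Y W \<and> join p W X = join q W Y"
proof -
  from ch(1) obtain V C f where V: "chain V C" and Vf: "join p X W = join f X V" "Str (join f X C)" "Str (join f X V)"
    "X f \<noteq> C f" "\<And>i. i \<le> f \<Longrightarrow> V i = C i"
  proof cases
    case base then show ?thesis using ch(2) by simp
  next
    case (step V C f) then show ?thesis using that[of V C f] by simp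
  qed
  have C: "periodic C" using V chain_pw by simp
  have pt: "join p X W i = join f X V i" for i using Vf(1) by simp
  have pf: "p \<le> f"
  proof (rule ccontr)
    assume "\<not> p \<le> f"
    then have "X f = V f" using pt[of f] by simp
    then show False using Vf by simp
  qed
  have WXe: "W i = X i" if "p \<le> i" "i < f" for i using pt[of i] that by simp
  have WV: "W i = V i" if "f \<le> i" for i using pt[of i] that pf by simp
  have Wf: "W f = C f" using WV Vf(5) by simp
  have eX: "join p X W = join f X W" "join p W X = join f W X"
    by (rule join_move; use WXe pf in simp)+
  have XW': "Str (join f X W)" and WX': "Str (join f W X)" using Vf(1,3) eX WX by simp_all
  note nbX' = nbX[unfolded eX]
  have "\<exists>i\<ge>q. W i \<noteq> Y i"
  proof (rule ccontr)
    assume "\<not> ?thesis"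
    then have "join q Y W = Y" by (intro join_nothing') auto
    then show False using YW(3) by simp
  qed
  then obtain i1 where i1: "q \<le> i1" "W i1 \<noteq> Y i1" by blast
  obtain f' where f': "q \<le> f'" "W f' \<noteq> Y f'" "\<And>i. q \<le> i \<Longrightarrow> i < f' \<Longrightarrow> \<not> W i \<noteq> Y i"
    by (rule first_diff[of q i1 "\<lambda>i. W i \<noteq> Y i"]) (use i1 in auto)
  have "\<exists>i. i < q \<and> W i \<noteq> Y i"
  proof (rule ccontr)
    assume c: "\<not> ?thesis"
    have "Y = Lf"
      by (rule periodic_agree_left[OF Y Lf, of "min a q"]) (use c left in \<open>metis min_less_iff_conj\<close>)
    then show False using YL by simp
  qed
  then obtain i2 where i2: "i2 < q" "W i2 \<noteq> Y i2" by blast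
  obtain e0 where e0: "e0 \<le> q - 1" "W e0 \<noteq> Y e0" "\<And>i. e0 < i \<Longrightarrow> i \<le> q - 1 \<Longrightarrow> \<not> W i \<noteq> Y i"
    by (rule last_diff[of i2 "q - 1" "\<lambda>i. W i \<noteq> Y i"]) (use i2 in auto)
  define e' where "e' = e0 + 1"
  have e': "e' \<le> q" "Y (e' - 1) \<noteq> W (e' - 1)" using e0 unfolding e'_def by auto
  have YWe: "Y i = W i" if "e' \<le> i" "i < f'" for i
    using e0(3)[of i] f'(3)[of i] that unfolding e'_def by (cases "i < q") auto
  have eY: "join q Y W = join x Y W" "join q W Y = join x W Y" if "e' \<le> x" "x \<le> f'" for x
  proof -
    have *: "join e' Y W = join z Y W" "join e' W Y = join z W Y" if "e' \<le> z" "z \<le> f'" for z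
      by (rule join_move; use YWe that in simp)+
    show "join q Y W = join x Y W" "join q W Y = join x W Y" using *[of q] *[of x] that e'(1) f'(1) by simp_all
  qed
  have ef': "e' \<le> f'" using e' f' by simp
  have YWs: "Str (join x Y W)" "Str (join x W Y)" if "e' \<le> x" "x \<le> f'" for x
    using YW(1,2) eY[OF that] by simp_all
  note nbY' = nbY[unfolded eY(2)[OF ef' order_refl]]
  consider "f' < f" | "f < e'" | "e' \<le> f" "f \<le> f'" by linarith
  then show ?thesis
  proof cases
    case 1
    have s: "Str (join e' Y (join f W X))"
      by (rule no_obstruction_right[OF W X Y C Vf(2) Vf(4) Wf WX' YWs(1) YWs(2) ef' YWe]) (use e' f' 1 ef' in auto)
    have "join e' (join f W X) Y = join e' W Y" using 1 ef' by (auto simp: join_def)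
    then have "Y = Lf \<or> Y = X" using nbX'[OF Y s] YWs[of e'] ef' by simp
    then have "Y = X" using YL by simp
    have "join e' Y (join f W X) = Y"
      by (rule loop0[OF Y s, of e' f]) (use \<open>Y = X\<close> 1 ef' in auto)
    then have "W f' = Y f'" using 1 ef' by (metis join_left join_right)
    then show ?thesis using f' by simp
  next
    case 2
    have s: "Str (join f X (join f' W Y))"
      by (rule no_obstruction_left[OF W X Y Lf V Vf(2) Vf(4,5) WV Vf(3) WX' YWs(1) YWs(2) ef' YWe _ _ 2 left nbY'])
         (use e' f' 2 ef' in auto)
    have "join f (join f' W Y) X = join f W X" using 2 ef' by (auto simp: join_def)
    then have "X = Lf \<or> X = Y" using nbY'[OF X s] WX' by simp
    then have "X = Y" using XL by simp
    have "join f X (join f' W Y) = X"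
      by (rule loop0[OF X s, of f f']) (use \<open>X = Y\<close> 2 ef' in auto)
    then have "W f = X f" using 2 ef' by (metis join_left join_right order_refl order_less_le_trans)
    then show ?thesis using Wf Vf(4) by simp
  next
    case 3
    have "X = Y"
    proof -
      have "Str (join f X Y) \<or> Str (join f Y X)"
        by (rule no_obstruction_same[OF W X Y C Vf(2) Vf(4) Wf XW' WX']) (use YWs 3 in auto)
      then show ?thesis
      proof
        assume s: "Str (join f X Y)"
        have "join f X (join f W Y) = join f X Y" "join f (join f W Y) X = join f W X" by (auto simp: join_def)
        then have "X = Lf \<or> X = Y" using nbY[unfolded eY(2)[OF 3], OF X, of f] s WX' by simp
        then show ?thesis using XL by simp
      next
        assume s: "Str (join f Y X)"
        have "join f Y (join f W X) = join f Y X" "join f (join f W X) Y = join f W Y" by (auto simp: join_def)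
        then have "Y = Lf \<or> Y = X" using nbX'[OF Y, of f] s YWs[OF 3] by simp
        then show ?thesis using YL by simp
      qed
    qed
    then show ?thesis using eX eY[OF 3] by simp
  qed
qed

end

section \<open>Touching periodic strings\<close>

text \<open>The reflection is about -1/2, so that the cut p, lying between the letters
  \<open>p - 1\<close> and p, goes to the cut -p.\<close>

definition mirror :: "(int \<Rightarrow> 'l) \<Rightarrow> int \<Rightarrow> 'l" where
  "mirror W = (\<lambda>i. W (- 1 - i))"

lemma mirror_rv [simp]: "mirror (mirror W) = W"
  by (simp add: mirror_def)

lemma mirror_eq_iff: "mirror X = mirror Y \<longleftrightarrow> X = Y"
  by (metis mirror_rv)

lemma mirror_spl: "mirror (join p X Y) = join (- p) (mirror Y) (mirror X)"
  by (auto simp: mirror_def join_def)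

context words begin

text \<open>A factorization of \<open>W\<close> through a band amounts to a periodic word \<open>X\<close> touching \<open>W\<close>: the two
  factors are \<open>join p X W\<close> and \<open>join p W X\<close>.\<close>

definition touch :: "(int \<Rightarrow> 'l) \<Rightarrow> (int \<Rightarrow> 'l) \<Rightarrow> int \<Rightarrow> int \<Rightarrow> bool" where
  "touch W X e f \<longleftrightarrow> periodic X \<and> e \<le> f \<and> (\<forall>i. e \<le> i \<and> i < f \<longrightarrow> X i = W i) \<and>
     Str (join e X W) \<and> Str (join e W X)"

lemma touchD:
  assumes "touch W X e f"
  shows "periodic X" "e \<le> f" "\<And>i. e \<le> i \<Longrightarrow> i < f \<Longrightarrow> X i = W i"
    "\<And>p. e \<le> p \<Longrightarrow> p \<le> f \<Longrightarrow> join p X W = join e X W"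
    "\<And>p. e \<le> p \<Longrightarrow> p \<le> f \<Longrightarrow> join p W X = join e W X"
    "\<And>p. e \<le> p \<Longrightarrow> p \<le> f \<Longrightarrow> Str (join p X W)"
    "\<And>p. e \<le> p \<Longrightarrow> p \<le> f \<Longrightarrow> Str (join p W X)"
proof -
  note t = assms[unfolded touch_def]
  show "periodic X" "e \<le> f" "\<And>i. e \<le> i \<Longrightarrow> i < f \<Longrightarrow> X i = W i" using t by auto
  show 1: "\<And>p. e \<le> p \<Longrightarrow> p \<le> f \<Longrightarrow> join p X W = join e X W"
    by (rule join_move[symmetric]) (use t in auto)
  show 2: "\<And>p. e \<le> p \<Longrightarrow> p \<le> f \<Longrightarrow> join p W X = join e W X"
    by (rule join_move[symmetric]) (use t in auto)
  show "Str (join p X W)" "Str (join p W X)" if "e \<le> p" "p \<le> f" for p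
    using 1[OF that] 2[OF that] t by simp_all
qed

lemma touch_at: "periodic X \<Longrightarrow> Str (join p X W) \<Longrightarrow> Str (join p W X) \<Longrightarrow> touch W X p p"
  by (auto simp: touch_def)

lemma dual_words: "words (\<lambda>a b. T b a) dir (rev ` Rel)"
proof
  show "b = b'" if "T b a" "T b' a" "dir b = dir b'" for a b b' by (rule pred_unique[OF that])
  show "a = a'" if "T b a" "T b a'" "dir a = dir a'" for a b a' by (rule succ_unique[OF that])
  show "T b a" if "T x a" "T x c" "T b c" "dir a \<noteq> dir b" for a b c x
    by (rule cross[OF that(3) that(2) that(1) not_sym[OF that(4)]])
  show "dir a = dir b" if "r \<in> rev ` Rel" "a \<in> set r" "b \<in> set r" for r a b
  proof -
    from that(1) obtain r' where "r' \<in> Rel" "r = rev r'" by blast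
    then show ?thesis using rel_mono[of r' a b] that(2,3) by simp
  qed
qed

lemma dual_Str: "words.Str (\<lambda>a b. T b a) (rev ` Rel) W = Str (mirror W)"
proof -
  have 1: "(\<forall>i. T (W (i + 1)) (W i)) \<longleftrightarrow> (\<forall>i. T (mirror W i) (mirror W (i + 1)))"
  proof
    assume a: "\<forall>i. T (W (i + 1)) (W i)"
    show "\<forall>i. T (mirror W i) (mirror W (i + 1))"
    proof
      fix i
      have "T (W ((- 2 - i) + 1)) (W (- 2 - i))" using a by blast
      moreover have "(- 2 - i) + 1 = - 1 - i" "- 2 - i = - 1 - (i + 1)" by simp_all
      ultimately show "T (mirror W i) (mirror W (i + 1))" unfolding mirror_def by metis
    qed
  next
    assume a: "\<forall>i. T (mirror W i) (mirror W (i + 1))"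
    show "\<forall>i. T (W (i + 1)) (W i)"
    proof
      fix i
      have "T (mirror W (- 2 - i)) (mirror W ((- 2 - i) + 1))" using a by blast
      moreover have "- 1 - (- 2 - i) = i + 1" "- 1 - ((- 2 - i) + 1) = i" by simp_all
      ultimately show "T (W (i + 1)) (W i)" unfolding mirror_def by metis
    qed
  qed
  have 2: "(\<exists>i. \<forall>k<length r. W (i + int k) = rev r ! k) \<longleftrightarrow> (\<exists>i. \<forall>k<length r. mirror W (i + int k) = r ! k)" for r
  proof
    assume "\<exists>i. \<forall>k<length r. W (i + int k) = rev r ! k"
    then obtain i where i: "\<forall>k<length r. W (i + int k) = rev r ! k" by blast
    have "mirror W (- i - int (length r) + int k) = r ! k" if "k < length r" for k
    proof -
      define j where "j = length r - 1 - k"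
      have j: "j < length r" "int j = int (length r) - 1 - int k" using that unfolding j_def by auto
      have "mirror W (- i - int (length r) + int k) = W (i + int j)" unfolding mirror_def j(2) by (simp add: algebra_simps)
      also have "\<dots> = rev r ! j" using i j by blast
      also have "\<dots> = r ! k" using that j unfolding j_def by (simp add: rev_nth)
      finally show ?thesis .
    qed
    then show "\<exists>i. \<forall>k<length r. mirror W (i + int k) = r ! k" by (intro exI[of _ "- i - int (length r)"]) simp
  next
    assume "\<exists>i. \<forall>k<length r. mirror W (i + int k) = r ! k"
    then obtain i where i: "\<forall>k<length r. mirror W (i + int k) = r ! k" by blast
    have "W (- i - int (length r) + int k) = rev r ! k" if "k < length r" for k
    proof -
      define j where "j = length r - 1 - k"
      have j: "j < length r" "int j = int (length r) - 1 - int k" using that unfolding j_def by auto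
      have "W (- i - int (length r) + int k) = mirror W (i + int j)" unfolding mirror_def j(2) by (simp add: algebra_simps)
      also have "\<dots> = r ! j" using i j by blast
      also have "\<dots> = rev r ! k" using that j unfolding j_def by (simp add: rev_nth)
      finally show ?thesis .
    qed
    then show "\<exists>i. \<forall>k<length r. W (i + int k) = rev r ! k" by (intro exI[of _ "- i - int (length r)"]) simp
  qed
  have 3: "(\<forall>r\<in>rev ` Rel. \<forall>i. \<not> (\<forall>k<length r. W (i + int k) = r ! k)) \<longleftrightarrow>
      (\<forall>r\<in>Rel. \<forall>i. \<not> (\<forall>k<length r. mirror W (i + int k) = r ! k))"
    unfolding ball_simps length_rev not_ex[symmetric] 2 ..
  show ?thesis unfolding words.Str_def[OF dual_words] Str_def 1 3 ..
qed

lemma mirror_period: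
  fixes X :: "int \<Rightarrow> 'l"
  shows "(\<exists>n>0. \<forall>i. mirror X (i + n) = mirror X i) \<longleftrightarrow> (\<exists>n>0. \<forall>i. X (i + n) = X i)"
proof -
  have *: "\<forall>i. mirror Y (i + n) = mirror Y i" if "\<forall>i. Y (i + n) = Y i" for Y :: "int \<Rightarrow> 'l" and n
  proof
    fix i
    have "Y ((- 1 - (i + n)) + n) = Y (- 1 - (i + n))" using that by blast
    then show "mirror Y (i + n) = mirror Y i" unfolding mirror_def by (simp add: algebra_simps)
  qed
  show ?thesis using *[of X] *[of "mirror X"] unfolding mirror_rv by metis
qed

lemma dual_pw: "words.periodic (\<lambda>a b. T b a) (rev ` Rel) X = periodic (mirror X)"
  unfolding words.periodic_def[OF dual_words] periodic_def dual_Str mirror_period ..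

lemma dual_touch: "words.touch (\<lambda>a b. T b a) (rev ` Rel) W X e f = touch (mirror W) (mirror X) (- f) (- e)"
proof -
  have *: "(\<forall>i. e \<le> i \<and> i < f \<longrightarrow> X i = W i) \<longleftrightarrow> (\<forall>i. - f \<le> i \<and> i < - e \<longrightarrow> mirror X i = mirror W i)" (is "?l = ?r")
  proof
    assume ?l
    show ?r
    proof (intro allI impI)
      fix i assume "- f \<le> i \<and> i < - e"
      then have "e \<le> - 1 - i \<and> - 1 - i < f" by linarith
      then show "mirror X i = mirror W i" using \<open>?l\<close> unfolding mirror_def by blast
    qed
  next
    assume ?r
    show ?l
    proof (intro allI impI)
      fix i assume "e \<le> i \<and> i < f"
      then have "- f \<le> - 1 - i \<and> - 1 - i < - e" by linarith
      then have "mirror X (- 1 - i) = mirror W (- 1 - i)" using \<open>?r\<close> by blast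
      then show "X i = W i" unfolding mirror_def by simp
    qed
  qed
  have "(touch (mirror W) (mirror X) (- f) (- e)) \<longleftrightarrow> periodic (mirror X) \<and> e \<le> f \<and> ?r \<and> Str (join (- e) (mirror X) (mirror W)) \<and> Str (join (- e) (mirror W) (mirror X))"
  proof -
    have "join (- f) (mirror X) (mirror W) = join (- e) (mirror X) (mirror W)" "join (- f) (mirror W) (mirror X) = join (- e) (mirror W) (mirror X)"
      if "e \<le> f" ?r
      by (rule join_move; use that in simp)+
    then show ?thesis unfolding touch_def by auto
  qed
  then show ?thesis
    unfolding words.touch_def[OF dual_words] dual_pw dual_Str mirror_spl * by blast
qed

end

context domestic_words begin

text \<open>Reading all words backwards gives an instance of the same locale; it provides the mirror
  images of the lemmas on touches.\<close>

lemma dual: "domestic_words (\<lambda>a b. T b a) dir (rev ` Rel)"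
proof -
  interpret dual: words "\<lambda>a b. T b a" dir "rev ` Rel" by (rule dual_words)
  show ?thesis
  proof
    obtain N where N: "N > 0" "\<forall>W i. Str W \<longrightarrow> (\<exists>k. i < k \<and> k < i + N \<and> dir (W k) \<noteq> dir (W i))"
      using mono_bound by (elim exE conjE)
    \<comment> \<open>Read backwards, the bound compares with the far end \<open>i + N\<close> of
      the window. Either that letter or the one found inside differs in direction from W i, hence
      \<open>N + 1\<close>.\<close>
    have "\<exists>k. i < k \<and> k < i + (N + 1) \<and> dir (W k) \<noteq> dir (W i)" if W: "dual.Str W" for W i
    proof -
      have "Str (mirror W)" using W by (simp add: dual_Str)
      then obtain k where k: "- 1 - i - N < k" "k < - 1 - i" "dir (mirror W k) \<noteq> dir (mirror W (- 1 - i - N))"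
        using N(2)[rule_format, of "mirror W" "- 1 - i - N"] by auto
      show ?thesis
      proof (cases "dir (mirror W k) = dir (W i)")
        case True
        then have "dir (W (i + N)) \<noteq> dir (W i)" using k(3) unfolding mirror_def by simp
        then show ?thesis using N(1) by (intro exI[of _ "i + N"]) auto
      next
        case False
        then show ?thesis using k(1,2) unfolding mirror_def by (intro exI[of _ "- 1 - k"]) auto
      qed
    qed
    then show "\<exists>N>0. \<forall>W i. dual.Str W \<longrightarrow> (\<exists>k. i < k \<and> k < i + N \<and> dir (W k) \<noteq> dir (W i))"
      using N(1) by (intro exI[of _ "N + 1"]) auto
    obtain L where L: "\<forall>W m. Str W \<longrightarrow> m > 0 \<longrightarrow> (\<forall>i. W (i + m) = W i) \<longrightarrow>
       (\<exists>n>0. n \<le> L \<and> (\<forall>i. W (i + n) = W i))" using dom by (elim exE)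
    have per: "\<forall>i. mirror Y (i + n) = mirror Y i" if "\<forall>i. Y (i + n) = Y i" for Y :: "int \<Rightarrow> 'l" and n
    proof
      fix i
      have "Y ((- 1 - (i + n)) + n) = Y (- 1 - (i + n))" using that by blast
      then show "mirror Y (i + n) = mirror Y i" unfolding mirror_def by (simp add: algebra_simps)
    qed
    have L': "\<exists>n>0. n \<le> L \<and> (\<forall>i. W (i + n) = W i)" if W: "dual.Str W" "m > 0" "\<forall>i. W (i + m) = W i" for W m
    proof -
      have "Str (mirror W)" using W by (simp add: dual_Str)
      from L[THEN spec, THEN spec, of "mirror W" m, THEN mp, THEN mp, THEN mp, OF this W(2) per[OF W(3)]]
      obtain n where n: "n > 0" "n \<le> L" "\<forall>i. mirror W (i + n) = mirror W i" by (elim exE conjE)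
      show ?thesis using per[OF n(3)] n(1,2) unfolding mirror_rv by (intro exI[of _ n]) simp
    qed
    show "\<exists>L. \<forall>W m. dual.Str W \<longrightarrow> m > 0 \<longrightarrow> (\<forall>i. W (i + m) = W i) \<longrightarrow>
       (\<exists>n>0. n \<le> L \<and> (\<forall>i. W (i + n) = W i))" 
    proof (intro exI[of _ L] allI)
      fix W m
      show "dual.Str W \<longrightarrow> m > 0 \<longrightarrow> (\<forall>i. W (i + m) = W i) \<longrightarrow> (\<exists>n>0. n \<le> L \<and> (\<forall>i. W (i + n) = W i))"
        by (rule impI, rule impI, rule impI, rule L')
    qed
  qed
qed

text \<open>Cuts are turns of power words, so this carries the source cut over from W to the factor
  X | W. If the touch starts inside the tail, the window of R | X makes R monotone from before e1 up
  to f, which leaves no turn of R between e1 and f.\<close>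

lemma touch_turns_right:
  assumes W: "Str W" and R: "periodic R" and t: "touch W X e f" "X (e - 1) \<noteq> W (e - 1)" "X f \<noteq> W f" "X \<noteq> R"
    and right: "\<And>i. e1 \<le> i \<Longrightarrow> W i = R i" "W (e1 - 1) \<noteq> R (e1 - 1)"
    and turn: "dir (R (t - 1)) \<noteq> dir (R t)"
  shows "e1 \<le> t \<Longrightarrow> e \<le> t"
    and "e1 \<le> e \<Longrightarrow> e1 \<le> t \<Longrightarrow> f \<le> t"
    and "(\<And>i. e1' \<le> i \<Longrightarrow> join e X W i = R i) \<Longrightarrow> join e X W (e1' - 1) \<noteq> R (e1' - 1) \<Longrightarrow> e1 \<le> t \<longleftrightarrow> e1' \<le> t"
proof -
  note tD = touchD[OF t(1)]
  have X: "periodic X" and ef: "e \<le> f" using tD by blast+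
  have main: "(e1 \<le> t \<longrightarrow> f \<le> t) \<and> ((\<forall>i. e1' \<le> i \<longrightarrow> join e X W i = R i) \<and> join e X W (e1' - 1) \<noteq> R (e1' - 1) \<longrightarrow> (e1 \<le> t \<longleftrightarrow> e1' \<le> t))"
    if "e1 \<le> e" for e1'
  proof -
    have WR: "W i = R i" if "e \<le> i" for i using right(1) that \<open>e1 \<le> e\<close> by simp
    have XR: "join e X R = join e X W" using WR by (auto simp: join_def)
    then have "Str (join e X R)" using tD(6)[of e] ef by simp
    then obtain g h d s where g: "g < e" and s: "e \<le> s" "s < h" and gR: "\<And>k. g \<le> k \<Longrightarrow> k < e \<Longrightarrow> dir (R k) = d"
      and gX: "\<And>k. e \<le> k \<Longrightarrow> k < h \<Longrightarrow> dir (X k) = d"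
      and s2: "R s \<noteq> X s" "\<And>i. e \<le> i \<Longrightarrow> i < s \<Longrightarrow> R i = X i"
      and gA: "\<And>A. Str A \<Longrightarrow> (\<And>k. g \<le> k \<Longrightarrow> k < e \<Longrightarrow> A k = R k) \<Longrightarrow>
        (\<And>k. e \<le> k \<Longrightarrow> k < h \<Longrightarrow> A k = X k) \<Longrightarrow> False"
      by (rule divergence[OF R X t(4)]) blast
    have sf: "s = f"
    proof (rule ccontr)
      assume "s \<noteq> f"
      then consider "s < f" | "f < s" by linarith
      then show False
      proof cases
        case 1 then show False using tD(3)[of s] WR[of s] s s2(1) by simp
      next
        case 2 then show False using s2(2)[of f] WR[of f] ef t(3) by simp
      qed
    qed
    have "g < e1"
    proof (rule ccontr)
      assume "\<not> g < e1"
      show False by (rule gA[of "join e W X"]) (use tD(7)[of e] ef right(1) \<open>\<not> g < e1\<close> in auto)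
    qed
    have Rd: "dir (R k) = d" if "g \<le> k" "k < f" for k
    proof (cases "k < e")
      case False
      then show ?thesis using s2(2)[of k] gX[of k] that sf s by simp
    qed (use gR that in auto)
    have noturn: "f \<le> t" if "g < t"
    proof (rule ccontr)
      assume "\<not> f \<le> t"
      then show False using Rd[of t] Rd[of "t - 1"] that turn by simp
    qed
    have "e1 \<le> t \<longleftrightarrow> e1' \<le> t" if r': "\<forall>i. e1' \<le> i \<longrightarrow> join e X W i = R i" "join e X W (e1' - 1) \<noteq> R (e1' - 1)"
    proof
      have "e1' \<le> e"
      proof (rule ccontr)
        assume "\<not> e1' \<le> e"
        then show False using r'(2) WR[of "e1' - 1"] by simp
      qed
      show "e1' \<le> t" if "e1 \<le> t" using noturn \<open>g < e1\<close> that \<open>e1' \<le> e\<close> ef by simp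
      show "e1 \<le> t" if "e1' \<le> t"
      proof (rule ccontr)
        assume "\<not> e1 \<le> t"
        then have "\<not> f \<le> t" using \<open>e1 \<le> e\<close> ef by simp
        then have "t \<le> g" using noturn by linarith
        have XRe: "X i = R i" if "e1' \<le> i" "i < e" for i using r'(1) that by (metis join_left)
        show False by (rule gA[OF periodic_Str[OF X]]) (use XRe \<open>t \<le> g\<close> \<open>e1' \<le> t\<close> in auto)
      qed
    qed
    then show ?thesis using noturn \<open>g < e1\<close> by auto
  qed
  show 1: "e1 \<le> e \<Longrightarrow> e1 \<le> t \<Longrightarrow> f \<le> t" using main[of 0] by blast
  then show "e1 \<le> t \<Longrightarrow> e \<le> t" using ef by linarith
  show "e1 \<le> t \<longleftrightarrow> e1' \<le> t" if r': "\<And>i. e1' \<le> i \<Longrightarrow> join e X W i = R i" "join e X W (e1' - 1) \<noteq> R (e1' - 1)"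
  proof (cases "e1 \<le> e")
    case True then show ?thesis using main[of e1'] r' by blast
  next
    \<comment> \<open>A touch starting left of e1 leaves the letters from \<open>e1 - 1\<close> on
      unchanged, so the tail starts at the same place.\<close>
    case False
    have "\<not> e1' < e1" using r'(1)[of "e1 - 1"] right(2) False by auto
    moreover have "\<not> e1 < e1'" using r'(2) right(1)[of "e1' - 1"] False by auto
    ultimately show ?thesis by simp
  qed
qed

lemma touch_turns_left:
  assumes W: "Str W" and Lf: "periodic Lf" and t: "touch W X e f" "X (e - 1) \<noteq> W (e - 1)" "X f \<noteq> W f" "X \<noteq> Lf"
    and left: "\<And>i. i < f2 \<Longrightarrow> W i = Lf i" "W f2 \<noteq> Lf f2"
    and turn: "dir (Lf (t - 1)) \<noteq> dir (Lf t)"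
  shows "t \<le> f2 \<Longrightarrow> t \<le> f"
    and "f \<le> f2 \<Longrightarrow> t \<le> f2 \<Longrightarrow> t \<le> e"
    and "(\<And>i. i < f2' \<Longrightarrow> join e W X i = Lf i) \<Longrightarrow> join e W X f2' \<noteq> Lf f2' \<Longrightarrow> t \<le> f2 \<longleftrightarrow> t \<le> f2'"
proof -
  interpret dual: domestic_words "\<lambda>a b. T b a" dir "rev ` Rel" by (rule dual)
  have a: "dual.Str (mirror W)" "dual.periodic (mirror Lf)" "dual.touch (mirror W) (mirror X) (- f) (- e)"
    "mirror X (- f - 1) \<noteq> mirror W (- f - 1)" "mirror X (- e) \<noteq> mirror W (- e)" "mirror X \<noteq> mirror Lf"
    "\<And>i. - f2 \<le> i \<Longrightarrow> mirror W i = mirror Lf i" "mirror W (- f2 - 1) \<noteq> mirror Lf (- f2 - 1)"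
    "dir (mirror Lf (- t - 1)) \<noteq> dir (mirror Lf (- t))"
    using W Lf t left turn by (auto simp: dual_Str dual_pw dual_touch mirror_eq_iff) (auto simp: mirror_def)
  note d = dual.touch_turns_right[OF a]
  show "t \<le> f2 \<Longrightarrow> t \<le> f" "f \<le> f2 \<Longrightarrow> t \<le> f2 \<Longrightarrow> t \<le> e" using d(1,2) by simp_all
  assume b: "\<And>i. i < f2' \<Longrightarrow> join e W X i = Lf i" "join e W X f2' \<noteq> Lf f2'"
  have e: "join (- f) (mirror X) (mirror W) = mirror (join e W X)"
    using touchD(5)[OF t(1), of f] touchD(2)[OF t(1)] by (simp add: mirror_spl[symmetric])
  have "(- f2 \<le> - t) = (- f2' \<le> - t)"
    by (rule d(3)) (use b in \<open>auto simp: e\<close>, auto simp: mirror_def)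
  then show "t \<le> f2 \<longleftrightarrow> t \<le> f2'" by simp
qed

text \<open>A window of length n shows all letters of E, so both directions occur in it and some
  turn has both of its letters inside.\<close>

lemma window_turn:
  assumes "Str E" "\<And>i. E (i + n) = E i" "n > 0"
  obtains t where "g < t" "t < g + n" "dir (E (t - 1)) \<noteq> dir (E t)"
proof -
  obtain t0 where t0: "dir (E (t0 - 1)) \<noteq> dir (E t0)" using turn_after[OF assms(1)] by metis
  have per: "E (i + n * k) = E i" for i k using periodic_mult[of E n] assms(2) by blast
  have win: "\<exists>j. g \<le> j \<and> j < g + n \<and> E j = E i" for i
  proof (intro exI conjI)
    show "g \<le> g + (i - g) mod n" "g + (i - g) mod n < g + n" using assms(3) by auto
    have "i = g + (i - g) mod n + n * ((i - g) div n)"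
      using mod_mult_div_eq[of "i - g" n] by linarith
    then show "E (g + (i - g) mod n) = E i" using per by metis
  qed
  obtain a b where ab: "g \<le> a" "a < g + n" "E a = E (t0 - 1)" "g \<le> b" "b < g + n" "E b = E t0"
    using win[of "t0 - 1"] win[of t0] by blast
  then have ne: "dir (E a) \<noteq> dir (E b)" using t0 by simp
  then consider "a < b" | "b < a" by (metis linorder_neqE)
  then show thesis
  proof cases
    case 1
    obtain t where "a < t" "t \<le> b" "dir (E (t - 1)) = dir (E a)" "dir (E t) = dir (E b)"
      by (rule turn_between[OF 1 ne])
    then show thesis using that[of t] ab ne by simp
  next
    case 2
    obtain t where "b < t" "t \<le> a" "dir (E (t - 1)) = dir (E b)" "dir (E t) = dir (E a)"
      by (rule turn_between[OF 2 ne[symmetric]])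
    then show thesis using that[of t] ab ne by simp
  qed
qed

text \<open>A third band inside the factor \<open>join e X W\<close> would itself touch \<open>W\<close> along a longer interval, so the
  factors at a longest touch are free of third bands.\<close>

lemma touch_window:
  assumes W: "Str W" and Lf: "periodic Lf" and R: "periodic R"
    and t: "touch W X e f" "X (e - 1) \<noteq> W (e - 1)" "X f \<noteq> W f" "X \<noteq> Lf"
    and left: "\<And>i. i < f2 \<Longrightarrow> W i = Lf i" "W f2 \<noteq> Lf f2"
    and max: "\<And>Z a b. touch W Z a b \<Longrightarrow> Z \<noteq> Lf \<Longrightarrow> Z \<noteq> R \<Longrightarrow> b - a \<le> f - e"
    and p2: "p2 \<le> f2" "dir (Lf (p2 - 1)) \<noteq> dir (Lf p2)"
    and E: "periodic E" "E \<noteq> X" "E \<noteq> R" "g < h" "\<And>i. E (i + (h - g)) = E i"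
    and win: "\<And>i. g \<le> i \<Longrightarrow> i < h \<Longrightarrow> join e X W i = E i"
    and no: "\<not> (p2 \<le> g \<and> (\<forall>i. g \<le> i \<and> i < h \<longrightarrow> W i = E i))"
  shows False
proof -
  note tD = touchD[OF t(1)]
  have X: "periodic X" "Str X" and ef: "e \<le> f" and XW: "\<And>i. e \<le> i \<Longrightarrow> i < f \<Longrightarrow> X i = W i"
    using tD periodic_Str by blast+
  have SE: "Str E" using E(1) by simp
  define W' where "W' = join e X W"
  have W': "Str W'" unfolding W'_def using tD(6)[of e] ef by simp
  have W'X: "W' i = X i" if "i < f" for i using XW[of i] that unfolding W'_def by (cases "i < e") auto
  have W'W: "W' i = W i" if "e \<le> i" for i using that unfolding W'_def by simp
  have win': "W' i = E i" if "g \<le> i" "i < h" for i using win that unfolding W'_def by simp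
  \<comment> \<open>Left of f the factor reads X, and a turn of E there would be shared with X. So
    the turn inside the window lies at f or beyond, and the window ends beyond f.\<close>
  have noXE: "dir (E (s - 1)) = dir (E s)" if "g < s" "s < h" "s < f" for s
  proof (rule ccontr)
    assume d: "dir (E (s - 1)) \<noteq> dir (E s)"
    have "E = X" by (rule turn_eq[OF E(1) X(1) _ _ d]) (use win'[of s] win'[of "s - 1"] W'X[of s] W'X[of "s - 1"] that in auto)
    then show False using E(2) by simp
  qed
  obtain t where t0: "g < t" "t < h" "dir (E (t - 1)) \<noteq> dir (E t)"
    by (rule window_turn[OF SE E(5), of g]) (use E(4) in auto)
  have tf: "f \<le> t" using noXE[of t] t0 by linarith
  have fh: "f < h" using tf t0 by simp
  show False
  proof (cases "g < e")
    case True
    have EW: "E i = W i" if "e \<le> i" "i < h" for i using win'[of i] W'W[of i] that True by simp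
    have E1: "E (e - 1) \<noteq> W (e - 1)" using win'[of "e - 1"] W'X[of "e - 1"] True ef fh t(2) by simp
    have "Str (join t E W')" by (rule glue_turn) (use SE W' win'[of t] win'[of "t - 1"] t0 in auto)
    moreover have "join t E W' = join e E W" using EW W'W tf ef t0 by (auto simp: join_def)
    ultimately have a: "Str (join e E W)" by simp
    \<comment> \<open>The splice W | E needs a turn of E in (e, h]. Failing that, t = e, and E g = E
      h differs in direction from \<open>E (e - 1)\<close>; E would then turn between g and e,
      against \<open>noXE\<close>.\<close>
    have "\<exists>s. e < s \<and> s \<le> h \<and> dir (E (s - 1)) \<noteq> dir (E s)"
    proof (cases "dir (E e) = dir (E h)")
      case False
      have "e < h" using ef fh by simp
      show ?thesis by (rule turn_between[OF \<open>e < h\<close> False]) (use False in auto)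
    next
      case True
      show ?thesis
      proof (cases "e < t")
        case True then show ?thesis using t0 by (intro exI[of _ t]) simp
      next
        case False
        then have te: "t = e" using tf ef by simp
        have "E h = E g" using E(5)[of g] by simp
        then have ne: "dir (E g) \<noteq> dir (E (e - 1))" using t0(3) te True by simp
        then have "g < e - 1" using \<open>g < e\<close> by (cases "g = e - 1") auto
        obtain s where "g < s" "s \<le> e - 1" "dir (E (s - 1)) \<noteq> dir (E s)"
          by (rule turn_between[OF \<open>g < e - 1\<close> ne]) (use ne that in auto)
        then show ?thesis using noXE[of s] ef fh by simp
      qed
    qed
    then obtain s where s: "e < s" "s \<le> h" "dir (E (s - 1)) \<noteq> dir (E s)" by blast
    have "Str (join s W E)" by (rule glue_turn) (use W SE EW[of "s - 1"] s in auto)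
    moreover have "join s W E = join e W E" by (rule join_move[symmetric]) (use EW s in auto)
    ultimately have b: "Str (join e W E)" by simp
    have tE: "touch W E e h" unfolding touch_def using E(1) EW a b ef fh by simp
    have "E \<noteq> Lf"
    proof
      assume "E = Lf"
      then have "join e W E = E" by (intro loop0[OF E(1) b, of "min e f2" e]) (use left in auto)
      then show False using E1 by (metis join_left zle_diff1_eq order_refl)
    qed
    then have "h - e \<le> f - e" using max[OF tE] E(3) by simp
    then show False using fh by simp
  next
    case False
    \<comment> \<open>The window now lies in W itself, so by \<open>no\<close> it starts before p2,
      in the left tail. X follows Lf on [e, f2), and a turn of Lf strictly inside would be shared
      with X; hence p2 = f2 and X is monotone before f2.\<close>
    have WE: "W i = E i" if "g \<le> i" "i < h" for i using win'[of i] W'W[of i] that False by simp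
    have gp: "g < p2" using no WE by auto
    have ff: "f2 < f"
    proof (rule ccontr)
      assume "\<not> f2 < f"
      then have "p2 \<le> e" using touch_turns_left(2)[OF W Lf t(1-4) left p2(2)] p2(1) by simp
      then show False using gp False by simp
    qed
    have XL: "X i = Lf i" if "e \<le> i" "i < f2" for i using XW[of i] left(1)[of i] that ff by simp
    have pf2: "p2 = f2"
    proof (rule ccontr)
      assume "p2 \<noteq> f2"
      then have "X = Lf" by (intro turn_eq[OF X(1) Lf, of p2]) (use XL p2 gp False in auto)
      then show False using t(4) by simp
    qed
    define d where "d = dir (Lf (f2 - 1))"
    have Xd: "dir (X i) = d" if "e \<le> i" "i < f2" for i
    proof (rule ccontr)
      assume "dir (X i) \<noteq> d"
      then have ne: "dir (X i) \<noteq> dir (X (f2 - 1))" using XL[of "f2 - 1"] gp pf2 False that unfolding d_def by simp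
      then have "i < f2 - 1" using that by (cases "i = f2 - 1") auto
      obtain s where "i < s" "s \<le> f2 - 1" "dir (X (s - 1)) \<noteq> dir (X s)"
        by (rule turn_between[OF \<open>i < f2 - 1\<close> ne]) (use ne that in auto)
      then have "X = Lf" by (intro turn_eq[OF X(1) Lf, of s]) (use XL that in auto)
      then show False using t(4) by simp
    qed
    have EL: "E \<noteq> Lf" using WE[of f2] left(2) gp pf2 ff fh by auto
    show False
    proof (cases "\<forall>i. e \<le> i \<and> i < g \<longrightarrow> W i = E i")
      case True
      then have EW: "E i = W i" if "e \<le> i" "i < h" for i using WE[of i] that by (cases "i < g") auto
      have "Str (join t E W)" by (rule glue_turn) (use SE W WE[of t] WE[of "t - 1"] t0 in auto)
      moreover have "join t E W = join e E W" by (rule join_move[symmetric]) (use EW t0 tf ef in auto)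
      moreover have "Str (join t W E)" by (rule glue_turn) (use SE W WE[of t] WE[of "t - 1"] t0 in auto)
      moreover have "join t W E = join e W E" by (rule join_move[symmetric]) (use EW t0 tf ef in auto)
      ultimately have "touch W E e h" unfolding touch_def using E(1) EW ef fh by simp
      then have "h - e \<le> f - e" using max EL E(3) by blast
      then show False using fh by simp
    next
      case ne: False
      \<comment> \<open>Going left, E leaves W at a place where W follows X in the constant
        direction d. So E turns there, and E and X can be spliced in both orders.\<close>
      then obtain i0 where i0: "e \<le> i0" "i0 < g" "W i0 \<noteq> E i0" by blast
      obtain k where k: "i0 \<le> k" "k \<le> g - 1" "W k \<noteq> E k" "\<And>i. k < i \<Longrightarrow> i \<le> g - 1 \<Longrightarrow> \<not> W i \<noteq> E i"
        by (rule last_diff[of i0 "g - 1" "\<lambda>i. W i \<noteq> E i"]) (use i0 in auto)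
      define a where "a = k + 1"
      have a: "e < a" "a \<le> g" "a < f2" "k = a - 1" using k i0 gp pf2 unfolding a_def by simp_all
      have EW: "E i = W i" if "a \<le> i" "i < h" for i using WE[of i] k(4)[of i] that unfolding a_def by (cases "i < g") auto
      have Ea: "E a = X a" using EW[of a] XW[of a] a ff fh by simp
      have "T (E k) (E a)" "T (W k) (W a)" using Str_T[OF SE, of a] Str_T[OF W, of a] a by simp_all
      then have "dir (E k) = (\<not> dir (W k))" using pred_neq[of "W k" "W a" "E k"] EW[of a] k(3) a ff fh by simp
      moreover have "dir (W k) = d" using Xd[of k] XW[of k] a k i0 ff by simp
      moreover have "dir (E a) = d" using Xd[of a] Ea a by simp
      ultimately have EX: "Str (join a E X)" by (intro glue_turn') (use SE X Ea a in auto)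
      have "Str (join t W' E)" by (rule glue_turn) (use SE W' win'[of "t - 1"] t0 in auto)
      moreover have "join t W' E = join a X E"
      proof
        fix i
        consider "i < a" | "a \<le> i" "i < f" | "f \<le> i" "i < t" | "t \<le> i" "f \<le> i" using tf by linarith
        then show "join t W' E i = join a X E i"
        proof cases
          case 1 then show ?thesis using W'X[of i] a ff tf by simp
        next
          case 2 then show ?thesis using W'X[of i] EW[of i] XW[of i] a tf fh by simp
        next
          case 3 then show ?thesis using W'W[of i] EW[of i] a tf ef t0 ff by simp
        next
          case 4 then show ?thesis using a ff by simp
        qed
      qed
      ultimately have "Str (join a X E)" by simp
      then show False using splice_both[OF E(1) X(1) EX] E(2) by simp
    qed
  qed
qed

lemma touch_window_left:
  assumes W: "Str W" and Lf: "periodic Lf" and R: "periodic R"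
    and t: "touch W X e f" "X (e - 1) \<noteq> W (e - 1)" "X f \<noteq> W f" "X \<noteq> R"
    and right: "\<And>i. e1 \<le> i \<Longrightarrow> W i = R i" "W (e1 - 1) \<noteq> R (e1 - 1)"
    and max: "\<And>Z a b. touch W Z a b \<Longrightarrow> Z \<noteq> Lf \<Longrightarrow> Z \<noteq> R \<Longrightarrow> b - a \<le> f - e"
    and p1: "e1 \<le> p1" "dir (R (p1 - 1)) \<noteq> dir (R p1)"
    and E: "periodic E" "E \<noteq> X" "E \<noteq> Lf" "g < h" "\<And>i. E (i + (h - g)) = E i"
    and win: "\<And>i. g \<le> i \<Longrightarrow> i < h \<Longrightarrow> join e W X i = E i"
    and no: "\<not> (h \<le> p1 \<and> (\<forall>i. g \<le> i \<and> i < h \<longrightarrow> W i = E i))"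
  shows False
proof -
  interpret dual: domestic_words "\<lambda>a b. T b a" dir "rev ` Rel" by (rule dual)
  have per: "mirror E (i + (- g - - h)) = mirror E i" for i
    using E(5)[of "- 1 - (i + (h - g))"] unfolding mirror_def by (simp add: algebra_simps)
  have e: "join (- f) (mirror X) (mirror W) = mirror (join e W X)"
    using touchD(5)[OF t(1), of f] touchD(2)[OF t(1)] by (simp add: mirror_spl[symmetric])
  show False
  proof (rule dual.touch_window[of "mirror W" "mirror R" "mirror Lf" "mirror X" "- f" "- e" "- e1" "- p1" "mirror E" "- h" "- g"])
    show "dual.Str (mirror W)" "dual.periodic (mirror R)" "dual.periodic (mirror Lf)" "dual.touch (mirror W) (mirror X) (- f) (- e)"
      "dual.periodic (mirror E)"
      using W Lf R t(1) E(1) by (simp_all add: dual_Str dual_pw dual_touch)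
    show "mirror X \<noteq> mirror R" "mirror E \<noteq> mirror X" "mirror E \<noteq> mirror Lf" using t(4) E(2,3) by (simp_all add: mirror_eq_iff)
    show "mirror X (- f - 1) \<noteq> mirror W (- f - 1)" "mirror X (- e) \<noteq> mirror W (- e)" "mirror W (- e1) \<noteq> mirror R (- e1)"
      "dir (mirror R (- p1 - 1)) \<noteq> dir (mirror R (- p1))"
      using t(2,3) right(2) p1(2) by (auto simp: mirror_def)
    show "- p1 \<le> - e1" "- h < - g" using p1 E(4) by simp_all
    show "mirror W i = mirror R i" if "i < - e1" for i using right(1)[of "- 1 - i"] that by (simp add: mirror_def)
    show "b - a \<le> - e - - f" if "dual.touch (mirror W) Z a b" "Z \<noteq> mirror R" "Z \<noteq> mirror Lf" for Z a b
      using max[of "mirror Z" "- b" "- a"] that by (simp add: dual_touch) (metis mirror_rv)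
    show "mirror E (i + (- g - - h)) = mirror E i" for i by (rule per)
    show "join (- f) (mirror X) (mirror W) i = mirror E i" if "- h \<le> i" "i < - g" for i
      unfolding e using win[of "- 1 - i"] that by (simp add: mirror_def)
    show "\<not> (- p1 \<le> - h \<and> (\<forall>i. - h \<le> i \<and> i < - g \<longrightarrow> mirror W i = mirror E i))"
    proof
      assume a: "- p1 \<le> - h \<and> (\<forall>i. - h \<le> i \<and> i < - g \<longrightarrow> mirror W i = mirror E i)"
      have "W i = E i" if "g \<le> i" "i < h" for i
      proof -
        have "- h \<le> - 1 - i \<and> - 1 - i < - g" using that by linarith
        then have "mirror W (- 1 - i) = mirror E (- 1 - i)" using a by blast
        then show ?thesis unfolding mirror_def by simp
      qed
      then show False using no a by simp
    qed
  qed
qed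

end

section \<open>Words of weak bridges\<close>

definition seg :: "(int \<Rightarrow> 'l) \<Rightarrow> int \<Rightarrow> int \<Rightarrow> 'l list" where
  "seg W i j = map (\<lambda>k. W (i + int k)) [0..<nat (j - i)]"

lemma length_seg [simp]: "length (seg W i j) = nat (j - i)"
  by (simp add: seg_def)

lemma nth_seg [simp]: "k < nat (j - i) \<Longrightarrow> seg W i j ! k = W (i + int k)"
  by (simp add: seg_def)

lemma seg_append: "i \<le> j \<Longrightarrow> j \<le> k \<Longrightarrow> seg W i j @ seg W j k = seg W i k"
  by (rule nth_equalityI) (auto simp: nth_append algebra_simps)

lemma seg_cong: "(\<And>x. i \<le> x \<Longrightarrow> x < j \<Longrightarrow> W x = V x) \<Longrightarrow> seg W i j = seg V i j"
  unfolding seg_def by (rule map_cong) auto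

lemma seg_shift: "seg (\<lambda>x. W (x + k)) i j = seg W (i + k) (j + k)"
  by (simp add: seg_def algebra_simps)

lemma seg_eqD: "seg W i j = seg V i' (i' + (j - i)) \<Longrightarrow> i \<le> x \<Longrightarrow> x < j \<Longrightarrow> W x = V (x - i + i')"
proof -
  assume a: "seg W i j = seg V i' (i' + (j - i))" and x: "i \<le> x" "x < j"
  have "seg W i j ! nat (x - i) = seg V i' (i' + (j - i)) ! nat (x - i)" using a by simp
  then show ?thesis using x by (simp add: algebra_simps)
qed

text \<open>The parameter p is a cut: a position at which a copy of b starts.\<close>

definition power_word :: "'l list \<Rightarrow> int \<Rightarrow> int \<Rightarrow> 'l" where
  "power_word b p i = b ! nat ((i - p) mod int (length b))"

lemma power_word_shift: "power_word b p (i + k) = power_word b (p - k) i"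
  by (simp add: power_word_def algebra_simps)

lemma power_word_period: "power_word b p (i + int (length b)) = power_word b p i"
  by (simp add: power_word_def diff_add_eq[symmetric])

lemma power_word_cong: "int (length b) dvd p - q \<Longrightarrow> power_word b p = power_word b q"
proof
  fix i assume "int (length b) dvd p - q"
  then have "(i - p) mod int (length b) = (i - q) mod int (length b)"
    by (simp add: mod_eq_dvd_iff dvd_diff_commute)
  then show "power_word b p i = power_word b q i" by (simp add: power_word_def)
qed

lemma power_word_nth: "0 \<le> k \<Longrightarrow> k < int (length b) \<Longrightarrow> power_word b p (p + k) = b ! nat k"
  by (simp add: power_word_def)

lemma power_word_hd: "b \<noteq> [] \<Longrightarrow> power_word b p p = hd b"
  using power_word_nth[of 0 b p] by (simp add: hd_conv_nth)

lemma power_word_last: "b \<noteq> [] \<Longrightarrow> power_word b p (p - 1) = last b"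
proof -
  assume b: "b \<noteq> []"
  have "power_word b p (p - 1) = power_word b p (p + (int (length b) - 1))"
    using power_word_period[of b p "p - 1"] by (simp add: algebra_simps)
  also have "\<dots> = b ! (length b - 1)" using b power_word_nth[of "int (length b) - 1" b p] by (simp add: nat_diff_distrib Suc_leI)
  finally show ?thesis using b by (simp add: last_conv_nth)
qed

lemma seg_pword: "seg (power_word b p) p (p + int (length b)) = b"
  by (rule nth_equalityI) (auto simp: power_word_nth)

text \<open>B contains one list for each periodic string up to shift. The word determines its list
  and, by \<open>B_prim\<close>, the cuts modulo its length; \<open>B_hd\<close> and
  \<open>B_last\<close> make every cut a turn from inverse to direct.\<close>

locale band_words = domestic_words T dir Rel
  for T :: "'l \<Rightarrow> 'l \<Rightarrow> bool" and dir :: "'l \<Rightarrow> bool" and Rel :: "'l list set" +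
  fixes B :: "'l list set"
  assumes B_ne: "b \<in> B \<Longrightarrow> b \<noteq> []"
    and B_hd: "b \<in> B \<Longrightarrow> dir (hd b)"
    and B_last: "b \<in> B \<Longrightarrow> \<not> dir (last b)"
    and B_Str: "b \<in> B \<Longrightarrow> Str (power_word b 0)"
    and B_prim: "b \<in> B \<Longrightarrow> power_word b p = power_word b q \<Longrightarrow> int (length b) dvd p - q"
    and B_rep: "periodic X \<Longrightarrow> \<exists>b\<in>B. \<exists>p. X = power_word b p"
    and B_uniq: "b \<in> B \<Longrightarrow> b' \<in> B \<Longrightarrow> power_word b p = power_word b' q \<Longrightarrow> b = b'"
begin

section \<open>Cuts and tails of the word of a weak bridge\<close>

lemma B_pw: "b \<in> B \<Longrightarrow> periodic (power_word b p)"
proof -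
  assume b: "b \<in> B"
  have "periodic (power_word b 0)" unfolding periodic_def
    using B_Str[OF b] B_ne[OF b] power_word_period by (intro conjI exI[of _ "int (length b)"]) auto
  then have "periodic (\<lambda>i. power_word b 0 (i + (- p)))" by (rule periodic_shift)
  moreover have "(\<lambda>i. power_word b 0 (i + (- p))) = power_word b p" unfolding power_word_shift by simp
  ultimately show ?thesis by simp
qed

lemma len_pos: "b \<in> B \<Longrightarrow> int (length b) > 0"
  using B_ne by simp

lemma cut_dirs:
  assumes "b \<in> B" shows "dir (power_word b p p)" "\<not> dir (power_word b p (p - 1))" "dir (power_word b p (p - 1)) \<noteq> dir (power_word b p p)"
  using power_word_hd power_word_last B_ne B_hd B_last assms by metis+

text \<open>\<open>bridge_word W p2 p1 b2 b1\<close>: the letters of \<open>W\<close> in \<open>[p2, p1)\<close> form a weak bridge from \<open>b1\<close> to \<open>b2\<close>, and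
  \<open>W\<close> continues it by the powers of the two bands.\<close>

definition free :: "(int \<Rightarrow> 'l) \<Rightarrow> int \<Rightarrow> int \<Rightarrow> bool" where
  "free W p2 p1 \<longleftrightarrow> (\<forall>b\<in>B. \<forall>s g. p2 \<le> g \<longrightarrow> g + int (length b) \<le> p1 \<longrightarrow>
     \<not> (\<forall>i. g \<le> i \<and> i < g + int (length b) \<longrightarrow> W i = power_word b s i))"

definition bridge_word :: "(int \<Rightarrow> 'l) \<Rightarrow> int \<Rightarrow> int \<Rightarrow> 'l list \<Rightarrow> 'l list \<Rightarrow> bool" where
  "bridge_word W p2 p1 b2 b1 \<longleftrightarrow> b1 \<in> B \<and> b2 \<in> B \<and> Str W \<and> p2 \<le> p1 \<and>
     (\<forall>i<p2. W i = power_word b2 p2 i) \<and> (\<forall>i\<ge>p1. W i = power_word b1 p1 i) \<and>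
     free W p2 p1 \<and> \<not> (b1 = b2 \<and> p1 = p2)"

lemma freeD: "free W p2 p1 \<Longrightarrow> b \<in> B \<Longrightarrow> p2 \<le> g \<Longrightarrow> g + int (length b) \<le> p1 \<Longrightarrow>
    (\<And>i. g \<le> i \<Longrightarrow> i < g + int (length b) \<Longrightarrow> W i = power_word b s i) \<Longrightarrow> False"
  unfolding free_def by blast

lemma wbrepD:
  assumes "bridge_word W p2 p1 b2 b1"
  shows "b1 \<in> B" "b2 \<in> B" "Str W" "p2 \<le> p1" "\<And>i. i < p2 \<Longrightarrow> W i = power_word b2 p2 i"
    "\<And>i. p1 \<le> i \<Longrightarrow> W i = power_word b1 p1 i" "free W p2 p1" "\<not> (b1 = b2 \<and> p1 = p2)"
  using assms unfolding bridge_word_def by auto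

lemma agree_turn:
  assumes X: "periodic X" and Y: "periodic Y" and "a \<le> b" "\<And>i. a \<le> i \<Longrightarrow> i \<le> b \<Longrightarrow> X i = Y i"
    "dir (X a) \<noteq> dir (X b)"
  shows "X = Y"
proof -
  have "a < b" using assms(3,5) by (cases "a = b") auto
  obtain t where t: "a < t" "t \<le> b" "dir (X (t - 1)) = dir (X a)" "dir (X t) = dir (X b)"
    by (rule turn_between[OF \<open>a < b\<close> assms(5)])
  show ?thesis by (rule turn_eq[OF X Y, of t]) (use t assms(4)[of t] assms(4)[of "t - 1"] assms(5) in auto)
qed

text \<open>With equal bands, \<open>loop\<close> makes W a power word. A non-empty piece of it
  between two cuts contains a copy of the band, and the empty one is the excluded trivial weak
  bridge.\<close>

lemma bridge_word_bands_neq: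
  assumes "bridge_word W p2 p1 b2 b1" shows "b1 \<noteq> b2"
proof
  assume e: "b1 = b2"
  note w = wbrepD[OF assms]
  have b: "periodic (power_word b1 p1)" "periodic (power_word b2 p2)" using B_pw w by blast+
  have W: "W = power_word b2 p2"
  proof (rule loop[OF b(2) w(3), of p2 p2 "p1 - p2"])
    show "W (i + (p1 - p2)) = power_word b2 p2 i" if "p2 \<le> i" for i
      using w(6)[of "i + (p1 - p2)"] that e by (simp add: power_word_shift)
  qed (rule w(5))
  have "power_word b1 p1 = power_word b2 p2"
    by (rule periodic_agree_right[OF b, of p1]) (use w(6) W in simp)
  then have "int (length b2) dvd p1 - p2" using B_prim w(2) e by blast
  moreover have "p1 - p2 > 0" using w(4,8) e by simp
  ultimately have "int (length b2) \<le> p1 - p2" by (rule zdvd_imp_le)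
  then show False using W by (intro freeD[OF w(7,2), of p2 p2]) simp_all
qed

lemma bridge_word_tails_neq: "bridge_word W p2 p1 b2 b1 \<Longrightarrow> power_word b2 p2 \<noteq> power_word b1 p1"
  using bridge_word_bands_neq B_uniq wbrepD(1,2) by metis

lemma bridge_word_neq_left: "bridge_word W p2 p1 b2 b1 \<Longrightarrow> W \<noteq> power_word b2 p2"
proof
  assume w: "bridge_word W p2 p1 b2 b1" and "W = power_word b2 p2"
  then have "power_word b2 p2 = power_word b1 p1"
    by (intro periodic_agree_right[of _ _ p1] B_pw) (use wbrepD[OF w] in auto)
  then show False using bridge_word_tails_neq[OF w] by simp
qed

lemma bridge_word_neq_right: "bridge_word W p2 p1 b2 b1 \<Longrightarrow> W \<noteq> power_word b1 p1"
proof
  assume w: "bridge_word W p2 p1 b2 b1" and "W = power_word b1 p1"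
  then have "power_word b2 p2 = power_word b1 p1"
    by (intro periodic_agree_left[of _ _ p2] B_pw) (use wbrepD[OF w] in auto)
  then show False using bridge_word_tails_neq[OF w] by simp
qed

lemma exact_right:
  assumes "W \<noteq> R" "\<And>i. p \<le> i \<Longrightarrow> W i = R i"
  obtains e1 :: int where "e1 \<le> p" "\<forall>i\<ge>e1. W i = R i" "W (e1 - 1) \<noteq> R (e1 - 1)"
proof -
  obtain i where i: "W i \<noteq> R i" using assms(1) by blast
  then have ip: "i \<le> p - 1" using assms(2)[of i] by (cases "i \<le> p - 1") auto
  obtain k where k: "i \<le> k" "k \<le> p - 1" "W k \<noteq> R k" "\<And>i. k < i \<Longrightarrow> i \<le> p - 1 \<Longrightarrow> \<not> W i \<noteq> R i"
    by (rule last_diff[of i "p - 1" "\<lambda>i. W i \<noteq> R i"]) (use i ip in auto)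
  show thesis
  proof (rule that[of "k + 1"])
    have "W i = R i" if "k + 1 \<le> i" for i using k(4)[of i] assms(2)[of i] that by (cases "p \<le> i") auto
    then show "\<forall>i\<ge>k + 1. W i = R i" by blast
  qed (use k in auto)
qed

lemma exact_left:
  assumes "W \<noteq> Lf" "\<And>i. i < p \<Longrightarrow> W i = Lf i"
  obtains f2 :: int where "p \<le> f2" "\<forall>i<f2. W i = Lf i" "W f2 \<noteq> Lf f2"
proof -
  obtain i where i: "W i \<noteq> Lf i" using assms(1) by blast
  then have ip: "p \<le> i" using assms(2)[of i] by (cases "p \<le> i") auto
  obtain k where k: "p \<le> k" "k \<le> i" "W k \<noteq> Lf k" "\<And>i. p \<le> i \<Longrightarrow> i < k \<Longrightarrow> \<not> W i \<noteq> Lf i"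
    by (rule first_diff[of p i "\<lambda>i. W i \<noteq> Lf i"]) (use i ip in auto)
  show thesis
  proof (rule that[of k])
    have "W i = Lf i" if "i < k" for i using k(4)[of i] assms(2)[of i] that by (cases "i < p") auto
    then show "\<forall>i<k. W i = Lf i" by blast
  qed (use k in auto)
qed

text \<open>A tail reaching a full period left of p1 would contain one more copy of b1. Either this
  copy lies between the cuts, against band-freeness, or it starts in the other tail and the two
  tails share a turn.\<close>

lemma cut_right_bound:
  assumes w: "bridge_word W p2 p1 b2 b1" and e1: "\<And>i. e1 \<le> i \<Longrightarrow> W i = power_word b1 p1 i"
  shows "p1 < e1 + int (length b1)"
proof (rule ccontr)
  assume n: "\<not> ?thesis"
  note wD = wbrepD[OF w]
  define c where "c = p1 - int (length b1)"
  have c: "e1 \<le> c" "c < p1" using n len_pos[OF wD(1)] unfolding c_def by auto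
  have cut: "power_word b1 c = power_word b1 p1" by (rule power_word_cong) (simp add: c_def)
  have "c < p2"
  proof (rule ccontr)
    assume "\<not> c < p2"
    then show False using e1 c by (intro freeD[OF wD(7,1), of c p1]) (auto simp: c_def)
  qed
  have "power_word b1 p1 = power_word b2 p2"
  proof (rule agree_turn)
    show "periodic (power_word b1 p1)" "periodic (power_word b2 p2)" using B_pw wD by blast+
    show "c \<le> p2 - 1" using \<open>c < p2\<close> by simp
    show eq: "power_word b1 p1 i = power_word b2 p2 i" if "c \<le> i" "i \<le> p2 - 1" for i
      using e1[of i] wD(5)[of i] c that by simp
    show "dir (power_word b1 p1 c) \<noteq> dir (power_word b1 p1 (p2 - 1))"
      using eq[of "p2 - 1"] \<open>c < p2\<close> cut_dirs(1)[OF wD(1), of c] cut_dirs(2)[OF wD(2), of p2] cut by simp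
  qed
  then show False using bridge_word_tails_neq[OF w] by simp
qed

lemma cut_left_bound:
  assumes w: "bridge_word W p2 p1 b2 b1" and f2: "\<And>i. i < f2 \<Longrightarrow> W i = power_word b2 p2 i"
  shows "f2 < p2 + int (length b2)"
proof (rule ccontr)
  assume n: "\<not> ?thesis"
  note wD = wbrepD[OF w]
  define c where "c = p2 + int (length b2)"
  have c: "c \<le> f2" "p2 < c" using n len_pos[OF wD(2)] unfolding c_def by auto
  have cut: "power_word b2 c = power_word b2 p2" by (rule power_word_cong) (simp add: c_def)
  have "p1 < c"
  proof (rule ccontr)
    assume "\<not> p1 < c"
    then show False using f2 c by (intro freeD[OF wD(7,2), of p2 p2]) (auto simp: c_def)
  qed
  have "power_word b1 p1 = power_word b2 p2"
  proof (rule agree_turn)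
    show "periodic (power_word b1 p1)" "periodic (power_word b2 p2)" using B_pw wD by blast+
    show "p1 \<le> c - 1" using \<open>p1 < c\<close> by simp
    show eq: "power_word b1 p1 i = power_word b2 p2 i" if "p1 \<le> i" "i \<le> c - 1" for i
      using f2[of i] wD(6)[of i] c that by simp
    show "dir (power_word b1 p1 p1) \<noteq> dir (power_word b1 p1 (c - 1))"
      using eq[of "c - 1"] \<open>p1 < c\<close> cut_dirs(1)[OF wD(1), of p1] cut_dirs(2)[OF wD(2), of c] cut by simp
  qed
  then show False using bridge_word_tails_neq[OF w] by simp
qed

lemma close_cuts:
  assumes "int (length b) dvd p - q" "e \<le> p" "p < e + int (length b)" "e \<le> q" "q < e + int (length b)"
  shows "p = q"
proof -
  have "\<bar>p - q\<bar> < int (length b)" using assms by linarith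
  then show ?thesis using zdvd_imp_le[of "int (length b)" "\<bar>p - q\<bar>"] assms(1) by (cases "p = q") auto
qed

text \<open>This recovers the weak bridge from its word: the tails fix the cuts modulo the band
  lengths, and the bounds above leave one choice for each.\<close>

lemma cut_unique:
  assumes w: "bridge_word W p2 p1 b2 b1" and w': "bridge_word W p2' p1' b2 b1"
  shows "p1 = p1' \<and> p2 = p2'"
proof
  note wD = wbrepD[OF w] and wD' = wbrepD[OF w']
  have R: "power_word b1 p1 = power_word b1 p1'"
  proof (rule periodic_agree_right[of _ _ "max p1 p1'"])
    show "power_word b1 p1 i = power_word b1 p1' i" if "max p1 p1' \<le> i" for i
      using wD(6)[of i] wD'(6)[of i] that by simp
  qed (rule B_pw[OF wD(1)])+
  have L: "power_word b2 p2 = power_word b2 p2'"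
  proof (rule periodic_agree_left[of _ _ "min p2 p2'"])
    show "power_word b2 p2 i = power_word b2 p2' i" if "i < min p2 p2'" for i
      using wD(5)[of i] wD'(5)[of i] that by simp
  qed (rule B_pw[OF wD(2)])+
  obtain e1 where e1': "e1 \<le> p1" "\<forall>i\<ge>e1. W i = power_word b1 p1 i" "W (e1 - 1) \<noteq> power_word b1 p1 (e1 - 1)"
    by (rule exact_right[OF bridge_word_neq_right[OF w] wD(6)])
  note e1 = e1'(1) e1'(2)[rule_format] e1'(3)
  obtain f2 where f2': "p2 \<le> f2" "\<forall>i<f2. W i = power_word b2 p2 i" "W f2 \<noteq> power_word b2 p2 f2"
    by (rule exact_left[OF bridge_word_neq_left[OF w] wD(5)])
  note f2 = f2'(1) f2'(2)[rule_format] f2'(3)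
  have "\<not> p1' \<le> e1 - 1" using wD'(6)[of "e1 - 1"] e1(3) R by auto
  then show "p1 = p1'"
    using close_cuts[of b1 p1 p1' e1] B_prim[OF wD(1) R] e1(1) cut_right_bound[OF w e1(2)]
      cut_right_bound[OF w', of e1] e1(2) R by simp
  have "\<not> f2 < p2'" using wD'(5)[of f2] f2(3) L by auto
  moreover have "f2 < p2 + int (length b2)" by (rule cut_left_bound[OF w f2(2)])
  moreover have "f2 < p2' + int (length b2)"
    by (rule cut_left_bound[OF w']) (use f2(2) L in simp)
  ultimately show "p2 = p2'"
    using close_cuts[of b2 p2 p2' "f2 - int (length b2) + 1"] B_prim[OF wD(2) L] f2(1) by simp
qed

text \<open>The cuts are the extreme ones: p1 is the first cut from e1 on, and p2 the last cut up to
  f2. A copy of b1 or b2 between them would be joined by \<open>loop\<close> or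
  \<open>loop_right\<close> to its own tail, which would then reach beyond its end; so only third
  bands remain to be excluded.\<close>

lemma build_wbrep:
  assumes b: "b1 \<in> B" "b2 \<in> B" and W: "Str W"
    and left: "\<And>i. i < f2 \<Longrightarrow> W i = power_word b2 p2 i" "W f2 \<noteq> power_word b2 p2 f2"
    and right: "\<And>i. e1 \<le> i \<Longrightarrow> W i = power_word b1 p1 i" "W (e1 - 1) \<noteq> power_word b1 p1 (e1 - 1)"
    and p2: "p2 \<le> f2" "f2 < p2 + int (length b2)"
    and p1: "e1 \<le> p1" "p1 < e1 + int (length b1)"
    and ne: "power_word b2 p2 \<noteq> power_word b1 p1"
    and third: "\<And>b s g. b \<in> B \<Longrightarrow> b \<noteq> b1 \<Longrightarrow> b \<noteq> b2 \<Longrightarrow> p2 \<le> g \<Longrightarrow> g + int (length b) \<le> p1 \<Longrightarrow>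
      (\<And>i. g \<le> i \<Longrightarrow> i < g + int (length b) \<Longrightarrow> W i = power_word b s i) \<Longrightarrow> False"
  shows "bridge_word W p2 p1 b2 b1"
proof -
  define Lf R where "Lf = power_word b2 p2" and "R = power_word b1 p1"
  have Lf: "periodic Lf" and R: "periodic R" unfolding Lf_def R_def using B_pw b by blast+
  have le: "p2 \<le> p1"
  proof (rule ccontr)
    assume n: "\<not> p2 \<le> p1"
    have "R = Lf"
    proof (rule agree_turn[OF R Lf])
      show "p1 \<le> p2 - 1" using n by simp
      show eq: "R i = Lf i" if "p1 \<le> i" "i \<le> p2 - 1" for i
        using left(1)[of i] right(1)[of i] that p1 p2 unfolding Lf_def R_def by simp
      show "dir (R p1) \<noteq> dir (R (p2 - 1))"
        using eq[of "p2 - 1"] n cut_dirs(1)[OF b(1), of p1] cut_dirs(2)[OF b(2), of p2]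
        unfolding Lf_def R_def by simp
    qed
    then show False using ne unfolding Lf_def R_def by simp
  qed
  have "free W p2 p1"
    unfolding free_def
  proof (intro ballI allI impI notI)
    fix b s g
    assume b': "b \<in> B" and g: "p2 \<le> g" "g + int (length b) \<le> p1"
      and win: "\<forall>i. g \<le> i \<and> i < g + int (length b) \<longrightarrow> W i = power_word b s i"
    define E where "E = power_word b s"
    have E: "periodic E" "Str E" unfolding E_def using B_pw[OF b'] by simp_all
    obtain t where t: "g < t" "t < g + int (length b)" "dir (E (t - 1)) \<noteq> dir (E t)"
      by (rule window_turn[OF E(2), of "int (length b)" g]) (use power_word_period len_pos b' in \<open>auto simp: E_def\<close>)
    have Et: "E (t - 1) = W (t - 1)" "E t = W t" using win t unfolding E_def by simp_all
    consider "b = b2" | "b = b1" | "b \<noteq> b1" "b \<noteq> b2" by blast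
    then show False
    proof cases
      case 1
      have S: "Str (join t W E)" by (rule glue_turn) (use W E Et t in auto)
      have "join t W E = Lf"
      proof (rule loop[OF Lf S, of "min f2 t" "\<bar>t\<bar> + \<bar>s - p2\<bar>" "s - p2"])
        show "join t W E i = Lf i" if "i < min f2 t" for i using left(1)[of i] that unfolding Lf_def by simp
        show "join t W E (i + (s - p2)) = Lf i" if "\<bar>t\<bar> + \<bar>s - p2\<bar> \<le> i" for i
        proof -
          have "t \<le> i + (s - p2)" using that by linarith
          then show ?thesis unfolding E_def Lf_def 1 by (simp add: power_word_shift)
        qed
      qed
      then have e: "join t W E i = Lf i" for i by simp
      have "E = Lf" by (rule periodic_agree_right[OF E(1) Lf, of t]) (use e in \<open>metis join_right\<close>)
      have "W f2 = Lf f2"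
      proof (cases "f2 < t")
        case True then show ?thesis using e[of f2] by simp
      next
        case False
        then have "W f2 = E f2" using win p2 g t 1 unfolding E_def by simp
        then show ?thesis using \<open>E = Lf\<close> by simp
      qed
      then show False using left(2) unfolding Lf_def by simp
    next
      case 2
      have S: "Str (join t E W)" by (rule glue_turn) (use W E Et t in auto)
      have "join t E W = R"
      proof (rule loop_right[OF R S, of "max e1 t" "- \<bar>t\<bar> - \<bar>s - p1\<bar>" "s - p1"])
        show "join t E W i = R i" if "max e1 t \<le> i" for i using right(1)[of i] that unfolding R_def by simp
        show "join t E W (i + (s - p1)) = R i" if "i < - \<bar>t\<bar> - \<bar>s - p1\<bar>" for i
        proof -
          have "i + (s - p1) < t" using that by linarith
          then show ?thesis unfolding E_def R_def 2 by (simp add: power_word_shift)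
        qed
      qed
      then have e: "join t E W i = R i" for i by simp
      have "E = R" by (rule periodic_agree_left[OF E(1) R, of t]) (use e in \<open>metis join_left\<close>)
      have "W (e1 - 1) = R (e1 - 1)"
      proof (cases "t \<le> e1 - 1")
        case True then show ?thesis using e[of "e1 - 1"] by simp
      next
        case False
        then have "W (e1 - 1) = E (e1 - 1)" using win p1 g t 2 unfolding E_def by simp
        then show ?thesis using \<open>E = R\<close> by simp
      qed
      then show False using right(2) unfolding R_def by simp
    next
      case 3
      show False by (rule third[OF b' 3 g]) (use win in auto)
    qed
  qed
  moreover have "\<not> (b1 = b2 \<and> p1 = p2)" using ne by auto
  ultimately show ?thesis unfolding bridge_word_def using b W le left(1) right(1) p1 p2 by auto
qed

end

section \<open>Factorizations and touches\<close>

context band_words begin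

lemma agree_bound:
  obtains N where "N > 0" "\<And>X Y a b. periodic X \<Longrightarrow> periodic Y \<Longrightarrow> X \<noteq> Y \<Longrightarrow> (\<And>i. a \<le> i \<Longrightarrow> i < b \<Longrightarrow> X i = Y i) \<Longrightarrow> b - a \<le> N"
proof -
  obtain N where N: "N > 0" "\<forall>W i. Str W \<longrightarrow> (\<exists>k. i < k \<and> k < i + N \<and> dir (W k) \<noteq> dir (W i))"
    using mono_bound by (elim exE conjE)
  show thesis
  proof (rule that[OF N(1)])
    fix X Y a b
    assume XY: "periodic X" "periodic Y" "X \<noteq> Y" "\<And>i. a \<le> i \<Longrightarrow> i < b \<Longrightarrow> X i = Y i"
    show "b - a \<le> N"
    proof (rule ccontr)
      assume n: "\<not> b - a \<le> N"
      obtain k where k: "a < k" "k < a + N" "dir (X k) \<noteq> dir (X a)"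
        using N(2)[rule_format, OF periodic_Str[OF XY(1)], of a] by (elim exE conjE)
      have "X = Y" by (rule agree_turn[OF XY(1,2), of a k]) (use k n XY(4) in auto)
      then show False using XY(3) by simp
    qed
  qed
qed

text \<open>A touching word different from both tails follows either of them for at most N letters.
  So the lengths of touches are bounded, and maximality gives the disagreements at both
  ends.\<close>

lemma longest_touch:
  assumes Lf: "periodic Lf" and R: "periodic R"
    and left: "\<And>i. i < f2 \<Longrightarrow> W i = Lf i" and right: "\<And>i. e1 \<le> i \<Longrightarrow> W i = R i"
    and t: "touch W Z a b" "Z \<noteq> Lf" "Z \<noteq> R"
  obtains X e f where "touch W X e f" "X \<noteq> Lf" "X \<noteq> R" "X (e - 1) \<noteq> W (e - 1)" "X f \<noteq> W f"
    "\<forall>Z a b. touch W Z a b \<longrightarrow> Z \<noteq> Lf \<longrightarrow> Z \<noteq> R \<longrightarrow> b - a \<le> f - e"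
proof -
  obtain N where N: "N > 0" "\<And>X Y a b. periodic X \<Longrightarrow> periodic Y \<Longrightarrow> X \<noteq> Y \<Longrightarrow> (\<And>i. a \<le> i \<Longrightarrow> i < b \<Longrightarrow> X i = Y i) \<Longrightarrow> b - a \<le> N"
    by (rule agree_bound) blast
  define M where "M = nat (\<bar>e1\<bar> + \<bar>f2\<bar> + 2 * N)"
  have bd: "b - a \<le> \<bar>e1\<bar> + \<bar>f2\<bar> + 2 * N" if t: "touch W Z a b" "Z \<noteq> Lf" "Z \<noteq> R" for Z a b
  proof -
    note tD = touchD[OF t(1)]
    have 1: "b - max a e1 \<le> N"
      by (rule N(2)[OF tD(1) R t(3)]) (use tD(3) right in auto)
    have 2: "min b f2 - a \<le> N"
      by (rule N(2)[OF tD(1) Lf t(2)]) (use tD(3) left in auto)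
    show ?thesis using 1 2 N(1) by linarith
  qed
  define Pr where "Pr = (\<lambda>(Z, a, b). touch W Z a b \<and> Z \<noteq> Lf \<and> Z \<noteq> R)"
  define m where "m = (\<lambda>(Z :: int \<Rightarrow> 'l, a :: int, b :: int). nat (b - a))"
  have "\<exists>x. Pr x \<and> (\<forall>y. Pr y \<longrightarrow> m y \<le> m x)"
  proof (rule ex_has_greatest_nat[of Pr "(Z, a, b)" m "M + 1"])
    show "Pr (Z, a, b)" using t unfolding Pr_def by simp
    show "\<forall>y. Pr y \<longrightarrow> m y < M + 1"
    proof (intro allI impI)
      fix y assume y: "Pr y"
      obtain Z a b where e: "y = (Z, a, b)" by (cases y)
      have "b - a \<le> \<bar>e1\<bar> + \<bar>f2\<bar> + 2 * N" using y bd[of Z a b] unfolding e Pr_def by simp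
      then show "m y < M + 1" unfolding e m_def M_def by simp
    qed
  qed
  then obtain X e f where x: "Pr (X, e, f)" "\<forall>y. Pr y \<longrightarrow> m y \<le> m (X, e, f)" by (metis prod_cases3)
  have X: "touch W X e f" "X \<noteq> Lf" "X \<noteq> R" using x(1) unfolding Pr_def by simp_all
  note tD = touchD[OF X(1)]
  have max: "b - a \<le> f - e" if "touch W Z a b" "Z \<noteq> Lf" "Z \<noteq> R" for Z a b
  proof -
    have "Pr (Z, a, b)" using that unfolding Pr_def by simp
    then have "m (Z, a, b) \<le> m (X, e, f)" using x(2) by blast
    then show ?thesis using tD(2) unfolding m_def by simp
  qed
  have "X (e - 1) \<noteq> W (e - 1)"
  proof
    assume eq: "X (e - 1) = W (e - 1)"
    have "join (e - 1) X W = join e X W" "join (e - 1) W X = join e W X"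
    proof -
      have "X i = W i" if "e - 1 \<le> i" "i < e" for i
      proof -
        have "i = e - 1" using that by simp
        then show ?thesis using eq by simp
      qed
      then show "join (e - 1) X W = join e X W" "join (e - 1) W X = join e W X" by (intro join_move; simp)+
    qed
    moreover have "X i = W i" if "e - 1 \<le> i" "i < f" for i using tD(3)[of i] that eq by (cases "i = e - 1") auto
    ultimately have "touch W X (e - 1) f" unfolding touch_def
      using tD(1,2) tD(6)[of e] tD(7)[of e] by auto
    then show False using max[of X "e - 1" f] X by simp
  qed
  moreover have "X f \<noteq> W f"
  proof
    assume eq: "X f = W f"
    have "X i = W i" if "e \<le> i" "i < f + 1" for i using tD(3)[of i] that eq by (cases "i = f") auto
    then have "touch W X e (f + 1)" unfolding touch_def
      using tD(1,2) tD(6)[of e] tD(7)[of e] by auto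
    then show False using max[of X e "f + 1"] X by simp
  qed
  ultimately show thesis using that X max by blast
qed

text \<open>This is the bound behind N(b, y) = 1. \<open>loop\<close> and \<open>loop_right\<close>
  show that a double copy of the period would be in phase with X and connected to the stretch [e, f)
  of agreement, but that stretch is shorter than 2n.\<close>

lemma no_double_window:
  assumes Z: "Str Z" and X: "periodic X" "\<And>i. X (i + n) = X i" "n > 0"
    and XZ: "\<And>i. e \<le> i \<Longrightarrow> i < f \<Longrightarrow> Z i = X i" "Z (e - 1) \<noteq> X (e - 1)" "Z f \<noteq> X f"
    and f: "e + n \<le> f" "f < e + 2 * n"
    and E: "\<And>i. E i = X (i + k)" and win: "\<And>i. g \<le> i \<Longrightarrow> i < g + 2 * n \<Longrightarrow> Z i = E i"
  shows False
proof -
  have Ee: "E = (\<lambda>i. X (i + k))" using E by blast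
  have pE: "periodic E" unfolding Ee by (rule periodic_shift[OF X(1)])
  have Eper: "E (i + n) = E i" for i
    using X(2)[of "i + k"] unfolding E by (simp add: algebra_simps)
  obtain t where t: "e < t" "t < e + n" "dir (X (t - 1)) \<noteq> dir (X t)"
    by (rule window_turn[OF periodic_Str[OF X(1)] X(2,3), of e])
  obtain t' where t': "g < t'" "t' < g + n" "dir (E (t' - 1)) \<noteq> dir (E t')"
    by (rule window_turn[OF periodic_Str[OF pE] Eper X(3), of g])
  have Zt: "Z (t - 1) = X (t - 1)" "Z t = X t" using XZ(1)[of t] XZ(1)[of "t - 1"] t f by simp_all
  have Zt': "Z (t' - 1) = E (t' - 1)" "Z t' = E t'" using win[of t'] win[of "t' - 1"] t' by simp_all
  have main: "E = X \<and> (\<forall>i. min t t' \<le> i \<and> i < max t t' \<longrightarrow> Z i = X i)"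
  proof (cases "t \<le> t'")
    case True
    have 1: "Str (join t' Z E)" by (rule glue_turn) (use Z pE Zt' t' in auto)
    have 2: "Str (join t X (join t' Z E))"
      by (rule glue_turn) (use X 1 Zt Zt' t True in \<open>auto simp: join_def\<close>)
    have "join t X (join t' Z E) = X"
    proof (rule loop[OF X(1) 2, of t "\<bar>t'\<bar> + \<bar>k\<bar>" "- k"])
      show "join t X (join t' Z E) (i + - k) = X i" if "\<bar>t'\<bar> + \<bar>k\<bar> \<le> i" for i
      proof -
        have "t' \<le> i + - k" using that by linarith
        then show ?thesis using True E[of "i + - k"] by simp
      qed
    qed simp
    then have e: "join t X (join t' Z E) i = X i" for i by simp
    have "E = X"
    proof (rule periodic_agree_right[OF pE X(1)])
      show "E i = X i" if "t' \<le> i" for i using e[of i] that True by simp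
    qed
    moreover have "Z i = X i" if "t \<le> i" "i < t'" for i using e[of i] that by simp
    ultimately show ?thesis using True by simp
  next
    case False
    have 1: "Str (join t Z X)" by (rule glue_turn) (use Z X Zt t in auto)
    have 2: "Str (join t' E (join t Z X))"
      by (rule glue_turn) (use pE 1 Zt' t' False in \<open>auto simp: join_def\<close>)
    have "join t' E (join t Z X) = X"
    proof (rule loop_right[OF X(1) 2, of t "- \<bar>t'\<bar> - \<bar>k\<bar>" "- k"])
      show "join t' E (join t Z X) (i + - k) = X i" if "i < - \<bar>t'\<bar> - \<bar>k\<bar>" for i
      proof -
        have "i + - k < t'" using that by linarith
        then show ?thesis using E[of "i + - k"] by simp
      qed
    qed (use False in simp)
    then have e: "join t' E (join t Z X) i = X i" for i by simp
    have "E = X"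
    proof (rule periodic_agree_left[OF pE X(1)])
      show "E i = X i" if "i < t'" for i using e[of i] that by simp
    qed
    moreover have "Z i = X i" if "t' \<le> i" "i < t" for i using e[of i] that by simp
    ultimately show ?thesis using False by simp
  qed
  have w1: "\<not> (g \<le> e - 1 \<and> e - 1 < g + 2 * n)" using win[of "e - 1"] XZ(2) main by auto
  have w2: "\<not> (g \<le> f \<and> f < g + 2 * n)" using win[of f] XZ(3) main by auto
  have w3: "\<not> (min t t' \<le> e - 1 \<and> e - 1 < max t t')" using main XZ(2) by auto
  have w4: "\<not> (min t t' \<le> f \<and> f < max t t')" using main XZ(3) by auto
  show False using w1 w2 w3 w4 t(1,2) t'(1,2) f X(3) by linarith
qed

text \<open>The second alternative is the composition with removal of one copy of the band; the word \<open>Z\<close>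
  and the absence of a double copy are what the product and \<open>N(b, y) = 1\<close> require.\<close>

definition factors :: "(int \<Rightarrow> 'l) \<Rightarrow> int \<Rightarrow> int \<Rightarrow> 'l list \<Rightarrow> 'l list \<Rightarrow> bool" where
  "factors W p2 p1 b2 b1 \<longleftrightarrow> (\<exists>b\<in>B. \<exists>W' W'' c c'. bridge_word W' c p1 b b1 \<and> bridge_word W'' p2 c' b2 b \<and>
     (seg W p2 p1 = seg W'' p2 c' @ seg W' c p1 \<or>
      (\<exists>x y r s. seg W p2 p1 = y @ x \<and>
         seg W'' p2 c' @ seg W' c p1 = y @ seg (power_word b s) r (r + int (length b)) @ x \<and>
         (\<exists>Z. Str Z \<and> seg Z p2 (p1 + int (length b)) = seg W'' p2 c' @ seg W' c p1 \<and>
            Z (p1 + int (length b)) = hd b1) \<and>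
         (\<forall>s' g. \<not> sublist (seg (power_word b s') g (g + 2 * int (length b))) (seg W'' p2 c' @ seg W' c p1)))))"

lemma sublist_seg:
  assumes "sublist (seg E g h) (seg Z i j)" "g \<le> h" "i \<le> j"
  obtains a where "i \<le> a" "a + (h - g) \<le> j" "\<And>x. a \<le> x \<Longrightarrow> x < a + (h - g) \<Longrightarrow> Z x = E (x - a + g)"
proof -
  obtain ps ss where e: "seg Z i j = ps @ seg E g h @ ss" using assms(1) unfolding sublist_def by blast
  have l: "nat (j - i) = length ps + nat (h - g) + length ss"
    using arg_cong[OF e, of length] by simp
  show thesis
  proof (rule that[of "i + int (length ps)"])
    show "i + int (length ps) + (h - g) \<le> j" using l assms(2,3) by linarith
    fix x assume x: "i + int (length ps) \<le> x" "x < i + int (length ps) + (h - g)"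
    define k where "k = nat (x - (i + int (length ps)))"
    have k: "k < nat (h - g)" "x = i + int (length ps + k)" unfolding k_def using x by auto
    have "Z x = seg Z i j ! (length ps + k)" using k l by simp
    also have "\<dots> = seg E g h ! k" unfolding e using k by (simp add: nth_append)
    also have "\<dots> = E (x - (i + int (length ps)) + g)" using k by (simp add: algebra_simps)
    finally show "Z x = E (x - (i + int (length ps)) + g)" .
  qed simp
qed

text \<open>A longest touch becomes a factorization once cuts of X are chosen: c, the last cut up to
  f, for the source factor, and c', the first cut from e on, for the target factor. If [e, f]
  contains a cut, c = c' and the composition is a product. Otherwise c' = c + n, and the product of
  the factors has one surplus copy of b.\<close>

lemma touch_factors:
  assumes w: "bridge_word W p2 p1 b2 b1" and t0: "touch W Z a0 b0" "Z \<noteq> power_word b2 p2" "Z \<noteq> power_word b1 p1"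
  shows "factors W p2 p1 b2 b1"
proof -
  note wD = wbrepD[OF w]
  define Lf R where "Lf = power_word b2 p2" and "R = power_word b1 p1"
  have Lf: "periodic Lf" and R: "periodic R" unfolding Lf_def R_def using B_pw wD by blast+
  have W: "Str W" by (rule wD(3))
  obtain e1 where e1_: "e1 \<le> p1" "\<forall>i\<ge>e1. W i = R i" "W (e1 - 1) \<noteq> R (e1 - 1)"
    unfolding R_def by (rule exact_right[OF bridge_word_neq_right[OF w] wD(6)])
  note e1 = e1_(1) e1_(2)[rule_format] e1_(3)
  obtain f2 where f2_: "p2 \<le> f2" "\<forall>i<f2. W i = Lf i" "W f2 \<noteq> Lf f2"
    unfolding Lf_def by (rule exact_left[OF bridge_word_neq_left[OF w] wD(5)])
  note f2 = f2_(1) f2_(2)[rule_format] f2_(3)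
  obtain X e f where t: "touch W X e f" "X \<noteq> Lf" "X \<noteq> R" "X (e - 1) \<noteq> W (e - 1)" "X f \<noteq> W f"
    and max': "\<forall>Z a b. touch W Z a b \<longrightarrow> Z \<noteq> Lf \<longrightarrow> Z \<noteq> R \<longrightarrow> b - a \<le> f - e"
    by (rule longest_touch[OF Lf R f2(2) e1(2) t0(1) t0(2,3)[folded Lf_def R_def]])
  note max = max'[rule_format]
  note tD = touchD[OF t(1)]
  have ef: "e \<le> f" by (rule tD(2))
  obtain b s where b: "b \<in> B" and Xb: "X = power_word b s" using B_rep tD(1) by blast
  define n where "n = int (length b)"
  have n: "n > 0" unfolding n_def using len_pos[OF b] .
  define W' where "W' = join e X W"
  define W'' where "W'' = join e W X"
  have W': "Str W'" "Str W''" unfolding W'_def W''_def using tD(6)[of e] tD(7)[of e] ef by simp_all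
  have W'X: "W' i = X i" if "i < f" for i using tD(3)[of i] that unfolding W'_def by (cases "i < e") auto
  have W'W: "W' i = W i" if "e \<le> i" for i using that unfolding W'_def by simp
  have W''X: "W'' i = X i" if "e \<le> i" for i using that unfolding W''_def by simp
  have W''W: "W'' i = W i" if "i < f" for i using tD(3)[of i] that unfolding W''_def by (cases "i < e") auto
  have turn1: "dir (R (p1 - 1)) \<noteq> dir (R p1)" unfolding R_def by (rule cut_dirs(3)[OF wD(1)])
  have turn2: "dir (Lf (p2 - 1)) \<noteq> dir (Lf p2)" unfolding Lf_def by (rule cut_dirs(3)[OF wD(2)])
  \<comment> \<open>The cuts one period further in. The tails of W contain p1 and p2 but not these,
    and the same holds for the factors; this shows that p1 and p2 are still the right cuts
    there.\<close>
  have cut1: "power_word b1 (p1 - int (length b1)) = power_word b1 p1" by (rule power_word_cong) simp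
  have turn1': "dir (R (p1 - int (length b1) - 1)) \<noteq> dir (R (p1 - int (length b1)))"
    unfolding R_def cut1[symmetric] by (rule cut_dirs(3)[OF wD(1)])
  have cut2: "power_word b2 (p2 + int (length b2)) = power_word b2 p2" by (rule power_word_cong) simp
  have turn2': "dir (Lf (p2 + int (length b2) - 1)) \<noteq> dir (Lf (p2 + int (length b2)))"
    unfolding Lf_def cut2[symmetric] by (rule cut_dirs(3)[OF wD(2)])
  have ep1: "e \<le> p1" by (rule touch_turns_right(1)[OF W R t(1,4,5,3) e1(2,3) turn1 e1(1)])
  have p2f: "p2 \<le> f" by (rule touch_turns_left(1)[OF W Lf t(1,4,5,2) f2(2,3) turn2 f2(1)])
  define c where "c = f - (f - s) mod n"
  have c: "c \<le> f" "f < c + n" unfolding c_def using n pos_mod_bound[of n "f - s"] pos_mod_sign[of n "f - s"] by linarith+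
  have "n dvd c - s" unfolding c_def by (simp add: mod_eq_dvd_iff[symmetric] mod_simps)
  then have Xc: "power_word b c = X" unfolding Xb n_def by (rule power_word_cong)
  define c' where "c' = e + (s - e) mod n"
  have c': "e \<le> c'" "c' < e + n" unfolding c'_def using n pos_mod_bound[of n "s - e"] pos_mod_sign[of n "s - e"] by linarith+
  have "n dvd c' - s" unfolding c'_def by (simp add: mod_eq_dvd_iff[symmetric] mod_simps)
  then have Xc': "power_word b c' = X" unfolding Xb n_def by (rule power_word_cong)
  have w': "bridge_word W' c p1 b b1"
  proof -
    have "W' \<noteq> R"
    proof
      assume "W' = R"
      then have "X = R" by (intro periodic_agree_left[OF tD(1) R, of f]) (use W'X in auto)
      then show False using t(3) by simp
    qed
    then obtain e1' where e1'_: "e1' \<le> max e e1" "\<forall>i\<ge>e1'. W' i = R i" "W' (e1' - 1) \<noteq> R (e1' - 1)"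
      by (rule exact_right[of W' R "max e e1"]) (use W'W e1(2) in auto)
    note e1' = e1'_(1) e1'_(2)[rule_format] e1'_(3)
    have tt: "e1 \<le> u \<longleftrightarrow> e1' \<le> u" if "dir (R (u - 1)) \<noteq> dir (R u)" for u
      by (rule touch_turns_right(3)[OF W R t(1,4,5,3) e1(2,3) that e1'(2,3)[unfolded W'_def]])
    have "\<not> e1 \<le> p1 - int (length b1)" using cut_right_bound[OF w, of e1] e1(2) unfolding R_def by simp
    then have p1: "e1' \<le> p1" "p1 < e1' + int (length b1)"
      using tt[OF turn1] tt[OF turn1'] e1(1) by auto
    show ?thesis
    proof (rule build_wbrep[OF wD(1) b W'(1) _ _ e1'(2,3)[unfolded R_def] c(1) _ p1])
      show "W' i = power_word b c i" if "i < f" for i using W'X[OF that] Xc by simp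
      show "W' f \<noteq> power_word b c f" using W'W[OF ef] Xc t(5) by simp
      show "f < c + int (length b)" using c unfolding n_def by simp
      show "power_word b c \<noteq> power_word b1 p1" using Xc t(3) unfolding R_def by simp
      fix b' s' g
      assume b': "b' \<in> B" "b' \<noteq> b1" "b' \<noteq> b" "c \<le> g" "g + int (length b') \<le> p1"
        and win: "\<And>i. g \<le> i \<Longrightarrow> i < g + int (length b') \<Longrightarrow> W' i = power_word b' s' i"
      show False
      proof (rule touch_window[OF W Lf R t(1,4,5,2) f2(2,3) _ f2(1) turn2])
        show "b - a \<le> f - e" if "touch W Z a b" "Z \<noteq> Lf" "Z \<noteq> R" for Z a b by (rule max[OF that])
        show "periodic (power_word b' s')" using B_pw b' by blast
        show "power_word b' s' \<noteq> X" using B_uniq[OF b'(1) b] b'(3) unfolding Xb by blast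
        show "power_word b' s' \<noteq> R" using B_uniq[OF b'(1) wD(1)] b'(2) unfolding R_def by blast
        show "g < g + int (length b')" using len_pos b' by simp
        show "power_word b' s' (i + (g + int (length b') - g)) = power_word b' s' i" for i
          using power_word_period by simp
        show "join e X W i = power_word b' s' i" if "g \<le> i" "i < g + int (length b')" for i
          using win that unfolding W'_def by blast
        show "\<not> (p2 \<le> g \<and> (\<forall>i. g \<le> i \<and> i < g + int (length b') \<longrightarrow> W i = power_word b' s' i))"
          using freeD[OF wD(7) b'(1) _ b'(5)] by blast
      qed
    qed
  qed
  have w'': "bridge_word W'' p2 c' b2 b"
  proof -
    have "W'' \<noteq> Lf"
    proof
      assume "W'' = Lf"
      then have "X = Lf" by (intro periodic_agree_right[OF tD(1) Lf, of e]) (use W''X in auto)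
      then show False using t(2) by simp
    qed
    then obtain f2' where f2'_: "min f f2 \<le> f2'" "\<forall>i<f2'. W'' i = Lf i" "W'' f2' \<noteq> Lf f2'"
      by (rule exact_left[of W'' Lf "min f f2"]) (use W''W f2(2) in auto)
    note f2' = f2'_(1) f2'_(2)[rule_format] f2'_(3)
    have tt: "u \<le> f2 \<longleftrightarrow> u \<le> f2'" if "dir (Lf (u - 1)) \<noteq> dir (Lf u)" for u
      by (rule touch_turns_left(3)[OF W Lf t(1,4,5,2) f2(2,3) that f2'(2,3)[unfolded W''_def]])
    have "\<not> p2 + int (length b2) \<le> f2" using cut_left_bound[OF w, of f2] f2(2) unfolding Lf_def by simp
    then have p2: "p2 \<le> f2'" "f2' < p2 + int (length b2)"
      using tt[OF turn2] tt[OF turn2'] f2(1) by auto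
    show ?thesis
    proof (rule build_wbrep[OF b wD(2) W'(2) f2'(2,3)[unfolded Lf_def] _ _ p2 c'(1)])
      show "W'' i = power_word b c' i" if "e \<le> i" for i using W''X[OF that] Xc' by simp
      show "W'' (e - 1) \<noteq> power_word b c' (e - 1)" using Xc' t(4) unfolding W''_def by simp
      show "c' < e + int (length b)" using c' unfolding n_def by simp
      show "power_word b2 p2 \<noteq> power_word b c'" using Xc' t(2) unfolding Lf_def by simp
      fix b' s' g
      assume b': "b' \<in> B" "b' \<noteq> b" "b' \<noteq> b2" "p2 \<le> g" "g + int (length b') \<le> c'"
        and win: "\<And>i. g \<le> i \<Longrightarrow> i < g + int (length b') \<Longrightarrow> W'' i = power_word b' s' i"
      show False
      proof (rule touch_window_left[OF W Lf R t(1,4,5,3) e1(2,3) _ e1(1) turn1])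
        show "b - a \<le> f - e" if "touch W Z a b" "Z \<noteq> Lf" "Z \<noteq> R" for Z a b by (rule max[OF that])
        show "periodic (power_word b' s')" using B_pw b' by blast
        show "power_word b' s' \<noteq> X" using B_uniq[OF b'(1) b] b'(2) unfolding Xb by blast
        show "power_word b' s' \<noteq> Lf" using B_uniq[OF b'(1) wD(2)] b'(3) unfolding Lf_def by blast
        show "g < g + int (length b')" using len_pos b' by simp
        show "power_word b' s' (i + (g + int (length b') - g)) = power_word b' s' i" for i
          using power_word_period by simp
        show "join e W X i = power_word b' s' i" if "g \<le> i" "i < g + int (length b')" for i
          using win that unfolding W''_def by blast
        show "\<not> (g + int (length b') \<le> p1 \<and> (\<forall>i. g \<le> i \<and> i < g + int (length b') \<longrightarrow> W i = power_word b' s' i))"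
          using freeD[OF wD(7) b'(1,4)] by blast
      qed
    qed
  qed
  have le: "c \<le> p1" "p2 \<le> c'" using wbrepD(4)[OF w'] wbrepD(4)[OF w''] by simp_all
  have cc: "n dvd c - c'" using B_prim[OF b, of c c'] Xc Xc' unfolding n_def by simp
  show ?thesis
  proof (cases "e \<le> c")
    case True
    \<comment> \<open>Two different cuts of X in [e, f] would enclose a copy of b between p2 and p1,
      against band-freeness of W.\<close>
    have "c = c'"
    proof (rule ccontr)
      assume ne: "c \<noteq> c'"
      have "c' \<le> c" using cc ne True c'(2) zdvd_imp_le[of n "c' - c"] dvd_diff_commute[of n c c'] by force
      then have "n \<le> c - c'" using cc ne zdvd_imp_le[of n "c - c'"] by simp
      then show False
        using c c' le tD(3) unfolding Xb n_def by (intro freeD[OF wD(7) b, of c' s]) auto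
    qed
    have "seg W p2 p1 = seg W p2 c @ seg W c p1" using le \<open>c = c'\<close> by (simp add: seg_append)
    also have "seg W p2 c = seg W'' p2 c" by (rule seg_cong) (use W''W c in simp)
    also have "seg W c p1 = seg W' c p1" by (rule seg_cong) (use W'W True in simp)
    finally show ?thesis unfolding factors_def using b w' w'' \<open>c = c'\<close> by blast
  next
    case False
    have "n dvd (c - c') + n" using cc by (rule dvd_add) simp
    then have "int (length b) dvd c + n - c'" unfolding n_def by (simp add: algebra_simps)
    then have "c + n = c'" by (rule close_cuts[of b _ _ e]) (use c c' False ef in \<open>auto simp: n_def\<close>)
    \<comment> \<open>The surplus copy is inserted at r, which lies in [e, f], where both factors
      follow X, and between p2 and p1.\<close>
    define r where "r = max e p2"
    have r: "e \<le> r" "p2 \<le> r" "r \<le> f" "r \<le> p1" unfolding r_def using ef p2f ep1 wD(4) by auto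
    have Xn: "X (i + n) = X i" for i unfolding Xb n_def by (rule power_word_period)
    have y: "seg W'' p2 c' @ seg W' c p1 = seg W p2 r @ seg X r (r + n) @ seg W r p1"
    proof -
      have "seg W'' p2 c' = seg W'' p2 r @ seg W'' r c'" using r c c' \<open>c + n = c'\<close> by (simp add: seg_append)
      moreover have "seg W'' p2 r = seg W p2 r" by (rule seg_cong) (use W''W r in simp)
      moreover have "seg W'' r c' = seg X r c'" by (rule seg_cong) (use W''X r in simp)
      moreover have "seg W' c p1 = seg W' c r @ seg W' r p1" using r False by (simp add: seg_append)
      moreover have "seg W' r p1 = seg W r p1" by (rule seg_cong) (use W'W r in simp)
      moreover have "seg W' c r = seg X c r" by (rule seg_cong) (use W'X r in simp)
      moreover have "seg X c r = seg X c' (r + n)"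
        using seg_shift[of X n c r] Xn \<open>c + n = c'\<close> by simp
      moreover have "seg X r c' @ seg X c' (r + n) = seg X r (r + n)"
        using r c False \<open>c + n = c'\<close> by (intro seg_append) auto
      ultimately show ?thesis by simp
    qed
    \<comment> \<open>W with one period of X inserted at r. It is a string because it equals W'' up
      to a turn of X and W' shifted by n from there on.\<close>
    define Zw where "Zw = (\<lambda>i. if i < r then W i else if i < r + n then X i else W (i - n))"
    obtain t where t': "r < t" "t < r + n" "dir (X (t - 1)) \<noteq> dir (X t)"
      by (rule window_turn[OF periodic_Str[OF tD(1)] Xn n, of r])
    have Xn': "X (i - n) = X i" for i using Xn[of "i - n"] by simp
    have ZwS: "Str Zw"
    proof -
      have "Str (\<lambda>i. W' (i + (- n)))" by (rule Str_shift[OF W'(1)])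
      then have "Str (join t W'' (\<lambda>i. W' (i + (- n))))"
        by (intro glue_turn[OF W'(2)]) (use t' r W''X[of "t - 1"] W'X[of "t - 1 - n"] W'X[of "t - n"] Xn' in auto)
      moreover have "join t W'' (\<lambda>i. W' (i + (- n))) = Zw"
      proof
        fix i
        consider "i < r" | "r \<le> i" "i < t" | "t \<le> i" "i < r + n" | "r + n \<le> i" by linarith
        then show "join t W'' (\<lambda>i. W' (i + (- n))) i = Zw i"
        proof cases
          case 1 then show ?thesis using t' r W''W[of i] unfolding Zw_def by simp
        next
          case 2 then show ?thesis using t' r W''X[of i] unfolding Zw_def by simp
        next
          case 3 then show ?thesis using t' r W'X[of "i - n"] Xn'[of i] unfolding Zw_def by simp
        next
          case 4 then show ?thesis using t' r n W'W[of "i - n"] unfolding Zw_def by simp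
        qed
      qed
      ultimately show ?thesis by simp
    qed
    have Zseg: "seg Zw p2 (p1 + n) = seg W p2 r @ seg X r (r + n) @ seg W r p1"
    proof -
      have "seg Zw p2 (p1 + n) = seg Zw p2 r @ seg Zw r (r + n) @ seg Zw (r + n) (p1 + n)"
        using r n by (simp add: seg_append)
      moreover have "seg Zw p2 r = seg W p2 r" by (rule seg_cong) (simp add: Zw_def)
      moreover have "seg Zw r (r + n) = seg X r (r + n)" by (rule seg_cong) (simp add: Zw_def)
      moreover have "seg Zw (r + n) (p1 + n) = seg W r p1"
      proof -
        have "seg (\<lambda>i. Zw (i + n)) r p1 = seg W r p1" by (rule seg_cong) (use n in \<open>simp add: Zw_def\<close>)
        then show ?thesis by (simp add: seg_shift)
      qed
      ultimately show ?thesis by simp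
    qed
    have ZX: "Zw i = X i" if "e \<le> i" "i < f + n" for i
    proof -
      consider "i < r" | "r \<le> i" "i < r + n" | "r + n \<le> i" by linarith
      then show ?thesis
      proof cases
        case 1 then show ?thesis using tD(3)[of i] r that unfolding Zw_def by simp
      next
        case 2 then show ?thesis unfolding Zw_def by simp
      next
        case 3 then show ?thesis using tD(3)[of "i - n"] r n that Xn'[of i] unfolding Zw_def by simp
      qed
    qed
    have "\<not> sublist (seg (power_word b s') g (g + 2 * int (length b))) (seg W'' p2 c' @ seg W' c p1)" for s' g
    proof
      assume "sublist (seg (power_word b s') g (g + 2 * int (length b))) (seg W'' p2 c' @ seg W' c p1)"
      then have sub: "sublist (seg (power_word b s') g (g + 2 * n)) (seg Zw p2 (p1 + n))"
        using y Zseg unfolding n_def by simp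
      obtain a where a: "p2 \<le> a" "a + (g + 2 * n - g) \<le> p1 + n"
        "\<And>x. a \<le> x \<Longrightarrow> x < a + (g + 2 * n - g) \<Longrightarrow> Zw x = power_word b s' (x - a + g)"
        by (rule sublist_seg[OF sub]) (use n wD(4) in auto)
      show False
      proof (rule no_double_window[OF ZwS tD(1) Xn n ZX, where E = "\<lambda>x. power_word b s' (x - a + g)" and g = a and k = "g - a - s' + s"])
        show "Zw (e - 1) \<noteq> X (e - 1)" using r t(4) unfolding Zw_def by simp
        show "Zw (f + n) \<noteq> X (f + n)" using r t(5) n Xn[of f] unfolding Zw_def by simp
        show "e + n \<le> f + n" "f + n < e + 2 * n" using ef False c by simp_all
        show "power_word b s' (i - a + g) = X (i + (g - a - s' + s))" for i
          unfolding Xb power_word_def by (simp add: algebra_simps)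
        show "Zw i = power_word b s' (i - a + g)" if "a \<le> i" "i < a + 2 * n" for i using a(3)[of i] that by simp
      qed
    qed
    moreover have "seg W p2 p1 = seg W p2 r @ seg W r p1" using r by (simp add: seg_append)
    moreover have "\<exists>Z. Str Z \<and> seg Z p2 (p1 + int (length b)) = seg W'' p2 c' @ seg W' c p1 \<and>
        Z (p1 + int (length b)) = hd b1"
    proof (intro exI[of _ Zw] conjI)
      show "seg Zw p2 (p1 + int (length b)) = seg W'' p2 c' @ seg W' c p1"
        using Zseg y unfolding n_def by simp
      show "Zw (p1 + int (length b)) = hd b1"
        using r n wD(6)[of p1] power_word_hd[OF B_ne[OF wD(1)]] unfolding Zw_def n_def by simp
    qed (rule ZwS)
    ultimately show ?thesis unfolding factors_def using b w' w'' y[unfolded n_def Xb] by blast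
  qed
qed

end

context band_words begin

section \<open>From compositions back to touches\<close>

definition bridge_word_of :: "(int \<Rightarrow> 'l) \<Rightarrow> int \<Rightarrow> int \<Rightarrow> 'l list \<Rightarrow> 'l list \<Rightarrow> 'l list \<Rightarrow> bool" where
  "bridge_word_of W p2 p1 b2 u b1 \<longleftrightarrow> bridge_word W p2 p1 b2 b1 \<and> u = seg W p2 p1"

lemma bridge_word_shift:
  assumes w: "bridge_word W p2 p1 b2 b1"
  shows "bridge_word (\<lambda>i. W (i + k)) (p2 - k) (p1 - k) b2 b1"
proof -
  note wD = wbrepD[OF w]
  have "free (\<lambda>i. W (i + k)) (p2 - k) (p1 - k)"
    unfolding free_def
  proof (intro ballI allI impI notI)
    fix b s g
    assume b: "b \<in> B" "p2 - k \<le> g" "g + int (length b) \<le> p1 - k"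
      "\<forall>i. g \<le> i \<and> i < g + int (length b) \<longrightarrow> W (i + k) = power_word b s i"
    show False
    proof (rule freeD[OF wD(7) b(1), of "g + k" "s + k"])
      show "W i = power_word b (s + k) i" if "g + k \<le> i" "i < g + k + int (length b)" for i
        using b(4)[rule_format, of "i - k"] that power_word_shift[of b "s + k" "i - k" k] by simp
    qed (use b in auto)
  qed
  moreover have "W (i + k) = power_word b2 (p2 - k) i" if "i < p2 - k" for i
    using wD(5)[of "i + k"] that by (simp add: power_word_shift)
  moreover have "W (i + k) = power_word b1 (p1 - k) i" if "p1 - k \<le> i" for i
    using wD(6)[of "i + k"] that by (simp add: power_word_shift)
  ultimately show ?thesis unfolding bridge_word_def using wD Str_shift[OF wD(3)] by auto
qed

lemma bridge_word_of_shift: "bridge_word_of W p2 p1 b2 u b1 \<Longrightarrow> bridge_word_of (\<lambda>i. W (i + k)) (p2 - k) (p1 - k) b2 u b1"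
  unfolding bridge_word_of_def using bridge_word_shift[of W p2 p1 b2 b1 k] seg_shift[of W k "p2 - k" "p1 - k"] by simp

lemma bridge_word_of_at:
  assumes "bridge_word_of W p2 p1 b2 u b1"
  shows "\<exists>W'. bridge_word_of W' q (q + int (length u)) b2 u b1"
proof -
  have "p1 = p2 + int (length u)" using assms wbrepD(4) unfolding bridge_word_of_def by fastforce
  then show ?thesis using bridge_word_of_shift[OF assms, of "p2 - q"] by (intro exI) (simp add: algebra_simps)
qed

text \<open>The converse of \<open>touch_factors\<close>. V is placed to share the right end q1 with
  W, and U to share the left end q2; their cuts c and c' then coincide for a product and are one
  period apart for a removal. Whatever decomposition a removal uses, the deleted copy straddles the
  junction of u' and v and is in phase with X, so the touch does not depend on it.\<close>

lemma comp_touch: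
  assumes v: "bridge_word_of V0 v2 v1 b v b1" and u': "bridge_word_of U0 u2 u1 b2 u' b"
    and w: "bridge_word_of W q2 q1 b2 u b1"
    and comp: "u = u' @ v \<or> (\<exists>x y s. u' @ v = y @ seg (power_word b s) 0 (int (length b)) @ x \<and> u = y @ x)"
  obtains r c c' where "bridge_word_of (join r (power_word b c) W) c q1 b v b1" "bridge_word_of (join r W (power_word b c)) q2 c' b2 u' b"
    "power_word b c' = power_word b c"
proof -
  note result = that
  define c where "c = q1 - int (length v)"
  obtain V where V: "bridge_word_of V c q1 b v b1" using bridge_word_of_at[OF v, of c] unfolding c_def by auto
  note VD = wbrepD[OF V[unfolded bridge_word_of_def, THEN conjunct1]]
  have Vv: "v = seg V c q1" using V unfolding bridge_word_of_def by blast
  define n where "n = int (length b)"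
  define c' where "c' = q2 + int (length u')"
  obtain U where U: "bridge_word_of U q2 c' b2 u' b" using bridge_word_of_at[OF u', of q2] unfolding c'_def by auto
  note UD = wbrepD[OF U[unfolded bridge_word_of_def, THEN conjunct1]]
  have Uu: "u' = seg U q2 c'" using U unfolding bridge_word_of_def by blast
  note WD = wbrepD[OF w[unfolded bridge_word_of_def, THEN conjunct1]]
  have Wu: "u = seg W q2 q1" using w unfolding bridge_word_of_def by blast
  have lu: "int (length u) = q1 - q2" using Wu WD(4) by simp
  define X where "X = power_word b c"
  have b: "b \<in> B" by (rule VD(2))
  have X: "periodic X" unfolding X_def by (rule B_pw[OF b])
  have n: "n > 0" unfolding n_def by (rule len_pos[OF b])
  have VX: "V i = X i" if "i < c" for i using VD(5) that unfolding X_def by simp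
  have finish: thesis
    if W1: "\<And>i. i < r \<Longrightarrow> W i = U i" and W2: "\<And>i. r \<le> i \<Longrightarrow> W i = V i"
      and VXr: "\<And>i. i < r \<Longrightarrow> V i = X i" and UXr: "\<And>i. r \<le> i \<Longrightarrow> U i = X i"
      and cX: "power_word b c' = X" for r
  proof -
    have e: "join r X W = V" "join r W X = U" using W1 W2 VXr UXr by (auto simp: join_def)
    show thesis by (rule result[of r c c']) (use e V U cX in \<open>simp_all add: X_def\<close>)
  qed
  show thesis
  proof (cases "u = u' @ v")
    case True
    have cc: "c' = c" using lu True unfolding c_def c'_def by simp
    have s: "seg W q2 q1 = seg U q2 c @ seg V c q1" using True Wu Uu Vv cc by simp
    have le: "q2 \<le> c" "c \<le> q1" using UD(4) VD(4) cc by simp_all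
    have "seg W q2 q1 = seg W q2 c @ seg W c q1" using le by (simp add: seg_append)
    then have s1: "seg W q2 c = seg U q2 c" and s2: "seg W c q1 = seg V c q1"
      using s by (simp_all add: append_eq_append_conv)
    show thesis
    proof (rule finish[of c])
      show "W i = U i" if "i < c" for i
      proof (cases "i < q2")
        case True then show ?thesis using WD(5) UD(5) by simp
      next
        case False then show ?thesis using seg_eqD[of W q2 c U q2 i] s1 that by simp
      qed
      show "W i = V i" if "c \<le> i" for i
      proof (cases "i < q1")
        case True then show ?thesis using seg_eqD[of W c q1 V c i] s2 that by simp
      next
        case False then show ?thesis using WD(6) VD(6) by simp
      qed
      show "V i = X i" if "i < c" for i by (rule VX[OF that])
      show "U i = X i" if "c \<le> i" for i using UD(6) that cc unfolding X_def by simp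
      show "power_word b c' = X" unfolding X_def cc ..
    qed
  next
    case False
    then obtain x y s where xy: "u' @ v = y @ seg (power_word b s) 0 n @ x" "u = y @ x"
      using comp unfolding n_def by blast
    define r where "r = q2 + int (length y)"
    have lens: "int (length u') + int (length v) = int (length y) + n + int (length x)"
      using arg_cong[OF xy(1), of length] n by simp
    have rx: "int (length x) = q1 - r" using lu xy(2) unfolding r_def by simp
    have cc: "c' = c + n" using lens lu xy(2) unfolding c_def c'_def by simp
    have cX: "power_word b c' = X" unfolding X_def cc n_def by (rule power_word_cong) simp
    define Z where "Z = power_word b (s + r)"
    note Zr = Z_def
    have Zs: "seg (power_word b s) 0 n = seg Z r (r + n)"
      using seg_shift[of "power_word b (s + r)" r 0 n] unfolding Zr by (simp add: power_word_shift add.commute)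
    \<comment> \<open>Coordinates of the full product: u' keeps its place, and v moves right by the
      length n of the copy to be deleted.\<close>
    define J where "J = (\<lambda>i. if i < c' then U i else V (i - n))"
    have J: "seg J q2 (q1 + n) = y @ seg Z r (r + n) @ x"
    proof -
      have "seg J q2 (q1 + n) = seg J q2 c' @ seg J c' (q1 + n)"
        using UD(4) VD(4) cc by (simp add: seg_append)
      moreover have "seg J q2 c' = seg U q2 c'" by (rule seg_cong) (simp add: J_def)
      moreover have "seg J c' (q1 + n) = seg V c q1"
      proof -
        have "seg (\<lambda>i. J (i + n)) c q1 = seg V c q1" by (rule seg_cong) (use cc in \<open>simp add: J_def\<close>)
        then show ?thesis by (simp add: seg_shift cc)
      qed
      ultimately show ?thesis using xy(1) Uu Vv Zs by simp
    qed
    have rq: "q2 \<le> r" "r \<le> q1" using rx unfolding r_def by simp_all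
    have "seg J q2 (q1 + n) = seg J q2 r @ seg J r (r + n) @ seg J (r + n) (q1 + n)"
      using rq n by (simp add: seg_append)
    then have Jp: "seg J q2 r = y" "seg J r (r + n) = seg Z r (r + n)" "seg J (r + n) (q1 + n) = x"
      using J rq n r_def rx by (auto simp: append_eq_append_conv)
    have JZ: "J i = Z i" if "r \<le> i" "i < r + n" for i
      using seg_eqD[of J r "r + n" Z r i] Jp(2) that by simp
    have Zn: "Z (i + n) = Z i" for i unfolding Zr n_def by (rule power_word_period)
    \<comment> \<open>A copy lying in u' alone or, for \<open>rc'\<close>, in v alone would
      contradict band-freeness of that factor.\<close>
    have rc: "c < r"
    proof (rule ccontr)
      assume a: "\<not> c < r"
      have "U i = power_word b (s + r) i" if "r \<le> i" "i < r + int (length b)" for i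
        using JZ[of i] that a cc unfolding J_def Zr n_def by simp
      then show False using a rq cc unfolding n_def by (intro freeD[OF UD(7) b, of r "s + r"]) auto
    qed
    have rc': "r < c'"
    proof (rule ccontr)
      assume a: "\<not> r < c'"
      have "V i = power_word b (s + r) i" if "r - n \<le> i" "i < r - n + int (length b)" for i
        using JZ[of "i + n"] that a Zn[of i] unfolding J_def Zr n_def by simp
      then show False using a rq cc unfolding n_def by (intro freeD[OF VD(7) b, of "r - int (length b)" "s + r"]) auto
    qed
    have UZ: "U i = Z i" if "r \<le> i" "i < c'" for i using JZ[of i] that cc rc unfolding J_def by simp
    have VZ: "V i = Z i" if "c \<le> i" "i < r" for i
      using JZ[of "i + n"] that cc rc' Zn[of i] unfolding J_def by simp
    have UX: "U i = X i" if "c' \<le> i" for i using UD(6) that cX by simp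
    have Z: "periodic Z" unfolding Zr by (rule B_pw[OF b])
    have ZX: "Z (i + (s + r - c)) = X i" for i unfolding Zr X_def by (simp add: power_word_shift)
    obtain t where t: "c < t" "t < c + n" "dir (Z (t - 1)) \<noteq> dir (Z t)"
      by (rule window_turn[OF periodic_Str[OF Z] Zn n, of c])
    \<comment> \<open>A turn of the deleted copy lies in the stretch shared with V or in the one
      shared with U. Gluing there joins Z to the tail X of that factor, and \<open>loop\<close> or
      \<open>loop_right\<close> gives equality of phase.\<close>
    have "Z = X"
    proof (cases "t \<le> r")
      case True
      have S: "Str (join t V Z)" by (rule glue_turn) (use VD(3) Z t VZ[of "t - 1"] True in auto)
      have "join t V Z = X"
      proof (rule loop[OF X S, of c "\<bar>t\<bar> + \<bar>s + r - c\<bar>" "s + r - c"])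
        show "join t V Z i = X i" if "i < c" for i using VX[OF that] that t by simp
        show "join t V Z (i + (s + r - c)) = X i" if "\<bar>t\<bar> + \<bar>s + r - c\<bar> \<le> i" for i
        proof -
          have "t \<le> i + (s + r - c)" using that by linarith
          then show ?thesis using ZX by simp
        qed
      qed
      then have e: "join t V Z i = X i" for i by simp
      show ?thesis
      proof (rule periodic_agree_right[OF Z X])
        show "Z i = X i" if "t \<le> i" for i using e[of i] that by simp
      qed
    next
      case False
      have S: "Str (join t Z U)" by (rule glue_turn') (use UD(3) Z t UZ[of t] False cc in auto)
      have "join t Z U = X"
      proof (rule loop_right[OF X S, of c' "- \<bar>t\<bar> - \<bar>s + r - c\<bar>" "s + r - c"])
        show "join t Z U i = X i" if "c' \<le> i" for i using UX[OF that] that t cc by simp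
        show "join t Z U (i + (s + r - c)) = X i" if "i < - \<bar>t\<bar> - \<bar>s + r - c\<bar>" for i
        proof -
          have "i + (s + r - c) < t" using that by linarith
          then show ?thesis using ZX by simp
        qed
      qed
      then have e: "join t Z U i = X i" for i by simp
      show ?thesis
      proof (rule periodic_agree_left[OF Z X])
        show "Z i = X i" if "i < t" for i using e[of i] that by simp
      qed
    qed
    have Ws: "seg W q2 q1 = seg W q2 r @ seg W r q1" using rq by (simp add: seg_append)
    have "length y = length (seg W q2 r)" unfolding r_def by simp
    then have ys: "y = seg W q2 r" "x = seg W r q1" using Ws xy(2) Wu by (simp_all add: append_eq_append_conv)
    show thesis
    proof (rule finish[of r])
      show "W i = U i" if "i < r" for i
      proof (cases "i < q2")
        case True then show ?thesis using WD(5) UD(5) by simp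
      next
        case False
        have "W i = J i" using seg_eqD[of W q2 r J q2 i] Jp(1) ys(1) that False by simp
        then show ?thesis using that rc' unfolding J_def by simp
      qed
      show "W i = V i" if "r \<le> i" for i
      proof (cases "i < q1")
        case True
        have "W i = J (i - r + (r + n))"
          using seg_eqD[of W r q1 J "r + n" i] Jp(3) ys(2) that True by (simp add: algebra_simps)
        also have "i - r + (r + n) = i + n" by simp
        also have "J (i + n) = V i" using that rc cc unfolding J_def by simp
        finally show ?thesis .
      next
        case False then show ?thesis using WD(6) VD(6) by simp
      qed
      show "V i = X i" if "i < r" for i using VX[of i] VZ[of i] that \<open>Z = X\<close> by (cases "i < c") auto
      show "U i = X i" if "r \<le> i" for i using UX[of i] UZ[of i] that \<open>Z = X\<close> by (cases "c' \<le> i") auto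
      show "power_word b c' = X" by (rule cX)
    qed
  qed
qed

text \<open>The abnormal factor passes from its left tail to X at q, and W passes from this factor
  to the chain at r. So W is the left tail attached to the chain at the smaller of q and r, and
  \<open>chain_step\<close> puts the overlaps in order.\<close>

lemma chain_abnormal:
  assumes w: "bridge_word W q2 q1 b2 b1" and V: "chain (join r X W) X"
    and U: "join r W X = join q (power_word b2 q2) X" and neq: "power_word b2 q2 \<noteq> X" and S: "Str (join r W X)"
  shows "chain W (power_word b2 q2)"
proof -
  note wD = wbrepD[OF w]
  define Lf where "Lf = power_word b2 q2"
  have Lf: "periodic Lf" unfolding Lf_def by (rule B_pw[OF wD(2)])
  have Ui: "join r W X i = join q Lf X i" for i using U unfolding Lf_def by simp
  show ?thesis
  proof (cases "q \<le> r")
    case True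
    have e: "join q Lf (join r X W) = W"
    proof
      fix i show "join q Lf (join r X W) i = W i"
        using Ui[of i] True by (cases "i < q"; cases "i < r") auto
    qed
    have "chain (join q Lf (join r X W)) Lf"
      by (rule chain_step[OF V Lf]) (use neq S U e wD(3) True in \<open>auto simp: Lf_def\<close>)
    then show ?thesis using e unfolding Lf_def by simp
  next
    case False
    have e: "join r Lf (join r X W) = W"
    proof
      fix i show "join r Lf (join r X W) i = W i"
        using Ui[of i] False by (cases "i < r") auto
    qed
    have "join r Lf X = join q Lf X"
    proof (rule join_move)
      show "Lf i = X i" if "r \<le> i" "i < q" for i using Ui[of i] that by simp
    qed (use False in simp)
    then have "chain (join r Lf (join r X W)) Lf"
      by (intro chain_step[OF V Lf]) (use neq S U e wD(3) in \<open>auto simp: Lf_def\<close>)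
    then show ?thesis using e unfolding Lf_def by simp
  qed
qed

text \<open>By \<open>touch_factors\<close>, an unfactorable word is touched by no periodic words
  other than its tails. Hence \<open>touch_unique\<close> identifies the factors as words, and
  \<open>cut_unique\<close> identifies the lists.\<close>

lemma last_factor_unique:
  assumes w: "bridge_word W q2 q1 b2 b1"
    and v: "bridge_word_of (join r (power_word b c) W) c q1 b v b1" "bridge_word_of (join r W (power_word b c)) q2 d b2 u' b" "power_word b d = power_word b c"
    and v': "bridge_word_of (join r' (power_word b' c') W) c' q1 b' v' b1" "bridge_word_of (join r' W (power_word b' c')) q2 d' b2 u'' b'" "power_word b' d' = power_word b' c'"
    and ch: "chain (join r (power_word b c) W) (power_word b c)"
    and nf: "\<not> factors (join r W (power_word b c)) q2 d b2 b" "\<not> factors (join r' W (power_word b' c')) q2 d' b2 b'"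
  shows "b = b' \<and> v = v' \<and> u' = u''"
proof -
  define X where "X = power_word b c"
  define Y where "Y = power_word b' c'"
  define Lf where "Lf = power_word b2 q2"
  note wD = wbrepD[OF w]
  note V = v(1)[unfolded bridge_word_of_def, THEN conjunct1] and U = v(2)[unfolded bridge_word_of_def, THEN conjunct1]
  note V' = v'(1)[unfolded bridge_word_of_def, THEN conjunct1] and U' = v'(2)[unfolded bridge_word_of_def, THEN conjunct1]
  have pX: "periodic X" and pY: "periodic Y" and pL: "periodic Lf"
    unfolding X_def Y_def Lf_def using B_pw wbrepD(2)[OF V] wbrepD(2)[OF V'] wD(2) by blast+
  have "X = Y \<and> join r X W = join r' Y W \<and> join r W X = join r' W Y"
  proof (rule touch_unique[OF wD(3) pX pY pL, of q2])
    show "W i = Lf i" if "i < q2" for i using wD(5) that unfolding Lf_def by simp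
    show "chain (join r X W) X" using ch unfolding X_def .
    show "join r X W \<noteq> X" using bridge_word_neq_left[OF V] unfolding X_def .
    show "join r' Y W \<noteq> Y" using bridge_word_neq_left[OF V'] unfolding Y_def .
    show "Str (join r W X)" "Str (join r' Y W)" "Str (join r' W Y)"
      unfolding X_def Y_def using wbrepD(3) U V' U' by blast+
    show "X \<noteq> Lf" using bridge_word_tails_neq[OF U] v(3) unfolding X_def Lf_def by simp
    show "Y \<noteq> Lf" using bridge_word_tails_neq[OF U'] v'(3) unfolding Y_def Lf_def by simp
    show "Z = Lf \<or> Z = X" if Z: "periodic Z" "Str (join p Z (join r W X))" "Str (join p (join r W X) Z)" for Z p
      using touch_factors[OF U touch_at[OF Z[unfolded X_def]]] nf(1) v(3) unfolding X_def Lf_def by metis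
    show "Z = Lf \<or> Z = Y" if Z: "periodic Z" "Str (join p Z (join r' W Y))" "Str (join p (join r' W Y) Z)" for Z p
      using touch_factors[OF U' touch_at[OF Z[unfolded Y_def]]] nf(2) v'(3) unfolding Y_def Lf_def by metis
  qed
  then have e: "X = Y" "join r X W = join r' Y W" "join r W X = join r' W Y" by auto
  have bb: "b = b'" using B_uniq e(1) wbrepD(2)[OF V] wbrepD(2)[OF V'] unfolding X_def Y_def by blast
  have "c = c'" using cut_unique[OF V, of c' q1] V' e(2) bb unfolding X_def Y_def by simp
  moreover have "d = d'" using cut_unique[OF U, of q2 d'] U' e(3) bb unfolding X_def Y_def by simp
  ultimately show ?thesis using bb v(1,2) v'(1,2) e unfolding bridge_word_of_def X_def Y_def by simp
qed

end

section \<open>Strings of a presentation\<close>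

fun is_dir :: "'a syllable \<Rightarrow> bool" where
  "is_dir (Dir a) = True"
| "is_dir (Inv a) = False"

lemma sublist_seg_iff:
  assumes "i \<le> j"
  shows "sublist xs (seg W i j) \<longleftrightarrow>
    (\<exists>a. i \<le> a \<and> a + int (length xs) \<le> j \<and> (\<forall>k<length xs. W (a + int k) = xs ! k))"
proof
  assume "sublist xs (seg W i j)"
  then obtain ps ss where e: "seg W i j = ps @ xs @ ss" unfolding sublist_def by blast
  have l: "nat (j - i) = length ps + length xs + length ss" using arg_cong[OF e, of length] by simp
  have "W (i + int (length ps) + int k) = xs ! k" if "k < length xs" for k
  proof -
    have "W (i + int (length ps + k)) = seg W i j ! (length ps + k)" using that l by simp
    then show ?thesis using that unfolding e by (simp add: nth_append algebra_simps)
  qed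
  then show "\<exists>a. i \<le> a \<and> a + int (length xs) \<le> j \<and> (\<forall>k<length xs. W (a + int k) = xs ! k)"
    using l assms by (intro exI[of _ "i + int (length ps)"]) auto
next
  assume "\<exists>a. i \<le> a \<and> a + int (length xs) \<le> j \<and> (\<forall>k<length xs. W (a + int k) = xs ! k)"
  then obtain a where a: "i \<le> a" "a + int (length xs) \<le> j" "\<forall>k<length xs. W (a + int k) = xs ! k" by blast
  have "xs = seg W a (a + int (length xs))" by (rule nth_equalityI) (use a(3) in auto)
  moreover have "seg W i j = seg W i a @ seg W a (a + int (length xs)) @ seg W (a + int (length xs)) j"
    using a by (simp add: seg_append)
  ultimately show "sublist xs (seg W i j)" unfolding sublist_def by metis
qed

lemma rotate_seg: "rotate k xs = seg (power_word xs 0) (int k) (int k + int (length xs))"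
  by (rule nth_equalityI) (auto simp: nth_rotate power_word_def nat_mod_distrib nat_add_distrib zmod_int[symmetric])

lemma power_word_rotate:
  assumes "xs \<noteq> []" shows "power_word (rotate k xs) p = power_word xs (p - int k)"
proof
  fix i
  define m where "m = (i - p) mod int (length xs)"
  have m: "0 \<le> m" "m < int (length xs)" unfolding m_def using assms by auto
  have "power_word (rotate k xs) p i = xs ! ((k + nat m) mod length xs)"
    unfolding power_word_def m_def[symmetric] using m by (simp add: nth_rotate m_def[symmetric])
  also have "(k + nat m) mod length xs = nat ((int k + m) mod int (length xs))"
    using m by (simp add: nat_mod_distrib nat_add_distrib)
  also have "(int k + m) mod int (length xs) = (i - (p - int k)) mod int (length xs)"
    unfolding m_def by (simp add: mod_simps algebra_simps)
  finally show "power_word (rotate k xs) p i = power_word xs (p - int k) i" unfolding power_word_def .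
qed

lemma list_pow_seg: "list_pow xs k = seg (power_word xs 0) 0 (int k * int (length xs))"
proof (induction k)
  case 0 then show ?case by (simp add: list_pow_def seg_def)
next
  case (Suc k)
  define m where "m = int k * int (length xs)"
  have a: "list_pow xs (Suc k) = list_pow xs k @ xs"
    unfolding list_pow_def by (simp add: replicate_append_same[symmetric])
  have "power_word xs m = power_word xs 0" by (rule power_word_cong) (simp add: m_def)
  then have e: "seg (power_word xs 0) m (m + int (length xs)) = xs" using seg_pword[of xs m] by simp
  have "list_pow xs (Suc k) = seg (power_word xs 0) 0 m @ seg (power_word xs 0) m (m + int (length xs))"
    by (simp only: a e Suc m_def[symmetric])
  also have "\<dots> = seg (power_word xs 0) 0 (m + int (length xs))"
    by (rule seg_append) (auto simp: m_def)
  finally show ?case by (simp add: m_def algebra_simps)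
qed

lemma length_list_pow: "length (list_pow xs k) = k * length xs"
  by (simp add: list_pow_def length_concat sum_list_replicate)

lemma seg_list_pow:
  assumes per: "\<And>i. W (i + int n) = W i" and "n > 0"
  shows "list_pow (seg W p (p + int n)) k = seg W p (p + int k * int n)"
proof -
  have "power_word (seg W p (p + int n)) 0 i = W (p + i)" for i
  proof -
    have "power_word (seg W p (p + int n)) 0 i = W (p + i mod int n)"
    proof -
      have "i mod int n < int n" "0 \<le> i mod int n" using assms(2) by simp_all
      then have "nat (i mod int n) < nat (p + int n - p)" by simp
      then show ?thesis unfolding power_word_def using assms(2) by simp
    qed
    also have "\<dots> = W (p + i mod int n + int n * (i div int n))"
      using periodic_mult[of W "int n"] per by metis
    also have "\<dots> = W (p + i)" by (simp add: algebra_simps)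
    finally show ?thesis .
  qed
  then have e: "power_word (seg W p (p + int n)) 0 = (\<lambda>i. W (i + p))" by (simp add: add.commute fun_eq_iff)
  show ?thesis unfolding list_pow_seg e seg_shift by (simp add: algebra_simps)
qed

locale presented =
  fixes A :: "('k, 'v, 'a) presentation" and B :: "('v, 'a) str set"
  assumes string_algebra: "string_algebra A" and signs: "sign_functions A"
    and domestic: "domestic A" and reps: "band_representatives A B"
begin

definition composable :: "'a syllable \<Rightarrow> 'a syllable \<Rightarrow> bool" where
  "composable a b \<longleftrightarrow> is_string A (Word [a, b])"

definition rel_words :: "'a syllable list set" where
  "rel_words = map Dir ` rels A \<union> (\<lambda>r. rev (map Inv r)) ` rels A"

definition band_lists :: "'a syllable list set" where
  "band_lists = syls ` B"

lemma rels_len: "r \<in> rels A \<Longrightarrow> 2 \<le> length r"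
  using string_algebra unfolding string_algebra_def Let_def by blast

lemma sub2: "2 \<le> length r \<Longrightarrow> sublist r [a, b] \<longleftrightarrow> r = [a, b]"
proof
  assume l: "2 \<le> length r" and "sublist r [a, b]"
  then obtain ps ss where e: "[a, b] = ps @ r @ ss" unfolding sublist_def by blast
  then have "length ps + length r + length ss = 2" by (metis length_append length_Cons list.size(3) add.assoc One_nat_def Suc_1)
  then have "length ps = 0" "length ss = 0" using l by linarith+
  then have "ps = []" "ss = []" by simp_all
  then show "r = [a, b]" using e by simp
qed simp

lemma composable_iff:
  "composable a b \<longleftrightarrow> arrow a \<in> arcs (quiver A) \<and> arrow b \<in> arcs (quiver A) \<and> syl_src A a = syl_tgt A b \<and>
     a \<noteq> syl_inv b \<and> (\<forall>r\<in>rels A. map Dir r \<noteq> [a, b] \<and> rev (map Inv r) \<noteq> [a, b])"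
  unfolding composable_def by (auto simp: sub2 rels_len)

lemma sign_facts:
  shows "\<And>x. x \<in> arcs (quiver A) \<Longrightarrow> arr_sig A x \<in> {1, -1} \<and> arr_eps A x \<in> {1, -1}"
    and "\<And>x y. x \<in> arcs (quiver A) \<Longrightarrow> y \<in> arcs (quiver A) \<Longrightarrow> x \<noteq> y \<Longrightarrow>
      tail (quiver A) x = tail (quiver A) y \<Longrightarrow> arr_sig A x = - arr_sig A y"
    and "\<And>x y. x \<in> arcs (quiver A) \<Longrightarrow> y \<in> arcs (quiver A) \<Longrightarrow> x \<noteq> y \<Longrightarrow>
      head (quiver A) x = head (quiver A) y \<Longrightarrow> arr_eps A x = - arr_eps A y"
    and "\<And>x y. x \<in> arcs (quiver A) \<Longrightarrow> y \<in> arcs (quiver A) \<Longrightarrow>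
      tail (quiver A) x = head (quiver A) y \<Longrightarrow> [x, y] \<notin> rels A \<Longrightarrow> arr_sig A x = - arr_eps A y"
proof -
  note s = signs[unfolded sign_functions_def Let_def]
  note s1 = s[THEN conjunct1] and s2 = s[THEN conjunct2, THEN conjunct1]
    and s3 = s[THEN conjunct2, THEN conjunct2, THEN conjunct1]
    and s4 = s[THEN conjunct2, THEN conjunct2, THEN conjunct2]
  fix x y
  assume x: "x \<in> arcs (quiver A)"
  show "arr_sig A x \<in> {1, -1} \<and> arr_eps A x \<in> {1, -1}" by (rule s1[rule_format, OF x])
  assume y: "y \<in> arcs (quiver A)"
  show "tail (quiver A) x = head (quiver A) y \<Longrightarrow> [x, y] \<notin> rels A \<Longrightarrow> arr_sig A x = - arr_eps A y"
    using s4[rule_format, OF x y] by blast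
  assume "x \<noteq> y"
  then show "tail (quiver A) x = tail (quiver A) y \<Longrightarrow> arr_sig A x = - arr_sig A y"
    using s2[rule_format, OF x y] by blast
  show "head (quiver A) x = head (quiver A) y \<Longrightarrow> arr_eps A x = - arr_eps A y"
    using s3[rule_format, OF x y] \<open>x \<noteq> y\<close> by blast
qed

text \<open>A syllable is determined by an end vertex, its sign there and its direction
  (\<open>syl_eq_tgt\<close>, \<open>syl_eq_src\<close>). Matching signs at a junction therefore
  yield \<open>succ_unique\<close> and \<open>pred_unique\<close>.\<close>

lemma composable_sig: assumes "composable a b" shows "syl_sig A a = - syl_eps A b"
proof -
  note t = assms[unfolded composable_iff]
  show ?thesis
  proof (cases a)
    case (Dir x)
    show ?thesis
    proof (cases b)
      case (Dir y)
      have "[x, y] \<notin> rels A" using t \<open>a = Dir x\<close> Dir by force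
      then show ?thesis using sign_facts(4)[of x y] t \<open>a = Dir x\<close> Dir by simp
    next
      case (Inv y)
      then have "x \<noteq> y" using t \<open>a = Dir x\<close> by auto
      then show ?thesis using sign_facts(2)[of x y] t \<open>a = Dir x\<close> Inv by simp
    qed
  next
    case (Inv x)
    show ?thesis
    proof (cases b)
      case (Dir y)
      then have "x \<noteq> y" using t \<open>a = Inv x\<close> by auto
      then show ?thesis using sign_facts(3)[of x y] t \<open>a = Inv x\<close> Dir by simp
    next
      case (Inv y)
      have "[y, x] \<notin> rels A" using t \<open>a = Inv x\<close> Inv by force
      then have "arr_sig A y = - arr_eps A x" using sign_facts(4)[of y x] t \<open>a = Inv x\<close> Inv by simp
      then show ?thesis using \<open>a = Inv x\<close> Inv by simp
    qed
  qed
qed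

lemma sign_val: "arrow a \<in> arcs (quiver A) \<Longrightarrow> syl_eps A a \<in> {1, -1} \<and> syl_sig A a \<in> {1, -1}"
  using sign_facts(1)[of "arrow a"] by (cases a) auto

lemma syl_eq_tgt:
  assumes "arrow a \<in> arcs (quiver A)" "arrow b \<in> arcs (quiver A)" "is_dir a = is_dir b"
    "syl_tgt A a = syl_tgt A b" "syl_eps A a = syl_eps A b"
  shows "a = b"
proof (rule ccontr)
  assume "a \<noteq> b"
  then have "syl_eps A a = - syl_eps A b"
    using assms(1-4) sign_facts(2,3)[of "arrow a" "arrow b"] by (cases a; cases b) simp_all
  then show False using assms(5) sign_val[OF assms(2)] by auto
qed

lemma syl_eq_src:
  assumes "arrow a \<in> arcs (quiver A)" "arrow b \<in> arcs (quiver A)" "is_dir a = is_dir b"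
    "syl_src A a = syl_src A b" "syl_sig A a = syl_sig A b"
  shows "a = b"
proof (rule ccontr)
  assume "a \<noteq> b"
  then have "syl_sig A a = - syl_sig A b"
    using assms(1-4) sign_facts(2,3)[of "arrow a" "arrow b"] by (cases a; cases b) simp_all
  then show False using assms(5) sign_val[OF assms(2)] by auto
qed

lemma sig_inv: "syl_sig A (syl_inv b) = syl_eps A b"
  by (cases b) auto

lemma rel_words_mono: assumes "r \<in> rel_words" "a \<in> set r" "b \<in> set r" shows "is_dir a = is_dir b"
proof -
  obtain r' where "r = map Dir r' \<or> r = rev (map Inv r')" using assms(1) unfolding rel_words_def by blast
  then show ?thesis using assms(2,3) by auto
qed

lemma words_TT: "words composable is_dir rel_words"
proof
  show "b = b'" if "composable a b" "composable a b'" "is_dir b = is_dir b'" for a b b'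
    using that(1,2)[unfolded composable_iff] composable_sig[OF that(1)] composable_sig[OF that(2)] that(3) by (intro syl_eq_tgt) auto
  show "a = a'" if "composable a b" "composable a' b" "is_dir a = is_dir a'" for a a' b
    using that(1,2)[unfolded composable_iff] composable_sig[OF that(1)] composable_sig[OF that(2)] that(3) by (intro syl_eq_src) auto
  \<comment> \<open>Vertex and sign are transported from a through x and c to b; opposite signs
    exclude cancellation. A relation is monotone, so it cannot be [a, b].\<close>
  show "composable a b" if "composable a x" "composable c x" "composable c b" "is_dir a \<noteq> is_dir b" for a b c x
    unfolding composable_iff
  proof (intro conjI ballI)
    note t = that(1-3)[unfolded composable_iff]
    show "arrow a \<in> arcs (quiver A)" "arrow b \<in> arcs (quiver A)" "syl_src A a = syl_tgt A b" using t by auto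
    show "a \<noteq> syl_inv b"
    proof
      assume "a = syl_inv b"
      then have "syl_sig A a = syl_eps A b" by (simp add: sig_inv)
      moreover have "syl_sig A a = - syl_eps A b"
        using composable_sig[OF that(1)] composable_sig[OF that(2)] composable_sig[OF that(3)] by simp
      ultimately show False using sign_val[of b] t by auto
    qed
    show "map Dir r \<noteq> [a, b]" "rev (map Inv r) \<noteq> [a, b]" if r: "r \<in> rels A" for r
    proof -
      have "map Dir r \<in> rel_words" "rev (map Inv r) \<in> rel_words" using r unfolding rel_words_def by auto
      then show "map Dir r \<noteq> [a, b]" "rev (map Inv r) \<noteq> [a, b]"
        using rel_words_mono[of _ a b] \<open>is_dir a \<noteq> is_dir b\<close> by force+
    qed
  qed
  show "is_dir a = is_dir b" if "r \<in> rel_words" "a \<in> set r" "b \<in> set r" for r a b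
    using rel_words_mono that .
qed

sublocale W: words composable is_dir rel_words by (rule words_TT)

lemma is_string_iff:
  "is_string A (Word xs) \<longleftrightarrow> xs \<noteq> [] \<and> arrow ` set xs \<subseteq> arcs (quiver A) \<and> successively composable xs \<and>
     (\<forall>r\<in>rel_words. \<not> sublist r xs)"
proof -
  have 1: "(\<forall>r\<in>rel_words. \<not> sublist r xs) \<longleftrightarrow> (\<forall>r\<in>rels A. \<not> sublist (map Dir r) xs \<and> \<not> sublist (rev (map Inv r)) xs)"
    unfolding rel_words_def by blast
  have 2: "successively composable xs \<longleftrightarrow> successively (\<lambda>\<beta> \<alpha>. syl_src A \<beta> = syl_tgt A \<alpha> \<and> \<beta> \<noteq> syl_inv \<alpha>) xs"
    if a: "arrow ` set xs \<subseteq> arcs (quiver A)" and r: "\<forall>r\<in>rel_words. \<not> sublist r xs"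
  proof -
    have "composable (xs ! i) (xs ! Suc i) \<longleftrightarrow> syl_src A (xs ! i) = syl_tgt A (xs ! Suc i) \<and> xs ! i \<noteq> syl_inv (xs ! Suc i)"
      if i: "Suc i < length xs" for i
    proof -
      have "xs = take i xs @ [xs ! i, xs ! Suc i] @ drop (Suc (Suc i)) xs"
        using i by (simp add: Cons_nth_drop_Suc)
      then have "sublist [xs ! i, xs ! Suc i] xs" unfolding sublist_def by blast
      then have "[xs ! i, xs ! Suc i] \<notin> rel_words" using r by blast
      moreover have "arrow (xs ! i) \<in> arcs (quiver A)" "arrow (xs ! Suc i) \<in> arcs (quiver A)"
        using a i by (auto simp: image_subset_iff)
      moreover have "\<forall>r\<in>rels A. map Dir r \<noteq> [xs ! i, xs ! Suc i] \<and> rev (map Inv r) \<noteq> [xs ! i, xs ! Suc i]"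
        using calculation(1) unfolding rel_words_def by (metis (no_types, lifting) UnI1 UnI2 image_eqI)
      ultimately show ?thesis unfolding composable_iff by blast
    qed
    then show ?thesis unfolding successively_conv_nth by auto
  qed
  show ?thesis using 1 2 by auto
qed

lemma Str_seg:
  assumes "W.Str X" "i < j" shows "is_string A (Word (seg X i j))"
  unfolding is_string_iff
proof (intro conjI ballI)
  have T: "composable (X k) (X (k + 1))" for k using assms(1) unfolding W.Str_def by blast
  show "seg X i j \<noteq> []" using assms(2) by (simp add: seg_def)
  show "arrow ` set (seg X i j) \<subseteq> arcs (quiver A)"
    using T[unfolded composable_iff] by (auto simp: seg_def)
  show "successively composable (seg X i j)" unfolding successively_conv_nth
  proof (intro allI impI)
    fix k assume "Suc k < length (seg X i j)"
    then show "composable (seg X i j ! k) (seg X i j ! Suc k)" using T[of "i + int k"] by (simp add: algebra_simps)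
  qed
  fix r assume "r \<in> rel_words"
  then show "\<not> sublist r (seg X i j)"
    using assms unfolding W.Str_def sublist_seg_iff[OF less_imp_le[OF assms(2)]] by blast
qed

lemma string_sub:
  assumes "is_string A (Word (xs @ ys @ zs))" "ys \<noteq> []" shows "is_string A (Word ys)"
proof -
  have "\<not> sublist r ys" if "r \<in> rel_words" for r
  proof
    assume "sublist r ys"
    then have "sublist r (xs @ ys @ zs)" unfolding sublist_def by (metis append.assoc)
    then show False using assms(1) that unfolding is_string_iff by blast
  qed
  then show ?thesis using assms unfolding is_string_iff by (auto simp: successively_append_iff)
qed

end

context presented begin

section \<open>Monotone strings, bands and least periods\<close>

lemma fin_digraph: "fin_digraph (quiver A)"
  using string_algebra unfolding string_algebra_def Let_def by blast

lemma long_paths: "\<exists>N. \<forall>p. quiver_path (quiver A) p \<and> length p \<ge> N \<longrightarrow> (\<exists>r\<in>rels A. sublist r p)"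
  using string_algebra unfolding string_algebra_def Let_def by blast

lemma monotone_dir:
  assumes "\<forall>x\<in>set xs. is_dir x" shows "map (Dir \<circ> arrow) xs = xs"
  using assms by (induction xs) (auto, metis is_dir.elims(2) syllable.sel(1))

lemma monotone_inv:
  assumes "\<forall>x\<in>set xs. \<not> is_dir x" shows "map (Inv \<circ> arrow) xs = xs"
  using assms by (induction xs) (auto, metis is_dir.elims(3) syllable.sel(2))

text \<open>A monotone string is a path or the inverse of a path, and long paths contain a
  relation.\<close>

lemma mono_word_bound:
  "\<exists>N>0. \<forall>X i. W.Str X \<longrightarrow> (\<exists>k. i < k \<and> k < i + N \<and> is_dir (X k) \<noteq> is_dir (X i))"
proof -
  obtain N where N: "\<forall>p. quiver_path (quiver A) p \<and> length p \<ge> N \<longrightarrow> (\<exists>r\<in>rels A. sublist r p)"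
    using long_paths by blast
  \<comment> \<open>The additional letter keeps the window non-empty when N = 0.\<close>
  define M where "M = N + 1"
  have "\<exists>k. i < k \<and> k < i + int M \<and> is_dir (X k) \<noteq> is_dir (X i)" if X: "W.Str X" for X i
  proof (rule ccontr)
    assume n: "\<not> ?thesis"
    define xs where "xs = seg X i (i + int M)"
    have len: "length xs = M" unfolding xs_def by simp
    have same: "is_dir x = is_dir (X i)" if "x \<in> set xs" for x
    proof -
      from that obtain k where k: "x = X (i + int k)" "k < M" unfolding xs_def seg_def by auto
      then show ?thesis using n by (cases "k = 0") auto
    qed
    have str: "is_string A (Word xs)" unfolding xs_def by (rule Str_seg[OF X]) (simp add: M_def)
    note s = str[unfolded is_string_iff]
    define p where "p = (if is_dir (X i) then map arrow xs else rev (map arrow xs))"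
    have suc: "syl_src A (xs ! k) = syl_tgt A (xs ! Suc k)" if "Suc k < length xs" for k
      using s that unfolding successively_conv_nth composable_iff by blast
    have "quiver_path (quiver A) p" unfolding quiver_path_def
    proof (intro conjI)
      show "p \<noteq> []" unfolding p_def using s by simp
      show "set p \<subseteq> arcs (quiver A)" unfolding p_def using s by auto
      show "successively (\<lambda>a b. tail (quiver A) a = head (quiver A) b) p"
      proof (cases "is_dir (X i)")
        case True
        have "tail (quiver A) (arrow (xs ! k)) = head (quiver A) (arrow (xs ! Suc k))" if "Suc k < length xs" for k
        proof -
          have "is_dir (xs ! k)" "is_dir (xs ! Suc k)" using same True that by auto
          then show ?thesis using suc[OF that] by (cases "xs ! k"; cases "xs ! Suc k") auto
        qed
        then show ?thesis unfolding p_def using True by (simp add: successively_conv_nth)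
      next
        case False
        have "tail (quiver A) (arrow (xs ! Suc k)) = head (quiver A) (arrow (xs ! k))" if "Suc k < length xs" for k
        proof -
          have "\<not> is_dir (xs ! k)" "\<not> is_dir (xs ! Suc k)" using same False that by auto
          then show ?thesis using suc[OF that] by (cases "xs ! k"; cases "xs ! Suc k") auto
        qed
        then have "successively (\<lambda>b a. tail (quiver A) a = head (quiver A) b) (map arrow xs)"
          by (simp add: successively_conv_nth)
        then show ?thesis unfolding p_def using False by simp
      qed
    qed
    moreover have "length p \<ge> N" unfolding p_def using len by (simp add: M_def)
    ultimately obtain r where r: "r \<in> rels A" "sublist r p" using N by blast
    have "\<exists>r'\<in>rel_words. sublist r' xs"
    proof (cases "is_dir (X i)")
      case True
      then have "sublist r (map arrow xs)" using r(2) unfolding p_def by simp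
      then have "sublist (map Dir r) (map Dir (map arrow xs))" by (rule map_mono_sublist)
      moreover have "map Dir (map arrow xs) = xs" using monotone_dir[of xs] same True by simp
      ultimately show ?thesis using r(1) unfolding rel_words_def by (metis UnI1 image_eqI)
    next
      case False
      then have "sublist (rev r) (map arrow xs)" using r(2) unfolding p_def by (metis rev_rev_ident sublist_rev)
      then have "sublist (map Inv (rev r)) (map Inv (map arrow xs))" by (rule map_mono_sublist)
      moreover have "map Inv (map arrow xs) = xs" using monotone_inv[of xs] same False by simp
      ultimately show ?thesis using r(1) unfolding rel_words_def by (metis UnI2 image_eqI rev_map)
    qed
    then show False using s by blast
  qed
  then show ?thesis by (intro exI[of _ "int M"]) (auto simp: M_def)
qed

text \<open>The least period makes the word primitive, and starting at a change from inverse to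
  direct gives the prescribed first and last syllables.\<close>

lemma band_of_periodic:
  assumes X: "W.Str X" and m: "m > 0" "\<forall>i. X (i + m) = X i"
  obtains p n where "n > 0" "\<forall>i. X (i + int n) = X i" "band A (Word (seg X p (p + int n)))"
proof -
  define P where "P = (\<lambda>n. n > 0 \<and> (\<forall>i. X (i + int n) = X i))"
  define n where "n = (LEAST n. P n)"
  have "P (nat m)" unfolding P_def using m by simp
  then have Pn: "P n" unfolding n_def by (rule LeastI)
  have least: "n \<le> n'" if "P n'" for n' unfolding n_def using that by (rule Least_le)
  have n: "n > 0" "\<And>i. X (i + int n) = X i" using Pn unfolding P_def by auto
  obtain N where N: "\<forall>X i. W.Str X \<longrightarrow> (\<exists>k. i < k \<and> k < i + N \<and> is_dir (X k) \<noteq> is_dir (X i))"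
    using mono_word_bound by (elim exE conjE)
  have nx: "\<exists>k. i < k \<and> is_dir (X k) \<noteq> is_dir (X i)" for i using N[rule_format, OF X, of i] by blast
  have "\<exists>a. \<not> is_dir (X a)"
  proof (cases "is_dir (X 0)")
    case True then show ?thesis using nx[of 0] by auto
  qed auto
  then obtain a where a: "\<not> is_dir (X a)" by blast
  obtain b where b: "a < b" "is_dir (X b)" using nx[of a] a by auto
  obtain p where p: "a \<le> p" "p \<le> b" "is_dir (X p)" "\<And>i. a \<le> i \<Longrightarrow> i < p \<Longrightarrow> \<not> is_dir (X i)"
    by (rule first_diff[of a b "\<lambda>i. is_dir (X i)"]) (use b in auto)
  have ap: "a < p" using p(1,3) a by (cases "a = p") auto
  have p1: "\<not> is_dir (X (p - 1))" using p(4)[of "p - 1"] ap by simp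
  define xs where "xs = seg X p (p + int n)"
  have xs: "xs \<noteq> []" "length xs = n" unfolding xs_def using n by (auto simp: seg_def)
  have hd: "hd xs = X p" using xs n(1) unfolding xs_def by (simp add: hd_conv_nth)
  have "last xs = X (p + int n - 1)" using xs n(1) unfolding xs_def
    by (simp add: last_conv_nth of_nat_diff add_diff_eq)
  then have last: "last xs = X (p - 1)" using n(2)[of "p - 1"] by (simp add: algebra_simps)
  have T: "composable (X (p - 1)) (X p)" using X unfolding W.Str_def by (metis diff_add_cancel)
  have pow: "list_pow xs k = seg X p (p + int k * int n)" for k
    unfolding xs_def by (rule seg_list_pow) (use n in auto)
  have "band A (Word xs)" unfolding band_def
  proof (intro conjI allI impI)
    show "is_string A (Word xs)" unfolding xs_def by (rule Str_seg[OF X]) (use n in simp)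
    show "syls (Word xs) \<noteq> []" using xs by simp
    show "str_src A (Word xs) = str_tgt A (Word xs)" using T unfolding composable_iff by (simp add: hd last)
    show "\<exists>a. last (syls (Word xs)) = Inv a" using p1 last by (cases "X (p - 1)") auto
    show "\<exists>a. hd (syls (Word xs)) = Dir a" using p(3) hd by (cases "X p") auto
    show "is_string A (Word (list_pow (syls (Word xs)) k))" if "1 \<le> k" for k
      unfolding syls.simps pow by (rule Str_seg[OF X]) (use n that in simp)
    show "\<not> (\<exists>c k. is_string A c \<and> 2 \<le> k \<and> syls (Word xs) = list_pow (syls c) k)"
    proof
    assume "\<exists>c k. is_string A c \<and> 2 \<le> k \<and> syls (Word xs) = list_pow (syls c) k"
    then obtain c k where ck: "2 \<le> k" "xs = list_pow (syls c) k" and "is_string A c" unfolding syls.simps by blast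
    \<comment> \<open>If the word were a proper power of c, the length of c would be a period
      smaller than the least one.\<close>
    define l where "l = length (syls c)"
    have nk: "n = k * l"
      unfolding l_def xs(2)[symmetric] by (subst ck(2)) (simp only: length_list_pow)
    have "l \<noteq> 0" using nk n(1) by (cases "l = 0") simp_all
    moreover have "2 * l \<le> k * l" using ck(1) by (rule mult_right_mono) simp
    ultimately have l: "l > 0" "l < n" using nk by linarith+
    have win: "X (p + int j) = power_word (syls c) 0 (int j)" if "j < n" for j
    proof -
      have "xs ! j = X (p + int j)" unfolding xs_def using that by simp
      moreover have "xs ! j = power_word (syls c) 0 (int j)"
      proof -
        have "int j < int k * int (length (syls c))"
          using that nk unfolding l_def of_nat_mult[symmetric] of_nat_less_iff by simp
        then have "j < nat (int k * int (length (syls c)) - 0)" by linarith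
        then show ?thesis unfolding ck(2) list_pow_seg by simp
      qed
      ultimately show ?thesis by simp
    qed
    have Xn: "X (i + int n * q) = X i" for i q by (rule periodic_mult) (use n in auto)
    have "X i = power_word (syls c) 0 (i - p)" for i
    proof -
      define j where "j = nat ((i - p) mod int n)"
      have j: "j < n" "int j = (i - p) mod int n" unfolding j_def using n by (auto simp: nat_less_iff)
      have i: "i = p + int j + int n * ((i - p) div int n)" unfolding j(2) by (simp add: algebra_simps)
      have "X i = X (p + int j)" using Xn[of "p + int j"] i by metis
      also have "\<dots> = power_word (syls c) 0 (int j)" by (rule win[OF j(1)])
      also have "\<dots> = power_word (syls c) 0 (int j + int l * (int k * ((i - p) div int n)))"
        by (rule periodic_mult[of "power_word (syls c) 0" "int l", symmetric]) (simp add: l_def power_word_period)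
      also have "int j + int l * (int k * ((i - p) div int n)) = i - p"
        using i nk by (simp add: algebra_simps)
      finally show ?thesis .
    qed
    then have "X (i + int l) = X i" for i
      using power_word_period[of "syls c" 0 "i - p"] unfolding l_def by (simp add: algebra_simps)
    then have "P l" unfolding P_def using l by blast
    then show False using least[of l] l by simp
    qed
  qed
  then show thesis using that n unfolding xs_def by blast
qed

text \<open>The least period of a periodic string is the length of a band, and domesticity leaves
  finitely many bands.\<close>

lemma bounded_periods:
  "\<exists>L. \<forall>X m. W.Str X \<longrightarrow> m > 0 \<longrightarrow> (\<forall>i. X (i + m) = X i) \<longrightarrow>
       (\<exists>n>0. n \<le> L \<and> (\<forall>i. X (i + n) = X i))"
proof -
  define S where "S = (\<lambda>b. int (length (syls b))) ` {b. band A b}"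
  have fin: "finite S" unfolding S_def using domestic unfolding domestic_def by simp
  show ?thesis
  proof (rule exI[of _ "Max S"], intro allI impI)
    fix X m
    assume X: "W.Str X" "m > 0" "\<forall>i. X (i + m) = X i"
    obtain p n where n: "n > 0" "\<forall>i. X (i + int n) = X i" "band A (Word (seg X p (p + int n)))"
      by (rule band_of_periodic[OF X])
    have "int n \<in> S" unfolding S_def using n(3) by (intro image_eqI[of _ _ "Word (seg X p (p + int n))"]) auto
    then have "int n \<le> Max S" using fin by simp
    then show "\<exists>n>0. n \<le> Max S \<and> (\<forall>i. X (i + n) = X i)" using n by (intro exI[of _ "int n"]) auto
  qed
qed

sublocale W: domestic_words composable is_dir rel_words
  by unfold_locales (rule mono_word_bound bounded_periods)+

lemma band_word:
  assumes "band A b"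
  shows "b = Word (syls b)" "syls b \<noteq> []" "is_dir (hd (syls b))" "\<not> is_dir (last (syls b))"
    "W.Str (power_word (syls b) 0)" "syl_src A (last (syls b)) = syl_tgt A (hd (syls b))"
proof -
  note s = assms[unfolded band_def]
  show b: "b = Word (syls b)" using s by (cases b) auto
  show ne: "syls b \<noteq> []" "is_dir (hd (syls b))" "\<not> is_dir (last (syls b))" using s by auto
  show "syl_src A (last (syls b)) = syl_tgt A (hd (syls b))" using s b by (metis str_src.simps(2) str_tgt.simps(2))
  define n where "n = int (length (syls b))"
  have n: "n > 0" unfolding n_def using ne by simp
  define Y where "Y = power_word (syls b) 0"
  have Yn: "Y (i + n * q) = Y i" for i q
    by (rule periodic_mult) (simp add: Y_def n_def power_word_period)
  have str: "is_string A (Word (seg Y 0 (int k * n)))" if "1 \<le> k" for k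
    using s that unfolding Y_def n_def list_pow_seg[symmetric] by simp
  \<comment> \<open>The definition of a band speaks of finite powers. Any window of the bi-infinite
    power, moved by a multiple of n, fits into one of them.\<close>
  have win: "\<exists>k a. 1 \<le> k \<and> 0 \<le> a \<and> a + l \<le> int k * n \<and> (\<forall>j. Y (i + j) = Y (a + j))" if "0 \<le> l" for i l
  proof -
    define a where "a = i mod n"
    define k where "k = nat (a + l) + 1"
    have a: "0 \<le> a" "a < n" unfolding a_def using n by auto
    have "int k * 1 \<le> int k * n" using n by (intro mult_left_mono) auto
    moreover have "int k = a + l + 1" using a that unfolding k_def by simp
    ultimately have "a + l \<le> int k * n" by linarith
    moreover have "Y (i + j) = Y (a + j)" for j
    proof -
      have "i + j = (a + j) + n * (i div n)" unfolding a_def by (simp add: algebra_simps)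
      then show ?thesis using Yn by metis
    qed
    ultimately show ?thesis using a by (intro exI[of _ k] exI[of _ a]) (auto simp: k_def)
  qed
  show "W.Str (power_word (syls b) 0)" unfolding W.Str_def Y_def[symmetric]
  proof (intro conjI allI ballI notI)
    fix i
    obtain k a where k: "1 \<le> k" "0 \<le> a" "a + 2 \<le> int k * n" "\<forall>j. Y (i + j) = Y (a + j)"
      using win[of 2 i] by auto
    have "successively composable (seg Y 0 (int k * n))" using str[OF k(1)] unfolding is_string_iff by blast
    moreover have l: "Suc (nat a) < nat (int k * n)" using k(2,3) by linarith
    ultimately have "composable (seg Y 0 (int k * n) ! nat a) (seg Y 0 (int k * n) ! Suc (nat a))"
      unfolding successively_conv_nth length_seg diff_0_right by blast
    moreover have "seg Y 0 (int k * n) ! nat a = Y a" "seg Y 0 (int k * n) ! Suc (nat a) = Y (a + 1)"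
      using l Suc_lessD[OF l] k(2) nth_seg[of "nat a" "int k * n" 0 Y] nth_seg[of "Suc (nat a)" "int k * n" 0 Y]
      by (simp_all add: add.commute)
    ultimately have "composable (Y a) (Y (a + 1))" by simp
    then show "composable (Y i) (Y (i + 1))" using k(4)[rule_format, of 0] k(4)[rule_format, of 1] by simp
  next
    fix r i assume r: "r \<in> rel_words" "\<forall>k<length r. Y (i + int k) = r ! k"
    obtain k a where k: "1 \<le> k" "0 \<le> a" "a + int (length r) \<le> int k * n" "\<forall>j. Y (i + j) = Y (a + j)"
      using win[of "int (length r)" i] by auto
    have "0 \<le> int k * n" using n by simp
    then have "sublist r (seg Y 0 (int k * n))"
      unfolding sublist_seg_iff[OF \<open>0 \<le> int k * n\<close>] using k r(2) by auto
    then show False using str[OF k(1)] r(1) unfolding is_string_iff by blast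
  qed
qed

text \<open>If a shift by d fixes the power word, so does a shift by gcd(n, d), by Bezout. Unless n
  divides d, the band would be a proper power.\<close>

lemma band_primitive:
  assumes b: "band A b" and e: "power_word (syls b) p = power_word (syls b) q"
  shows "int (length (syls b)) dvd p - q"
proof -
  define n where "n = length (syls b)"
  define X where "X = power_word (syls b) 0"
  have ne: "n > 0" unfolding n_def using band_word(2)[OF b] by simp
  have Xn: "X (i + int n) = X i" for i unfolding X_def n_def by (rule power_word_period)
  define d where "d = p - q"
  have Xd: "X (i + d) = X i" for i
  proof -
    have "power_word (syls b) p (i + p) = power_word (syls b) q (i + p)" using e by simp
    then show ?thesis unfolding X_def d_def power_word_def by (simp add: algebra_simps)
  qed
  define g where "g = nat (gcd (int n) d)"
  have gp: "gcd (int n) d > 0" using ne by simp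
  then have g3: "int g = gcd (int n) d" unfolding g_def by simp
  have g1: "g > 0" using g3 gp by linarith
  have g2: "g dvd n" by (rule int_dvd_int_iff[THEN iffD1]) (simp add: g3)
  note g = g1 g2 g3
  obtain u v where uv: "u * int n + v * d = gcd (int n) d" using bezout_int by blast
  have "X (i + int g) = X i" for i
  proof -
    have "i + int g = (i + int n * u) + d * v" using uv g(3) by (simp add: algebra_simps)
    then have "X (i + int g) = X (i + int n * u + d * v)" by (rule arg_cong)
    also have "\<dots> = X (i + int n * u)" by (rule periodic_mult) (simp add: Xd)
    also have "\<dots> = X i" by (rule periodic_mult) (simp add: Xn)
    finally show ?thesis .
  qed
  then have pow: "list_pow (seg X 0 (0 + int g)) k = seg X 0 (0 + int k * int g)" for k
    by (rule seg_list_pow) (rule g(1))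
  obtain k where k: "n = g * k" using g(2) by blast
  have "syls b = seg X 0 (int n)" using seg_pword[of "syls b" 0] unfolding X_def n_def by simp
  then have sb: "syls b = list_pow (seg X 0 (int g)) k" using pow[of k] k by (simp add: algebra_simps)
  have "is_string A (Word (seg X 0 (int g)))"
    by (rule Str_seg) (use band_word(5)[OF b] g X_def in auto)
  then have "\<not> 2 \<le> k" using b sb unfolding band_def by (metis syls.simps(2))
  then have "k = 1" using k ne by (cases k) auto
  then have "int n = gcd (int n) d" using k g(3) by simp
  then have "int n dvd d" by (metis gcd_dvd2)
  then show ?thesis unfolding n_def d_def .
qed

lemma band_length_unique:
  assumes "band A b" "band A b'" "power_word (syls b) p = power_word (syls b') q"
  shows "length (syls b) = length (syls b')"
proof -
  have 1: "int (length (syls b')) dvd int (length (syls b))"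
    if e: "power_word (syls b) p = power_word (syls b') q" and b': "band A b'" for b b' p q
  proof -
    have "power_word (syls b') (q - int (length (syls b))) i = power_word (syls b') q i" for i
      using power_word_shift[of "syls b'" q i "int (length (syls b))"] power_word_period[of "syls b" p i] e by metis
    then have "power_word (syls b') q = power_word (syls b') (q - int (length (syls b)))" by (simp add: fun_eq_iff)
    then show ?thesis using band_primitive[OF b'] by fastforce
  qed
  show ?thesis using 1[OF assms(3,2)] 1[OF assms(3)[symmetric] assms(1)] by (simp add: dvd_antisym)
qed

lemma rep_band: "b \<in> B \<Longrightarrow> band A b"
  using reps unfolding band_representatives_def by blast

lemma band_lists_band: "l \<in> band_lists \<Longrightarrow> band A (Word l) \<and> Word l \<in> B"
proof -
  assume "l \<in> band_lists"
  then obtain b where b: "b \<in> B" "l = syls b" unfolding band_lists_def by blast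
  then show ?thesis using rep_band[OF b(1)] band_word(1)[OF rep_band[OF b(1)]] by metis
qed

lemma eq_rotate:
  assumes e: "power_word xs p = power_word ys q" and l: "length xs = length ys" and ne: "ys \<noteq> []"
  shows "\<exists>k. xs = rotate k ys"
proof -
  define m where "m = p - q"
  define k where "k = nat (m mod int (length ys))"
  have k: "int k = m mod int (length ys)" unfolding k_def using ne by simp
  have "xs = seg (power_word xs p) p (p + int (length xs))" by (rule seg_pword[symmetric])
  also have "\<dots> = seg (power_word ys q) p (p + int (length ys))" using e l by simp
  also have "power_word ys q = power_word ys (p - int k)"
    by (rule power_word_cong) (simp add: k m_def mod_eq_dvd_iff[symmetric] mod_simps)
  also have "power_word ys (p - int k) = power_word (rotate k ys) p" by (rule power_word_rotate[OF ne, symmetric])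
  also have "seg (power_word (rotate k ys) p) p (p + int (length ys)) = rotate k ys"
    using seg_pword[of "rotate k ys" p] by simp
  finally show ?thesis by blast
qed

sublocale W: band_words composable is_dir rel_words band_lists
proof
  show "b \<noteq> []" "is_dir (hd b)" "\<not> is_dir (last b)" "W.Str (power_word b 0)" if "b \<in> band_lists" for b
    using band_word(2-5)[of "Word b"] band_lists_band[OF that] by simp_all
  show "int (length b) dvd p - q" if "b \<in> band_lists" "power_word b p = power_word b q" for b p q
    using band_primitive[of "Word b"] band_lists_band[OF that(1)] that(2) by simp
  show "\<exists>b\<in>band_lists. \<exists>p. X = power_word b p" if X: "W.periodic X" for X
  proof -
    obtain m where m: "W.Str X" "m > 0" "\<forall>i. X (i + m) = X i" using X unfolding W.periodic_def by blast
    obtain p n where n: "n > 0" "\<forall>i. X (i + int n) = X i" "band A (Word (seg X p (p + int n)))"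
      by (rule band_of_periodic[OF m])
    define xs where "xs = seg X p (p + int n)"
    have "\<exists>!b'. b' \<in> B \<and> cyclic_perm b' (Word xs)"
      using reps n(3) unfolding band_representatives_def xs_def by blast
    then obtain k where k: "Word (rotate k xs) \<in> B" unfolding cyclic_perm_def by auto
    have xs: "xs \<noteq> []" "length xs = n" unfolding xs_def using n by (auto simp: seg_def)
    have "X i = power_word xs p i" for i
    proof -
      define j where "j = (i - p) mod int n"
      have j: "0 \<le> j" "j < int n" unfolding j_def using n by auto
      have "power_word xs p i = X (p + j)"
        unfolding power_word_def xs(2) j_def[symmetric] unfolding xs_def using j by simp
      also have "\<dots> = X (p + j + int n * ((i - p) div int n))"
        by (rule periodic_mult[OF n(2), symmetric])
      also have "p + j + int n * ((i - p) div int n) = i" unfolding j_def by (simp add: algebra_simps)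
      finally show ?thesis by simp
    qed
    then have "X = power_word (rotate k xs) (p + int k)" using power_word_rotate[OF xs(1), of k "p + int k"] by auto
    moreover have "rotate k xs \<in> band_lists" unfolding band_lists_def using k by force
    ultimately show ?thesis by blast
  qed
  show "b = b'" if "b \<in> band_lists" "b' \<in> band_lists" "power_word b p = power_word b' q" for b b' p q
  proof -
    note bb = band_lists_band[OF that(1)] band_lists_band[OF that(2)] and pe = that(3)
    have "length b = length b'" using band_length_unique[of "Word b" "Word b'"] bb pe by simp
    moreover have "b' \<noteq> []" using band_word(2)[of "Word b'"] bb by simp
    ultimately obtain k where k: "b = rotate k b'" using eq_rotate[OF pe] by blast
    have "\<exists>!b''. b'' \<in> B \<and> cyclic_perm b'' (Word b')"
      using reps bb unfolding band_representatives_def by blast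
    moreover have "cyclic_perm (Word b) (Word b')" "cyclic_perm (Word b') (Word b')"
      unfolding cyclic_perm_def k by (auto intro: exI[of _ 0])
    ultimately show ?thesis using bb by blast
  qed
qed

end

section \<open>Weak bridges of a presentation\<close>

lemma seg_pword_rotate:
  assumes "b \<noteq> []" shows "\<exists>k. seg (power_word b s) g (g + int (length b)) = rotate k b"
proof -
  define k where "k = nat ((g - s) mod int (length b))"
  have k: "int k = (g - s) mod int (length b)" unfolding k_def using assms by simp
  have "power_word b s = power_word b (g - int k)"
  proof (rule power_word_cong)
    have "int (length b) dvd (g - s) - (g - s) mod int (length b)" by (rule dvd_minus_mod)
    then show "int (length b) dvd s - (g - int k)" unfolding k by (simp add: dvd_diff_commute algebra_simps)
  qed
  then have "seg (power_word b s) g (g + int (length b)) = seg (\<lambda>x. power_word b 0 (x + (int k - g))) g (g + int (length b))"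
    by (simp add: power_word_shift)
  also have "\<dots> = seg (power_word b 0) (int k) (int k + int (length b))"
    unfolding seg_shift by (simp add: algebra_simps)
  also have "\<dots> = rotate k b" by (rule rotate_seg[symmetric])
  finally show ?thesis by blast
qed

lemma seg_in_list_pow:
  assumes "l \<noteq> []" shows "\<exists>m. sublist (seg (power_word l p) a b) (list_pow l m)"
proof (cases "a \<le> b")
  case True
  define n where "n = int (length l)"
  have n: "n > 0" unfolding n_def using assms by simp
  define a' where "a' = (a - p) mod n"
  have a': "0 \<le> a'" unfolding a'_def using n by simp
  define m where "m = nat (a' + (b - a))"
  have "int m * 1 \<le> int m * n" using n by (intro mult_left_mono) auto
  moreover have "int m = a' + (b - a)" unfolding m_def using a' True by simp
  ultimately have m: "a' + (b - a) \<le> int m * n" by linarith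
  have "power_word l 0 (a' + j) = power_word l p (a + j)" for j
    unfolding power_word_def a'_def n_def by (simp add: mod_simps algebra_simps)
  moreover have mn: "0 \<le> int m * n" using n by simp
  ultimately have "sublist (seg (power_word l p) a b) (seg (power_word l 0) 0 (int m * n))"
    unfolding sublist_seg_iff[OF mn] using True m a' by (intro exI[of _ a']) auto
  then show ?thesis unfolding list_pow_seg n_def by blast
next
  case False
  then have "seg (power_word l p) a b = []" by (simp add: seg_def)
  then show ?thesis by simp
qed

lemma list_pow_sub_word:
  assumes "sublist (seg X a b) (list_pow l m)" "a \<le> b"
  obtains s where "\<And>i. a \<le> i \<Longrightarrow> i < b \<Longrightarrow> X i = power_word l s i"
proof -
  have n: "0 \<le> int m * int (length l)" by simp
  obtain c where c: "\<forall>k<length (seg X a b). power_word l 0 (c + int k) = seg X a b ! k"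
    using assms(1) unfolding list_pow_seg sublist_seg_iff[OF n] by blast
  show thesis
  proof (rule that[of "a - c"])
    fix i assume i: "a \<le> i" "i < b"
    have "seg X a b ! nat (i - a) = power_word l 0 (c + int (nat (i - a)))"
      using c[rule_format, of "nat (i - a)"] i by simp
    then show "X i = power_word l (a - c) i" using i by (simp add: power_word_def algebra_simps)
  qed
qed

lemma list_pow_rev_map:
  fixes f :: "'z \<Rightarrow> 'z"
  shows "list_pow (rev (map f l)) m = rev (map f (list_pow l m))"
proof (induction m)
  case (Suc m)
  have a: "list_pow xs (Suc m) = list_pow xs m @ xs" for xs :: "'z list"
    unfolding list_pow_def by (simp add: replicate_append_same[symmetric])
  have b: "list_pow xs (Suc m) = xs @ list_pow xs m" for xs :: "'z list"
    unfolding list_pow_def by simp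
  show ?case unfolding a[of "rev (map f l)"] Suc b[of l] by simp
qed (simp add: list_pow_def)

lemma syl_inv_inv [simp]: "syl_inv (syl_inv a) = a"
  by (cases a) auto

lemma syls_str_inv [simp]: "syls (str_inv u) = rev (map syl_inv (syls u))"
  by (cases u) auto

lemma sublist_inv: "sublist (rev (map syl_inv xs)) (rev (map syl_inv ys)) \<longleftrightarrow> sublist xs ys"
proof
  assume "sublist (rev (map syl_inv xs)) (rev (map syl_inv ys))"
  then have "sublist (map syl_inv xs) (map syl_inv ys)" by simp
  then have "sublist (map syl_inv (map syl_inv xs)) (map syl_inv (map syl_inv ys))" by (rule map_mono_sublist)
  then show "sublist xs ys" by (simp add: comp_def)
qed (simp add: map_mono_sublist)

lemma syls_str_mult: "str_mult A x y = Some z \<Longrightarrow> syls z = syls x @ syls y"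
  by (cases x; cases y) (auto split: if_splits)

definition extended_word :: "'l list \<Rightarrow> 'l list \<Rightarrow> 'l list \<Rightarrow> int \<Rightarrow> int \<Rightarrow> 'l" where
  "extended_word b2 u b1 p i = (if i < p then power_word b2 p i else if i < p + int (length u) then u ! nat (i - p)
     else power_word b1 (p + int (length u)) i)"

context presented begin

text \<open>In a weak bridge the label of a length-0 string is forced by the source band.\<close>

definition mkstr :: "'a syllable list \<Rightarrow> 'a syllable list \<Rightarrow> ('v, 'a) str" where
  "mkstr l us = (if us = [] then Triv (syl_tgt A (hd l)) (syl_eps A (hd l)) else Word us)"

lemma syls_mkstr [simp]: "syls (mkstr l us) = us"
  by (simp add: mkstr_def)

lemma composable_same_target:
  assumes "composable a x" "composable a y" shows "syl_tgt A x = syl_tgt A y" "syl_eps A x = syl_eps A y"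
  using assms[unfolded composable_iff] composable_sig[OF assms(1)] composable_sig[OF assms(2)] by auto

lemma composable_src: assumes "composable a x" shows "syl_src A a = syl_tgt A x" "syl_sig A a = - syl_eps A x"
  using assms[unfolded composable_iff] composable_sig[OF assms] by auto

lemma junction:
  assumes "is_string A (Word (xs @ ys))" "xs \<noteq> []" "ys \<noteq> []" shows "composable (last xs) (hd ys)"
  using assms unfolding is_string_iff successively_append_iff by blast

lemma is_string_triv:
  assumes "arrow a \<in> arcs (quiver A)" shows "is_string A (Triv (syl_tgt A a) (syl_eps A a))"
proof -
  interpret Q: fin_digraph "quiver A" by (rule fin_digraph)
  show ?thesis using assms sign_val[OF assms] by (cases a) auto
qed

lemma string_arc: "is_string A (Word xs) \<Longrightarrow> a \<in> set xs \<Longrightarrow> arrow a \<in> arcs (quiver A)"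
  unfolding is_string_iff by blast

lemma band_lists_D:
  assumes "l \<in> band_lists"
  shows "l \<noteq> []" "is_dir (hd l)" "\<not> is_dir (last l)" "composable (last l) (hd l)" "Word l \<in> B" "band A (Word l)"
    "is_string A (Word l)"
proof -
  show b: "band A (Word l)" and "Word l \<in> B" using band_lists_band[OF assms] by blast+
  note s = band_word[OF b]
  show "l \<noteq> []" "is_dir (hd l)" "\<not> is_dir (last l)" using s by simp_all
  show "is_string A (Word l)" using b unfolding band_def by blast
  have "is_string A (Word (seg (power_word l 0) (0 - 1) (0 + 1)))" by (rule Str_seg) (use s(5) in auto)
  moreover have "seg (power_word l 0) (0 - 1) (0 + 1) = [last l, hd l]"
    using power_word_last[of l 0] power_word_hd[of l 0] \<open>l \<noteq> []\<close> by (simp add: seg_def upt_rec)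
  ultimately show "composable (last l) (hd l)" unfolding composable_def by simp
qed

lemma weak_bridge_iff:
  "weak_bridge A B (WB b1 u b2) \<longleftrightarrow> (\<exists>l1\<in>band_lists. \<exists>l2\<in>band_lists. \<exists>us. b1 = Word l1 \<and> b2 = Word l2 \<and> u = mkstr l1 us \<and>
     is_string A (Word (l2 @ us @ l1)) \<and> band_free A u \<and> \<not> (l1 = l2 \<and> us = []))"
  (is "?l \<longleftrightarrow> ?r")
proof
  assume ?l
  then have w: "b1 \<in> B" "b2 \<in> B" "is_string A u" "band_free A u" "str_mult3 A b2 u b1 \<noteq> None"
    "\<not> (b1 = b2 \<and> u = Triv (str_tgt A b1) (str_eps A b1))" unfolding weak_bridge_def by auto
  define l1 l2 where "l1 = syls b1" and "l2 = syls b2"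
  have b: "b1 = Word l1" "b2 = Word l2" unfolding l1_def l2_def using band_word(1) rep_band w(1,2) by blast+
  have l: "l1 \<in> band_lists" "l2 \<in> band_lists" unfolding band_lists_def l1_def l2_def using w by auto
  show ?r
  proof (cases u)
    case (Triv v i)
    have "str_tgt A (Word l1) = v \<and> str_eps A (Word l1) = i"
      using w(5) unfolding str_mult3_def b Triv by (auto split: if_splits)
    then have vi: "v = syl_tgt A (hd l1)" "i = syl_eps A (hd l1)" by auto
    then have u: "u = mkstr l1 []" unfolding Triv mkstr_def by simp
    have "is_string A (Word (l2 @ l1))"
      using w(5) vi unfolding str_mult3_def b Triv by (auto split: if_splits)
    moreover have "l1 \<noteq> l2" using w(6) u b unfolding mkstr_def by auto
    ultimately show ?thesis using l b u w(4) by (intro bexI[of _ l1] bexI[of _ l2] exI[of _ "[]"]) auto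
  next
    case (Word us)
    have us: "us \<noteq> []" using w(3) Word by simp
    then have u: "u = mkstr l1 us" unfolding Word mkstr_def by simp
    have "is_string A (Word (l2 @ us @ l1))"
      using w(5) unfolding str_mult3_def b Word by (auto split: if_splits bind_splits)
    then show ?thesis using l b u w(4) us by (intro bexI[of _ l1] bexI[of _ l2] exI[of _ us]) auto
  qed
next
  assume ?r
  then obtain l1 l2 us where r: "l1 \<in> band_lists" "l2 \<in> band_lists" "b1 = Word l1" "b2 = Word l2" "u = mkstr l1 us"
    "is_string A (Word (l2 @ us @ l1))" "band_free A u" "\<not> (l1 = l2 \<and> us = [])" by blast
  have B: "b1 \<in> B" "b2 \<in> B" using band_lists_D(5) r by blast+
  show ?l
  proof (cases "us = []")
    case True
    have u: "u = Triv (syl_tgt A (hd l1)) (syl_eps A (hd l1))" using r(5) True unfolding mkstr_def by simp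
    have "hd l1 \<in> set l1" using band_lists_D(1)[OF r(1)] by simp
    then have "is_string A u" unfolding u by (intro is_string_triv) (use string_arc band_lists_D(7)[OF r(1)] in blast)
    moreover have "str_mult3 A b2 u b1 \<noteq> None" unfolding str_mult3_def u r(3,4) using r(6) True by simp
    ultimately show ?thesis unfolding weak_bridge_def using B r True by auto
  next
    case False
    have u: "u = Word us" using r(5) False unfolding mkstr_def by simp
    have "is_string A (Word us)" using string_sub[OF r(6) False] .
    moreover have "is_string A (Word (us @ l1))" using string_sub[of l2 "us @ l1" "[]"] r(6) False by simp
    ultimately have "str_mult3 A b2 u b1 \<noteq> None" "is_string A u"
      unfolding str_mult3_def u r(3,4) using r(6) by (simp_all del: is_string.simps)
    then show ?thesis unfolding weak_bridge_def using B r(7) u by simp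
  qed
qed

text \<open>The outer band copies have letters of both directions at their two ends, so no relation
  covers either copy. An occurrence in the bi-infinite word thus lies in a tail or in the finite
  string \<open>l2 @ us @ l1\<close>.\<close>

lemma string_wrd:
  assumes l: "l1 \<in> band_lists" "l2 \<in> band_lists" and s: "is_string A (Word (l2 @ us @ l1))"
  shows "W.Str (extended_word l2 us l1 p)" "seg (extended_word l2 us l1 p) p (p + int (length us)) = us"
    "seg (extended_word l2 us l1 p) (p - int (length l2)) (p + int (length us) + int (length l1)) = l2 @ us @ l1"
proof -
  define X where "X = extended_word l2 us l1 p"
  define p1 where "p1 = p + int (length us)"
  define lo hi where "lo = p - int (length l2)" and "hi = p1 + int (length l1)"
  have n: "int (length l1) > 0" "int (length l2) > 0" using band_lists_D(1) l by auto
  have le: "lo < p" "p \<le> p1" "p1 < hi" unfolding lo_def hi_def p1_def using n by auto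
  have Xl: "X i = power_word l2 p i" if "i < p" for i using that unfolding X_def extended_word_def by simp
  have Xr: "X i = power_word l1 p1 i" if "p1 \<le> i" for i using that unfolding X_def extended_word_def p1_def by simp
  have s1: "seg X p p1 = us" unfolding X_def p1_def by (rule nth_equalityI) (auto simp: extended_word_def)
  then show "seg (extended_word l2 us l1 p) p (p + int (length us)) = us" unfolding X_def p1_def .
  have cut: "power_word l2 p = power_word l2 lo" by (rule power_word_cong) (simp add: lo_def)
  have "seg X lo p = seg (power_word l2 lo) lo p" by (rule seg_cong) (simp add: Xl cut)
  also have "\<dots> = l2" using seg_pword[of l2 lo] unfolding lo_def by simp
  finally have s2: "seg X lo p = l2" .
  have "seg X p1 hi = seg (power_word l1 p1) p1 hi" by (rule seg_cong) (simp add: Xr)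
  also have "\<dots> = l1" unfolding hi_def by (rule seg_pword)
  finally have s3: "seg X p1 hi = l1" .
  have F: "seg X lo hi = l2 @ us @ l1"
  proof -
    have "seg X lo hi = seg X lo p @ seg X p p1 @ seg X p1 hi" using le by (simp add: seg_append)
    then show ?thesis using s1 s2 s3 by simp
  qed
  then show "seg (extended_word l2 us l1 p) (p - int (length l2)) (p + int (length us) + int (length l1)) = l2 @ us @ l1"
    unfolding X_def lo_def hi_def p1_def .
  note st = s[unfolded F[symmetric] is_string_iff]
  have S2: "W.Str (power_word l2 p)" and S1: "W.Str (power_word l1 p1)" using W.B_pw l W.periodic_Str by blast+
  have d2: "is_dir (X lo)" "\<not> is_dir (X (p - 1))"
    using W.cut_dirs(1)[OF l(2), of lo] W.cut_dirs(2)[OF l(2), of p] Xl[of lo] Xl[of "p - 1"] le cut by simp_all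
  have cut': "power_word l1 hi = power_word l1 p1" by (rule power_word_cong) (simp add: hi_def)
  have d1: "is_dir (X p1)" "\<not> is_dir (X (hi - 1))"
    using W.cut_dirs(1)[OF l(1), of p1] W.cut_dirs(2)[OF l(1), of hi] Xr[of p1] Xr[of "hi - 1"] le cut' by simp_all
  show "W.Str (extended_word l2 us l1 p)" unfolding X_def[symmetric] W.Str_def
  proof (intro conjI allI ballI notI)
    fix i
    consider "i + 1 < p" | "p1 \<le> i" | "p - 1 \<le> i" "i < p1" by linarith
    then show "composable (X i) (X (i + 1))"
    proof cases
      case 1 then show ?thesis using S2 Xl[of i] Xl[of "i + 1"] unfolding W.Str_def by simp
    next
      case 2 then show ?thesis using S1 Xr[of i] Xr[of "i + 1"] unfolding W.Str_def by simp
    next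
      case 3
      define k where "k = nat (i - lo)"
      have k: "Suc k < nat (hi - lo)" "i = lo + int k" unfolding k_def using 3 le by auto
      have "composable (seg X lo hi ! k) (seg X lo hi ! Suc k)"
        using st k(1) unfolding successively_conv_nth length_seg by blast
      then show ?thesis using k Suc_lessD[OF k(1)] by (simp add: algebra_simps)
    qed
  next
    fix r i assume r: "r \<in> rel_words" and oc: "\<forall>k<length r. X (i + int k) = r ! k"
    define e where "e = i + int (length r)"
    have inr: "X j \<in> set r" if "i \<le> j" "j < e" for j
    proof -
      have "nat (j - i) < length r" using that unfolding e_def by linarith
      then have "X (i + int (nat (j - i))) \<in> set r" using oc by (metis nth_mem)
      then show ?thesis using that by simp
    qed
    have same: "is_dir (X j) = is_dir (X k)" if "i \<le> j" "j < e" "i \<le> k" "k < e" for j k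
      by (rule rel_words_mono[OF r]) (use inr that in auto)
    consider "e \<le> p" | "p1 \<le> i" | "i \<le> lo" "p < e" | "hi \<le> e" "i < p1" | "lo < i" "e < hi" "i < p1" "p < e" by linarith
    then show False
    proof cases
      case 1
      then have "\<forall>k<length r. power_word l2 p (i + int k) = r ! k" using oc Xl unfolding e_def by simp
      then show False using S2 r unfolding W.Str_def by blast
    next
      case 2
      then have "\<forall>k<length r. power_word l1 p1 (i + int k) = r ! k" using oc Xr by simp
      then show False using S1 r unfolding W.Str_def by blast
    next
      case 3 then show False using same[of lo "p - 1"] d2 le by simp
    next
      case 4 then show False using same[of p1 "hi - 1"] d1 le by simp
    next
      case 5
      have "lo \<le> hi" using le by simp
      then have "sublist r (seg X lo hi)" unfolding sublist_seg_iff[OF \<open>lo \<le> hi\<close>]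
        using oc 5 unfolding e_def by (intro exI[of _ i]) auto
      then show False using st r by blast
    qed
  qed
qed

text \<open>Band-freeness concerns all bands and their rotations, \<open>free\<close> only the
  representatives. Each rotation of a band is a window of the power word of a representative, of the
  same length.\<close>

lemma band_free_iff:
  assumes "p2 \<le> p1"
  shows "band_free A (mkstr l (seg X p2 p1)) \<longleftrightarrow> W.free X p2 p1"
proof
  assume bf: "band_free A (mkstr l (seg X p2 p1))"
  show "W.free X p2 p1" unfolding W.free_def
  proof (intro ballI allI impI notI)
    fix b s g
    assume b: "b \<in> band_lists" "p2 \<le> g" "g + int (length b) \<le> p1"
      and win: "\<forall>i. g \<le> i \<and> i < g + int (length b) \<longrightarrow> X i = power_word b s i"
    obtain k where k: "seg (power_word b s) g (g + int (length b)) = rotate k b"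
      using seg_pword_rotate[OF band_lists_D(1)[OF b(1)]] by blast
    have "sublist (rotate k b) (seg X p2 p1)"
      unfolding k[symmetric] sublist_seg_iff[OF assms] using b win by (intro exI[of _ g]) auto
    moreover have "cyclic_perm (Word (rotate k b) :: ('v, 'a) str) (Word b)" unfolding cyclic_perm_def by blast
    ultimately show False using bf band_lists_D(6)[OF b(1)] unfolding band_free_def by fastforce
  qed
next
  assume fr: "W.free X p2 p1"
  show "band_free A (mkstr l (seg X p2 p1))" unfolding band_free_def
  proof (rule notI, elim exE conjE)
    fix b b'
    assume b: "band A b" "cyclic_perm b' b" "sublist (syls b') (syls (mkstr l (seg X p2 p1)))"
    obtain k xs where k: "b = Word xs" "b' = Word (rotate k xs)" using b(2) unfolding cyclic_perm_def by blast
    have "W.Str (power_word xs 0)" using band_word(5)[OF b(1)] k by simp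
    moreover have "xs \<noteq> []" using band_word(2)[OF b(1)] k by simp
    ultimately have "W.periodic (power_word xs 0)" unfolding W.periodic_def using power_word_period by (intro conjI exI[of _ "int (length xs)"]) auto
    then obtain m q where m: "m \<in> band_lists" "power_word xs 0 = power_word m q" using W.B_rep by blast
    have len: "length xs = length m"
      using band_length_unique[OF b(1) band_lists_D(6)[OF m(1)], of 0 q] m(2) k by simp
    have rot: "rotate k xs = seg (power_word m q) (int k) (int k + int (length m))"
      using rotate_seg[of k xs] m(2) len by simp
    obtain a where a: "p2 \<le> a" "a + int (length m) \<le> p1"
      "\<forall>j<length m. X (a + int j) = rotate k xs ! j"
      using b(3) len unfolding k syls.simps syls_mkstr sublist_seg_iff[OF assms] by auto
    have "X i = power_word m (q + a - int k) i" if "a \<le> i" "i < a + int (length m)" for i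
    proof -
      have j: "nat (i - a) < length m" using that by linarith
      then have "X (a + int (nat (i - a))) = power_word m q (int k + int (nat (i - a)))"
        using a(3)[rule_format, OF j] unfolding rot by simp
      then show ?thesis using that by (simp add: power_word_def algebra_simps)
    qed
    then show False by (rule W.freeD[OF fr m(1) a(1,2)])
  qed
qed

lemma weak_bridge_rep:
  assumes "weak_bridge A B w"
  shows "syls (wb_src w) \<in> band_lists" "syls (wb_tgt w) \<in> band_lists"
    "wb_src w = Word (syls (wb_src w))" "wb_tgt w = Word (syls (wb_tgt w))"
    "wb_str w = mkstr (syls (wb_src w)) (syls (wb_str w))"
    "is_string A (Word (full_word w))"
    "\<exists>X p2 p1. W.bridge_word_of X p2 p1 (syls (wb_tgt w)) (syls (wb_str w)) (syls (wb_src w))"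
proof -
  obtain b1 u b2 where w: "w = WB b1 u b2" by (cases w)
  obtain l1 l2 us where l: "l1 \<in> band_lists" "l2 \<in> band_lists" and e: "b1 = Word l1" "b2 = Word l2" "u = mkstr l1 us"
    and s: "is_string A (Word (l2 @ us @ l1))" and bf: "band_free A u" and nt: "\<not> (l1 = l2 \<and> us = [])"
    using assms unfolding w weak_bridge_iff by blast
  show "syls (wb_src w) \<in> band_lists" "syls (wb_tgt w) \<in> band_lists"
    "wb_src w = Word (syls (wb_src w))" "wb_tgt w = Word (syls (wb_tgt w))"
    "wb_str w = mkstr (syls (wb_src w)) (syls (wb_str w))" "is_string A (Word (full_word w))"
    using l e s unfolding w full_word_def by simp_all
  define X where "X = extended_word l2 us l1 0"
  define n where "n = int (length us)"
  have sw: "W.Str X" "seg X 0 n = us" using string_wrd(1,2)[OF l s, of 0] unfolding X_def n_def by simp_all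
  have "W.free X 0 n" using bf band_free_iff[of 0 n l1 X] sw(2) unfolding e n_def by simp
  moreover have "X i = power_word l2 0 i" if "i < 0" for i using that unfolding X_def extended_word_def by simp
  moreover have "X i = power_word l1 n i" if "n \<le> i" for i using that unfolding X_def extended_word_def n_def by simp
  moreover have "\<not> (l1 = l2 \<and> n = 0)" using nt unfolding n_def by simp
  ultimately have "W.bridge_word X 0 n l2 l1" unfolding W.bridge_word_def using l sw unfolding n_def by auto
  then show "\<exists>X p2 p1. W.bridge_word_of X p2 p1 (syls (wb_tgt w)) (syls (wb_str w)) (syls (wb_src w))"
    unfolding W.bridge_word_of_def w using e sw(2) by auto
qed

lemma bridge_word_of_seg:
  assumes "W.bridge_word_of X p2 p1 l2 us l1"
  shows "seg X (p2 - int (length l2)) (p1 + int (length l1)) = l2 @ us @ l1"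
    "l1 \<in> band_lists" "l2 \<in> band_lists" "is_string A (Word (l2 @ us @ l1))"
proof -
  note w = assms[unfolded W.bridge_word_of_def]
  note wD = W.wbrepD[OF w[THEN conjunct1]]
  show l: "l1 \<in> band_lists" "l2 \<in> band_lists" by (rule wD)+
  have cut: "power_word l2 p2 = power_word l2 (p2 - int (length l2))" by (rule power_word_cong) simp
  have "seg X (p2 - int (length l2)) p2 = seg (power_word l2 (p2 - int (length l2))) (p2 - int (length l2)) p2"
    by (rule seg_cong) (simp add: wD(5) cut)
  also have "\<dots> = l2" using seg_pword[of l2 "p2 - int (length l2)"] by simp
  finally have s2: "seg X (p2 - int (length l2)) p2 = l2" .
  have "seg X p1 (p1 + int (length l1)) = seg (power_word l1 p1) p1 (p1 + int (length l1))"
    by (rule seg_cong) (simp add: wD(6))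
  also have "\<dots> = l1" by (rule seg_pword)
  finally have s3: "seg X p1 (p1 + int (length l1)) = l1" .
  have "seg X (p2 - int (length l2)) (p1 + int (length l1)) =
    seg X (p2 - int (length l2)) p2 @ seg X p2 p1 @ seg X p1 (p1 + int (length l1))"
    using wD(4) by (simp add: seg_append)
  then show e: "seg X (p2 - int (length l2)) (p1 + int (length l1)) = l2 @ us @ l1"
    using s2 s3 w by simp
  have "p2 - int (length l2) < p1 + int (length l1)" using wD(4) W.len_pos l by (smt (verit))
  then show "is_string A (Word (l2 @ us @ l1))" unfolding e[symmetric] by (rule Str_seg[OF wD(3)])
qed

lemma bridge_word_of_weak_bridge:
  assumes "W.bridge_word_of X p2 p1 l2 us l1"
  shows "weak_bridge A B (WB (Word l1) (mkstr l1 us) (Word l2))"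
proof -
  note w = assms[unfolded W.bridge_word_of_def]
  note wD = W.wbrepD[OF w[THEN conjunct1]]
  have us: "us = seg X p2 p1" using w by blast
  have "band_free A (mkstr l1 us)" unfolding us band_free_iff[OF wD(4)] by (rule wD(7))
  moreover have "\<not> (l1 = l2 \<and> us = [])" using W.bridge_word_bands_neq[OF w[THEN conjunct1]] by simp
  ultimately show ?thesis unfolding weak_bridge_iff using bridge_word_of_seg[OF assms] by blast
qed

end

section \<open>Factorizations into bridges\<close>

context presented begin

lemma weak_bridge_eqI:
  assumes "weak_bridge A B w" "weak_bridge A B w'" "syls (wb_src w) = syls (wb_src w')"
    "syls (wb_str w) = syls (wb_str w')" "syls (wb_tgt w) = syls (wb_tgt w')"
  shows "w = w'"
  using weak_bridge_rep(3-5)[OF assms(1)] weak_bridge_rep(3-5)[OF assms(2)] assms(3-5)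
  by (cases w; cases w') auto

section \<open>Compositions of weak bridges in terms of lists\<close>

lemma comp_lists:
  assumes "is_comp A B u' v w" and b: "b = syls (wb_tgt v)"
  shows "syls (wb_str w) = syls (wb_str u') @ syls (wb_str v) \<or>
    (\<exists>x y s. syls (wb_str u') @ syls (wb_str v) = y @ seg (power_word b s) 0 (int (length b)) @ x \<and>
       syls (wb_str w) = y @ x)"
proof -
  obtain z where z: "str_mult A (wb_str u') (wb_str v) = Some z"
    "wb_str w = z \<or> band_count (wb_tgt v) z = 1 \<and> band_removal A (wb_tgt v) z (wb_str w)"
    using assms(1) unfolding is_comp_def by blast
  have zl: "syls z = syls (wb_str u') @ syls (wb_str v)" by (rule syls_str_mult[OF z(1)])
  from z(2) show ?thesis
  proof
    assume "wb_str w = z" then show ?thesis using zl by simp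
  next
    assume "band_count (wb_tgt v) z = 1 \<and> band_removal A (wb_tgt v) z (wb_str w)"
    then obtain y1 y2 b' where r: "cyclic_perm b' (wb_tgt v)" "str_mult3 A y2 b' y1 = Some z"
      "str_mult A y2 y1 = Some (wb_str w)" unfolding band_removal_def by blast
    obtain k xs where k: "wb_tgt v = Word xs" "b' = Word (rotate k xs)" using r(1) unfolding cyclic_perm_def by blast
    have bx: "b = xs" using b k by simp
    obtain t where t: "str_mult A b' y1 = Some t" "str_mult A y2 t = Some z"
      using r(2) unfolding str_mult3_def by (auto split: bind_splits)
    have "syls z = syls y2 @ rotate k b @ syls y1"
      using syls_str_mult[OF t(1)] syls_str_mult[OF t(2)] k bx by simp
    moreover have "rotate k b = seg (power_word b (- int k)) 0 (int (length b))"
    proof -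
      have "rotate k b = seg (power_word b 0) (0 + int k) (int (length b) + int k)"
        unfolding rotate_seg by (simp add: add.commute)
      also have "\<dots> = seg (\<lambda>i. power_word b 0 (i + int k)) 0 (int (length b))" by (rule seg_shift[symmetric])
      finally show ?thesis by (simp add: power_word_shift)
    qed
    ultimately show ?thesis using zl syls_str_mult[OF r(3)] by (metis)
  qed
qed

lemma string_prefix: "is_string A (Word (xs @ ys)) \<Longrightarrow> xs \<noteq> [] \<Longrightarrow> is_string A (Word xs)"
  using string_sub[of "[]" xs ys] by simp

lemma string_suffix: "is_string A (Word (xs @ ys)) \<Longrightarrow> ys \<noteq> [] \<Longrightarrow> is_string A (Word ys)"
  using string_sub[of xs ys "[]"] by simp

lemma string_mkstr:
  assumes "l \<noteq> []" "is_string A (Word l)" "us = [] \<or> is_string A (Word us)"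
  shows "is_string A (mkstr l us)"
proof (cases "us = []")
  case True
  have "arrow (hd l) \<in> arcs (quiver A)" using string_arc[OF assms(2)] assms(1) by simp
  then show ?thesis using True is_string_triv unfolding mkstr_def by simp
next
  case False then show ?thesis using assms(3) unfolding mkstr_def by simp
qed

text \<open>A product with a length-0 string is defined only if vertex and sign match. A syllable
  that may stand to the left of both words forces this, by
  \<open>composable_same_target\<close>.\<close>

lemma mkstr_mult:
  assumes "b \<noteq> []" "l \<noteq> []"
    and "us = [] \<Longrightarrow> vs = [] \<Longrightarrow> \<exists>a. composable a (hd b) \<and> composable a (hd l)"
    and "us = [] \<Longrightarrow> vs \<noteq> [] \<Longrightarrow> \<exists>a. composable a (hd b) \<and> composable a (hd vs)"
    and "us \<noteq> [] \<Longrightarrow> vs = [] \<Longrightarrow> composable (last us) (hd l)"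
    and "us \<noteq> [] \<Longrightarrow> vs \<noteq> [] \<Longrightarrow> is_string A (Word (us @ vs))"
  shows "str_mult A (mkstr b us) (mkstr l vs) = Some (mkstr l (us @ vs))"
proof -
  consider "us = []" "vs = []" | "us = []" "vs \<noteq> []" | "us \<noteq> []" "vs = []" | "us \<noteq> []" "vs \<noteq> []" by blast
  then show ?thesis
  proof cases
    case 1
    then obtain a where "composable a (hd b)" "composable a (hd l)" using assms(3) by blast
    then have "syl_tgt A (hd b) = syl_tgt A (hd l)" "syl_eps A (hd b) = syl_eps A (hd l)"
      by (rule composable_same_target)+
    then show ?thesis using 1 unfolding mkstr_def by simp
  next
    case 2
    then obtain a where "composable a (hd b)" "composable a (hd vs)" using assms(4) by blast
    then have "syl_tgt A (hd b) = syl_tgt A (hd vs)" "syl_eps A (hd b) = syl_eps A (hd vs)"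
      by (rule composable_same_target)+
    then show ?thesis using 2 unfolding mkstr_def by simp
  next
    case 3
    then have "composable (last us) (hd l)" using assms(5) by blast
    then have "syl_src A (last us) = syl_tgt A (hd l)" "syl_sig A (last us) = - syl_eps A (hd l)"
      by (rule composable_src)+
    then show ?thesis using 3 unfolding mkstr_def by simp
  next
    case 4
    then have "is_string A (Word (us @ vs))" using assms(6) by blast
    then show ?thesis using 4 unfolding mkstr_def by (simp del: is_string.simps)
  qed
qed

lemma factors_not_bridge:
  assumes w: "W.bridge_word_of X p2 p1 l2 us l1" and f: "W.factors X p2 p1 l2 l1"
  shows "\<not> bridge A B (WB (Word l1) (mkstr l1 us) (Word l2))"
proof -
  define u where "u = WB (Word l1) (mkstr l1 us) (Word l2)"
  have wu: "weak_bridge A B u" unfolding u_def by (rule bridge_word_of_weak_bridge[OF w])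
  have us: "us = seg X p2 p1" using w unfolding W.bridge_word_of_def by blast
  obtain b V U c c' where b: "b \<in> band_lists" and V: "W.bridge_word V c p1 b l1" and U: "W.bridge_word U p2 c' l2 b"
    and fac: "seg X p2 p1 = seg U p2 c' @ seg V c p1 \<or>
      (\<exists>x y r s. seg X p2 p1 = y @ x \<and>
         seg U p2 c' @ seg V c p1 = y @ seg (power_word b s) r (r + int (length b)) @ x \<and>
         (\<exists>Z. W.Str Z \<and> seg Z p2 (p1 + int (length b)) = seg U p2 c' @ seg V c p1 \<and>
            Z (p1 + int (length b)) = hd l1) \<and>
         (\<forall>s' g. \<not> sublist (seg (power_word b s') g (g + 2 * int (length b))) (seg U p2 c' @ seg V c p1)))"
    using f unfolding W.factors_def by blast
  define vs where "vs = seg V c p1"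
  define ts where "ts = seg U p2 c'"
  have Vr: "W.bridge_word_of V c p1 b vs l1" and Ur: "W.bridge_word_of U p2 c' l2 ts b"
    using V U unfolding W.bridge_word_of_def vs_def ts_def by auto
  define v where "v = WB (Word l1) (mkstr l1 vs) (Word b)"
  define t where "t = WB (Word b) (mkstr b ts) (Word l2)"
  have wv: "weak_bridge A B v" and wt: "weak_bridge A B t"
    unfolding v_def t_def by (rule bridge_word_of_weak_bridge[OF Vr] bridge_word_of_weak_bridge[OF Ur])+
  have l1: "l1 \<in> band_lists" and l2: "l2 \<in> band_lists" using bridge_word_of_seg[OF w] by blast+
  have sV: "is_string A (Word (b @ vs @ l1))" and sU: "is_string A (Word (l2 @ ts @ b))"
    using bridge_word_of_seg[OF Vr] bridge_word_of_seg[OF Ur] by blast+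
  have sX: "is_string A (Word (l2 @ us @ l1))" using bridge_word_of_seg[OF w] by blast
  have ne: "b \<noteq> []" "l1 \<noteq> []" "l2 \<noteq> []" using band_lists_D(1) b l1 l2 by blast+
  define ys where "ys = ts @ vs"
  have jV: "composable (last b) (hd (vs @ l1))" by (rule junction[OF sV]) (use ne in auto)
  have jb: "composable (last b) (hd b)" by (rule band_lists_D(4)[OF b])
  have jU: "composable (last ts) (hd b)" if "ts \<noteq> []"
    using junction[of "l2 @ ts" b] sU ne that by simp
  have mult: "str_mult A (mkstr b ts) (mkstr l1 vs) = Some (mkstr l1 ys)"
    if ys: "ys \<noteq> [] \<Longrightarrow> is_string A (Word ys)"
    unfolding ys_def
  proof (rule mkstr_mult[OF ne(1,2)])
    show "\<exists>a. composable a (hd b) \<and> composable a (hd l1)" if "ts = []" "vs = []" using jV jb that by auto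
    show "\<exists>a. composable a (hd b) \<and> composable a (hd vs)" if "ts = []" "vs \<noteq> []" using jV jb that by auto
    show "composable (last ts) (hd l1)" if "ts \<noteq> []" "vs = []"
    proof -
      have "composable (last b) (hd l1)" using jV that by simp
      note e = composable_same_target[OF this jb]
      \<comment> \<open>With v empty, both bands may follow on the right of \<open>last b\<close>,
        and both heads are direct; hence they are the same syllable.\<close>
      have "hd l1 = hd b"
      proof (rule syl_eq_tgt)
        show "arrow (hd l1) \<in> arcs (quiver A)" "arrow (hd b) \<in> arcs (quiver A)"
          using \<open>composable (last b) (hd l1)\<close> jb unfolding composable_iff by blast+
        show "is_dir (hd l1) = is_dir (hd b)" using band_lists_D(2) l1 b by simp
      qed (rule e)+
      then show ?thesis using jU that by simp
    qed
    show "is_string A (Word (ts @ vs))" if "ts \<noteq> []" using ys that unfolding ys_def by simp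
  qed
  have "is_comp A B t v u"
  proof (cases "us = ys")
    case True
    have m: "str_mult A (mkstr b ts) (mkstr l1 vs) = Some (mkstr l1 ys)"
      by (rule mult) (use sX string_sub True in blast)
    show ?thesis unfolding is_comp_def using wv wt wu m True unfolding u_def v_def t_def by auto
  next
    case False
    then obtain xl yl r s Z where e: "us = yl @ xl" "ys = yl @ seg (power_word b s) r (r + int (length b)) @ xl"
      and Z: "W.Str Z" "seg Z p2 (p1 + int (length b)) = ys" "Z (p1 + int (length b)) = hd l1"
      and nd: "\<And>s' g. \<not> sublist (seg (power_word b s') g (g + 2 * int (length b))) ys"
      using fac unfolding us ys_def ts_def vs_def by blast
    define n where "n = int (length b)"
    define m where "m = seg (power_word b s) r (r + n)"
    have n: "n > 0" unfolding n_def using ne by simp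
    have mne: "m \<noteq> []" unfolding m_def using n by (simp add: seg_def)
    have eys: "ys = yl @ m @ xl" using e(2) unfolding m_def n_def .
    obtain k where k: "m = rotate k b" unfolding m_def n_def using seg_pword_rotate[OF ne(1)] by blast
    have pb: "W.Str (power_word b s)" using W.B_pw[OF b] W.periodic_Str by blast
    have jm: "composable (last m) (hd m)"
    proof -
      have "is_string A (Word (seg (power_word b s) r (r + n + n)))" by (rule Str_seg[OF pb]) (use n in simp)
      moreover have "seg (power_word b s) r (r + n + n) = m @ seg (power_word b s) (r + n) (r + n + n)"
        unfolding m_def using n by (simp add: seg_append)
      moreover have "seg (power_word b s) (r + n) (r + n + n) = m"
        using seg_shift[of "power_word b s" n r "r + n"] power_word_period[of b s] unfolding m_def n_def by simp
      ultimately show ?thesis using junction mne by metis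
    qed
    have yne: "ys \<noteq> []" using eys mne by simp
    have p21: "p2 < p1 + n" using W.wbrepD(4) w n unfolding W.bridge_word_of_def by fastforce
    \<comment> \<open>The word Z lets the product be followed by \<open>hd l1\<close> on its right.
      If xl is empty, this syllable shows that the deleted copy matches the length-0 string next to
      it.\<close>
    have sysl: "is_string A (Word (ys @ [hd l1]))"
    proof -
      have "is_string A (Word (seg Z p2 (p1 + n + 1)))" by (rule Str_seg[OF Z(1)]) (use p21 in simp)
      moreover have "seg Z p2 (p1 + n + 1) = seg Z p2 (p1 + n) @ seg Z (p1 + n) (p1 + n + 1)"
        using p21 by (simp add: seg_append)
      moreover have "seg Z (p1 + n) (p1 + n + 1) = [hd l1]" using Z(3) unfolding n_def by (simp add: seg_def)
      ultimately show ?thesis using Z(2) unfolding n_def by simp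
    qed
    have sys: "is_string A (Word ys)" by (rule string_prefix[OF sysl yne])
    have smx: "is_string A (Word (m @ xl))" by (rule string_suffix[of yl]) (use sys eys mne in simp_all)
    have sm: "is_string A (Word m)" by (rule string_prefix[OF smx mne])
    have jx: "composable (last m) (hd (xl @ [hd l1]))"
      using junction[of "yl @ m" "xl @ [hd l1]"] sysl eys mne by simp
    have M: "str_mult A (mkstr b ts) (mkstr l1 vs) = Some (mkstr l1 ys)" by (rule mult[OF sys])
    have mm: "Word m = mkstr b m" using mne unfolding mkstr_def by simp
    have M1: "str_mult A (Word m) (mkstr l1 xl) = Some (mkstr l1 (m @ xl))"
      unfolding mm by (rule mkstr_mult[OF ne(1,2)]) (use mne jx smx in auto)
    \<comment> \<open>If yl is empty, its label comes from the deleted copy m, which stands on its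
      right.\<close>
    have M2: "str_mult A (mkstr m yl) (mkstr l1 (m @ xl)) = Some (mkstr l1 ys)"
      unfolding eys by (rule mkstr_mult[OF mne ne(2)]) (use mne jm sys eys in auto)
    have M3: "str_mult A (mkstr m yl) (mkstr l1 xl) = Some (mkstr l1 us)"
      unfolding e(1)
    proof (rule mkstr_mult[OF mne ne(2)])
      show "\<exists>a. composable a (hd m) \<and> composable a (hd l1)" if "yl = []" "xl = []" using jm jx that by auto
      show "\<exists>a. composable a (hd m) \<and> composable a (hd xl)" if "yl = []" "xl \<noteq> []" using jm jx that by auto
      show "composable (last yl) (hd l1)" if "yl \<noteq> []" "xl = []"
        using junction[of "l2 @ us" l1] sX e(1) ne that by simp
      show "is_string A (Word (yl @ xl))" if "yl \<noteq> []" "xl \<noteq> []"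
        using string_sub[OF sX] e(1) that by simp
    qed
    have cp: "cyclic_perm (Word m :: ('v, 'a) str) (Word b)" unfolding cyclic_perm_def k by blast
    have "band_removal A (Word b) (mkstr l1 ys) (mkstr l1 us)" unfolding band_removal_def
    proof (intro exI conjI)
      show "is_string A (mkstr l1 xl)"
        by (rule string_mkstr[OF ne(2) band_lists_D(7)[OF l1]]) (use string_suffix[OF smx] in blast)
      show "is_string A (mkstr m yl)"
        by (rule string_mkstr[OF mne sm]) (use sys eys string_prefix in blast)
      show "cyclic_perm (Word m :: ('v, 'a) str) (Word b)" by (rule cp)
      show "str_mult3 A (mkstr m yl) (Word m) (mkstr l1 xl) = Some (mkstr l1 ys)"
        unfolding str_mult3_def M1 using M2 by simp
    qed (rule M3)
    moreover have "band_count (Word b :: ('v, 'a) str) (mkstr l1 ys) = 1"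
    proof -
      define S where "S = {k. \<exists>b'. cyclic_perm b' (Word b :: ('v, 'a) str) \<and> sublist (list_pow (syls b') k) ys}"
      have le: "k \<le> 1" if k: "k \<in> S" for k
      proof (rule ccontr)
        assume "\<not> k \<le> 1"
        obtain b' where b': "cyclic_perm b' (Word b :: ('v, 'a) str)" "sublist (list_pow (syls b') k) ys"
          using k unfolding S_def by blast
        obtain j where j: "b' = Word (rotate j b)" using b'(1) unfolding cyclic_perm_def by blast
        define K where "K = int k * n"
        have K: "2 * n \<le> K" unfolding K_def using \<open>\<not> k \<le> 1\<close> n by (intro mult_right_mono) auto
        have "list_pow (rotate j b) k = seg (power_word b (0 - int j)) 0 K"
          unfolding list_pow_seg power_word_rotate[OF ne(1)] K_def n_def by simp
        also have "\<dots> = seg (power_word b (0 - int j)) 0 (0 + 2 * n) @ seg (power_word b (0 - int j)) (0 + 2 * n) K"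
          using K n by (intro seg_append[symmetric]) auto
        finally have "sublist (seg (power_word b (0 - int j)) 0 (0 + 2 * n)) (list_pow (rotate j b) k)" by simp
        then have "sublist (seg (power_word b (0 - int j)) 0 (0 + 2 * n)) ys"
          using b'(2) j sublist_order.order.trans by simp
        then show False using nd unfolding n_def by blast
      qed
      have one: "1 \<in> S" unfolding S_def
      proof (intro CollectI exI conjI)
        show "cyclic_perm (Word m :: ('v, 'a) str) (Word b)" by (rule cp)
        show "sublist (list_pow (syls (Word m :: ('v, 'a) str)) 1) ys"
          unfolding eys by (simp add: list_pow_def)
      qed
      have "S \<subseteq> {0, 1}" using le by (auto simp: le_Suc_eq)
      then have "finite S" by (rule finite_subset) simp
      then have "Max S = 1" using le one by (intro Max_eqI) auto
      then show ?thesis unfolding band_count_def S_def by simp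
    qed
    ultimately show ?thesis unfolding is_comp_def using wv wt wu M unfolding u_def v_def t_def by auto
  qed
  then show ?thesis unfolding bridge_def u_def[symmetric] using wv wt by blast
qed

text \<open>The exit is the letter at \<open>e1 - 1\<close>, next to the right tail, and the entry
  is the letter at f2, next to the left tail. Abnormality thus means e1 \<le> f2: the two tails
  cover the word, which is a single splice.\<close>

lemma abnormal_splits:
  assumes w: "W.bridge_word_of X p2 p1 (syls (wb_tgt w)) (syls (wb_str w)) (syls (wb_src w))"
    and ab: "abnormal_weak_bridge w"
  shows "\<exists>q. X = join q (power_word (syls (wb_tgt w)) p2) (power_word (syls (wb_src w)) p1)"
proof -
  define l1 l2 us where "l1 = syls (wb_src w)" and "l2 = syls (wb_tgt w)" and "us = syls (wb_str w)"
  have w: "W.bridge_word_of X p2 p1 l2 us l1" using w unfolding l1_def l2_def us_def .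
  note wr = w[unfolded W.bridge_word_of_def, THEN conjunct1]
  note wD = W.wbrepD[OF wr]
  define R Lf where "R = power_word l1 p1" and "Lf = power_word l2 p2"
  have R: "W.periodic R" and Lf: "W.periodic Lf" unfolding R_def Lf_def using W.B_pw wD by blast+
  have neq: "Lf \<noteq> R" unfolding R_def Lf_def by (rule W.bridge_word_tails_neq[OF wr])
  have XR: "X i = R i" if "p1 \<le> i" for i using wD(6) that unfolding R_def .
  have XL: "X i = Lf i" if "i < p2" for i using wD(5) that unfolding Lf_def .
  define n1 n2 where "n1 = int (length l1)" and "n2 = int (length l2)"
  have n: "n1 > 0" "n2 > 0" unfolding n1_def n2_def using W.len_pos wD by blast+
  define lo hi where "lo = p2 - n2" and "hi = p1 + n1"
  have le: "lo < p2" "p2 \<le> p1" "p1 < hi" unfolding lo_def hi_def using n wD(4) by auto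
  have full: "full_word w = seg X lo hi"
    using bridge_word_of_seg(1)[OF w] unfolding full_word_def lo_def hi_def n1_def n2_def l1_def l2_def us_def by simp
  obtain e1 where e1: "e1 \<le> p1" "\<forall>i\<ge>e1. X i = R i" "X (e1 - 1) \<noteq> R (e1 - 1)"
    unfolding R_def by (rule W.exact_right[OF W.bridge_word_neq_right[OF wr] wD(6)])
  obtain f2 where f2: "p2 \<le> f2" "\<forall>i<f2. X i = Lf i" "X f2 \<noteq> Lf f2"
    unfolding Lf_def by (rule W.exact_left[OF W.bridge_word_neq_left[OF wr] wD(5)])
  have cut2: "Lf = power_word l2 lo" unfolding Lf_def by (rule power_word_cong) (simp add: lo_def n2_def)
  have cut1: "R = power_word l1 hi" unfolding R_def by (rule power_word_cong) (simp add: hi_def n1_def)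
  have dL: "is_dir (Lf lo) \<noteq> is_dir (Lf (p2 - 1))"
    using W.cut_dirs(1)[OF wD(2), of lo] W.cut_dirs(2)[OF wD(2), of p2] cut2 unfolding Lf_def by simp
  have dR: "is_dir (R p1) \<noteq> is_dir (R (hi - 1))"
    using W.cut_dirs(1)[OF wD(1), of p1] W.cut_dirs(2)[OF wD(1), of hi] cut1 unfolding R_def by simp
  \<comment> \<open>The exit lies in the finite word. Otherwise the right tail would cover the whole
    copy of the target band, where the left tail turns.\<close>
  have lo_e1: "lo < e1"
  proof (rule ccontr)
    assume "\<not> lo < e1"
    have "Lf = R"
    proof (intro W.agree_turn[OF Lf R _ _ dL])
      show "Lf i = R i" if "lo \<le> i" "i \<le> p2 - 1" for i
        using XL[of i] e1(2)[rule_format, of i] that \<open>\<not> lo < e1\<close> by simp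
    qed (use le in simp)
    then show False using neq by simp
  qed
  have f2_hi: "f2 < hi"
  proof (rule ccontr)
    assume "\<not> f2 < hi"
    have "R = Lf"
    proof (intro W.agree_turn[OF R Lf _ _ dR])
      show "R i = Lf i" if "p1 \<le> i" "i \<le> hi - 1" for i
        using XR[of i] f2(2)[rule_format, of i] that \<open>\<not> f2 < hi\<close> by simp
    qed (use le in simp)
    then show False using neq by simp
  qed
  have lenF: "int (length (full_word w)) = hi - lo" unfolding full using le by simp
  \<comment> \<open>\<open>initial_part w k\<close> is the stretch from \<open>p1 - k\<close> to hi.
    It contains a full copy of the source band, hence both directions, so lying in a power of the
    band fixes the phase. This first fails when the stretch includes \<open>e1 - 1\<close>.\<close>
  have idx1: "exit_index w = nat (p1 - e1) + 1"
    unfolding exit_index_def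
  proof (rule Least_equality)
    define K where "K = nat (p1 - e1) + 1"
    have K: "int K = p1 - e1 + 1" unfolding K_def using e1(1) by simp
    have part: "initial_part w k = seg X (p1 - int k) hi" if "n1 + int k \<le> hi - lo" for k
    proof -
      have "length (full_word w) - (length l1 + k) = nat (p1 - int k - lo)"
        using lenF that unfolding hi_def n1_def by linarith
      moreover have "seg X lo hi = seg X lo (p1 - int k) @ seg X (p1 - int k) hi"
        using that le n unfolding hi_def by (simp add: seg_append)
      ultimately show ?thesis unfolding initial_part_def Let_def l1_def[symmetric] full
        using that le unfolding hi_def by simp
    qed
    show "1 \<le> nat (p1 - e1) + 1 \<and> length (syls (wb_src w)) + (nat (p1 - e1) + 1) \<le> length (full_word w) \<and>
      \<not> (\<exists>m. sublist (initial_part w (nat (p1 - e1) + 1)) (list_pow (syls (wb_src w)) m))"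
      unfolding K_def[symmetric] l1_def[symmetric]
    proof (intro conjI notI)
      show "1 \<le> K" unfolding K_def by simp
      have b: "n1 + int K \<le> hi - lo" unfolding K hi_def using lo_e1 by simp
      then show "length l1 + K \<le> length (full_word w)" using lenF unfolding n1_def by linarith
      assume "\<exists>m. sublist (initial_part w K) (list_pow l1 m)"
      then obtain m where m: "sublist (seg X (e1 - 1) hi) (list_pow l1 m)"
        unfolding part[OF b] K by auto
      obtain s where s: "\<And>i. e1 - 1 \<le> i \<Longrightarrow> i < hi \<Longrightarrow> X i = power_word l1 s i"
        by (rule list_pow_sub_word[OF m]) (use e1(1) le in auto)
      have "R = power_word l1 s"
      proof (rule W.agree_turn[OF R W.B_pw[OF wD(1)] _ _ dR])
        show "R i = power_word l1 s i" if "p1 \<le> i" "i \<le> hi - 1" for i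
          using s[of i] XR[of i] that e1(1) by simp
      qed (use le in simp)
      then show False using s[of "e1 - 1"] e1(1,3) le by simp
    qed
    fix k assume k: "1 \<le> k \<and> length (syls (wb_src w)) + k \<le> length (full_word w) \<and>
      \<not> (\<exists>m. sublist (initial_part w k) (list_pow (syls (wb_src w)) m))"
    show "nat (p1 - e1) + 1 \<le> k"
    proof (rule ccontr)
      assume "\<not> ?thesis"
      then have "e1 \<le> p1 - int k" using e1(1) by linarith
      then have "seg X (p1 - int k) hi = seg R (p1 - int k) hi" by (intro seg_cong) (use e1(2) in auto)
      moreover have "n1 + int k \<le> hi - lo" using k lenF unfolding n1_def l1_def by linarith
      ultimately have "\<exists>m. sublist (initial_part w k) (list_pow l1 m)"
        using part seg_in_list_pow[of l1 p1 "p1 - int k" hi] band_lists_D(1)[OF wD(1)] unfolding R_def by simp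
      then show False using k unfolding l1_def by blast
    qed
  qed
  have ex: "int (exit_offset w) = hi - e1"
    unfolding exit_offset_def idx1 hi_def n1_def l1_def using e1(1) by simp
  have fi: "full_word (wb_inv w) = rev (map syl_inv (full_word w))"
    unfolding full_word_def wb_inv_def by simp
  have idx2: "exit_index (wb_inv w) = nat (f2 - p2) + 1"
    unfolding exit_index_def
  proof (rule Least_equality)
    define K where "K = nat (f2 - p2) + 1"
    have K: "int K = f2 - p2 + 1" unfolding K_def using f2(1) by simp
    have sr: "syls (wb_src (wb_inv w)) = rev (map syl_inv l2)" unfolding wb_inv_def l2_def by simp
    have lf: "length (full_word (wb_inv w)) = length (full_word w)" unfolding fi by simp
    have part: "initial_part (wb_inv w) k = rev (map syl_inv (seg X lo (p2 + int k)))" if "n2 + int k \<le> hi - lo" for k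
    proof -
      have "initial_part (wb_inv w) k = rev (take (length l2 + k) (map syl_inv (full_word w)))"
        unfolding initial_part_def Let_def sr fi by (simp add: rev_take)
      moreover have "seg X lo hi = seg X lo (p2 + int k) @ seg X (p2 + int k) hi"
        using that le n unfolding lo_def by (simp add: seg_append)
      moreover have "length l2 + k = nat (p2 + int k - lo)" unfolding lo_def n2_def by simp
      ultimately show ?thesis unfolding full by (simp add: take_map)
    qed
    have subi: "sublist (initial_part (wb_inv w) k) (list_pow (syls (wb_src (wb_inv w))) m) \<longleftrightarrow>
      sublist (seg X lo (p2 + int k)) (list_pow l2 m)" if "n2 + int k \<le> hi - lo" for k m
      unfolding part[OF that] sr list_pow_rev_map sublist_inv ..
    show "1 \<le> nat (f2 - p2) + 1 \<and> length (syls (wb_src (wb_inv w))) + (nat (f2 - p2) + 1) \<le> length (full_word (wb_inv w)) \<and>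
      \<not> (\<exists>m. sublist (initial_part (wb_inv w) (nat (f2 - p2) + 1)) (list_pow (syls (wb_src (wb_inv w))) m))"
      unfolding K_def[symmetric]
    proof (intro conjI notI)
      show "1 \<le> K" unfolding K_def by simp
      have b: "n2 + int K \<le> hi - lo" unfolding K lo_def using f2_hi by simp
      then show "length (syls (wb_src (wb_inv w))) + K \<le> length (full_word (wb_inv w))"
        using lenF unfolding n2_def lf sr by simp
      assume "\<exists>m. sublist (initial_part (wb_inv w) K) (list_pow (syls (wb_src (wb_inv w))) m)"
      then obtain m where m: "sublist (seg X lo (f2 + 1)) (list_pow l2 m)"
        unfolding subi[OF b] K by (auto simp: algebra_simps)
      obtain s where s: "\<And>i. lo \<le> i \<Longrightarrow> i < f2 + 1 \<Longrightarrow> X i = power_word l2 s i"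
        by (rule list_pow_sub_word[OF m]) (use f2(1) le in auto)
      have "Lf = power_word l2 s"
      proof (rule W.agree_turn[OF Lf W.B_pw[OF wD(2)] _ _ dL])
        show "Lf i = power_word l2 s i" if "lo \<le> i" "i \<le> p2 - 1" for i
          using s[of i] XL[of i] that f2(1) by simp
      qed (use le in simp)
      then show False using s[of f2] f2(1,3) le by simp
    qed
    fix k assume k: "1 \<le> k \<and> length (syls (wb_src (wb_inv w))) + k \<le> length (full_word (wb_inv w)) \<and>
      \<not> (\<exists>m. sublist (initial_part (wb_inv w) k) (list_pow (syls (wb_src (wb_inv w))) m))"
    show "nat (f2 - p2) + 1 \<le> k"
    proof (rule ccontr)
      assume "\<not> ?thesis"
      then have "p2 + int k \<le> f2" using f2(1) by linarith
      then have "seg X lo (p2 + int k) = seg Lf lo (p2 + int k)" by (intro seg_cong) (use f2(2) in auto)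
      moreover have b: "n2 + int k \<le> hi - lo" using k lenF unfolding n2_def lf sr by simp
      ultimately have "\<exists>m. sublist (seg X lo (p2 + int k)) (list_pow l2 m)"
        using seg_in_list_pow[of l2 p2 lo "p2 + int k"] band_lists_D(1)[OF wD(2)] unfolding Lf_def by simp
      then show False using k subi[OF b] by blast
    qed
  qed
  have en: "int (entry_offset w) = f2 - lo"
    unfolding entry_offset_def exit_offset_def idx2 lo_def n2_def l2_def using f2(1) by (simp add: wb_inv_def)
  have "e1 \<le> f2"
  proof (rule ccontr)
    assume a: "\<not> e1 \<le> f2"
    have "full_word w = seg X lo f2 @ seg X f2 e1 @ seg X e1 hi"
      unfolding full using a le f2(1) e1(1) by (simp add: seg_append)
    moreover have "seg X f2 e1 \<noteq> []" using a by (simp add: seg_def)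
    moreover have "length (seg X e1 hi) = exit_offset w" "length (seg X lo f2) = entry_offset w" using ex en by simp_all
    ultimately show False using ab unfolding normal_weak_bridge_def by blast
  qed
  have "X = join e1 Lf R"
  proof
    fix i show "X i = join e1 Lf R i" using e1(2) f2(2) \<open>e1 \<le> f2\<close> by (cases "i < e1") auto
  qed
  then show ?thesis unfolding R_def Lf_def l1_def l2_def by blast
qed

lemma comp_rep:
  assumes c: "is_comp A B u' v w"
    and w: "W.bridge_word_of X p2 p1 (syls (wb_tgt w)) (syls (wb_str w)) (syls (wb_src w))"
  obtains r c c' where
    "W.bridge_word_of (join r (power_word (syls (wb_tgt v)) c) X) c p1 (syls (wb_tgt v)) (syls (wb_str v)) (syls (wb_src v))"
    "W.bridge_word_of (join r X (power_word (syls (wb_tgt v)) c)) p2 c' (syls (wb_tgt u')) (syls (wb_str u')) (syls (wb_src u'))"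
    "power_word (syls (wb_tgt v)) c' = power_word (syls (wb_tgt v)) c"
    "syls (wb_src u') = syls (wb_tgt v)"
proof -
  have cD: "weak_bridge A B u'" "weak_bridge A B v" "wb_tgt v = wb_src u'" "wb_src w = wb_src v"
    "wb_tgt w = wb_tgt u'" using c unfolding is_comp_def by blast+
  obtain V v2 v1 where V: "W.bridge_word_of V v2 v1 (syls (wb_tgt v)) (syls (wb_str v)) (syls (wb_src v))"
    using weak_bridge_rep(7)[OF cD(2)] by blast
  obtain U u2 u1 where U: "W.bridge_word_of U u2 u1 (syls (wb_tgt u')) (syls (wb_str u')) (syls (wb_tgt v))"
    using weak_bridge_rep(7)[OF cD(1)] cD(3) by auto
  have w': "W.bridge_word_of X p2 p1 (syls (wb_tgt u')) (syls (wb_str w)) (syls (wb_src v))"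
    using w cD(4,5) by simp
  show thesis
  proof (rule W.comp_touch[OF V U w' comp_lists[OF c refl]])
    fix r d d'
    assume "W.bridge_word_of (join r (power_word (syls (wb_tgt v)) d) X) d p1 (syls (wb_tgt v)) (syls (wb_str v)) (syls (wb_src v))"
      "W.bridge_word_of (join r X (power_word (syls (wb_tgt v)) d)) p2 d' (syls (wb_tgt u')) (syls (wb_str u')) (syls (wb_tgt v))"
      "power_word (syls (wb_tgt v)) d' = power_word (syls (wb_tgt v)) d"
    then show thesis using cD(3) by (intro that[of r d d']) simp_all
  qed
qed

text \<open>Each abnormal factor adds one splice at the target end.\<close>

lemma iterated_chain:
  assumes "iterated_comp A B us v" "\<forall>x\<in>set us. abnormal_weak_bridge x"
    "W.bridge_word_of X p2 p1 (syls (wb_tgt v)) (syls (wb_str v)) (syls (wb_src v))"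
  shows "W.chain X (power_word (syls (wb_tgt v)) p2)"
  using assms
proof (induction arbitrary: X p2 p1 rule: iterated_comp.induct)
  case (single u)
  define Lf R where "Lf = power_word (syls (wb_tgt u)) p2" and "R = power_word (syls (wb_src u)) p1"
  note wr = single.prems(2)[unfolded W.bridge_word_of_def, THEN conjunct1]
  obtain q where q: "X = join q Lf R" using abnormal_splits[OF single.prems(2)] single.prems(1) unfolding Lf_def R_def by auto
  have "W.periodic R" "W.periodic Lf" unfolding R_def Lf_def using W.B_pw W.wbrepD[OF wr] by blast+
  moreover have "Lf \<noteq> R" unfolding Lf_def R_def by (rule W.bridge_word_tails_neq[OF wr])
  moreover have "W.Str (join q Lf R)" using W.wbrepD(3)[OF wr] q by simp
  ultimately have "W.chain (join q Lf R) Lf" by (intro W.chain_step[OF W.chain.base]) auto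
  then show ?case using q unfolding Lf_def by simp
next
  case (step us v u w)
  obtain r c c' where
    V: "W.bridge_word_of (join r (power_word (syls (wb_tgt v)) c) X) c p1 (syls (wb_tgt v)) (syls (wb_str v)) (syls (wb_src v))"
    and U: "W.bridge_word_of (join r X (power_word (syls (wb_tgt v)) c)) p2 c' (syls (wb_tgt u)) (syls (wb_str u)) (syls (wb_src u))"
    and cc: "power_word (syls (wb_tgt v)) c' = power_word (syls (wb_tgt v)) c" "syls (wb_src u) = syls (wb_tgt v)"
    by (rule comp_rep[OF step.hyps(2) step.prems(2)])
  have tw: "wb_tgt w = wb_tgt u" using step.hyps(2) unfolding is_comp_def by blast
  note wX = step.prems(2)[unfolded W.bridge_word_of_def tw, THEN conjunct1]
  note wU = U[unfolded W.bridge_word_of_def, THEN conjunct1]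
  have ch: "W.chain (join r (power_word (syls (wb_tgt v)) c) X) (power_word (syls (wb_tgt v)) c)"
    by (rule step.IH[OF _ V]) (use step.prems(1) in auto)
  obtain q where q: "join r X (power_word (syls (wb_tgt v)) c) = join q (power_word (syls (wb_tgt u)) p2) (power_word (syls (wb_tgt v)) c)"
    using abnormal_splits[OF U] step.prems(1) cc by auto
  have neq: "power_word (syls (wb_tgt u)) p2 \<noteq> power_word (syls (wb_tgt v)) c"
    using W.bridge_word_tails_neq[OF wU] cc by simp
  show ?case unfolding tw
    by (rule W.chain_abnormal[OF wX ch q neq W.wbrepD(3)[OF wU]])
qed

lemma bridge_not_factors:
  assumes "bridge A B w" "W.bridge_word_of X p2 p1 (syls (wb_tgt w)) (syls (wb_str w)) (syls (wb_src w))"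
  shows "\<not> W.factors X p2 p1 (syls (wb_tgt w)) (syls (wb_src w))"
proof
  assume "W.factors X p2 p1 (syls (wb_tgt w)) (syls (wb_src w))"
  note n = factors_not_bridge[OF assms(2) this]
  have "weak_bridge A B w" using assms(1) unfolding bridge_def by blast
  note wr = weak_bridge_rep(3-5)[OF this]
  have "WB (Word (syls (wb_src w))) (mkstr (syls (wb_src w)) (syls (wb_str w))) (Word (syls (wb_tgt w))) = w"
    unfolding wr[symmetric] by simp
  then show False using n assms(1) by simp
qed

lemma iterated_snoc:
  assumes "iterated_comp A B (us @ [u]) w"
  shows "(us = [] \<and> u = w) \<or> (us \<noteq> [] \<and> (\<exists>v. iterated_comp A B us v \<and> is_comp A B u v w))"
  using assms
proof cases
  case (single)
  then show ?thesis by simp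
next
  case (step us' v u')
  then have "us' \<noteq> []" by (auto elim: iterated_comp.cases)
  then show ?thesis using step by auto
qed

lemma iterated_weak: "iterated_comp A B us v \<Longrightarrow> weak_bridge A B v"
  by (induction rule: iterated_comp.induct) (auto simp: is_comp_def)

lemma iterated_ne: "iterated_comp A B us v \<Longrightarrow> us \<noteq> []"
  by (induction rule: iterated_comp.induct) auto

lemma factorization_unique:
  assumes "iterated_comp A B us u" "\<forall>v\<in>set (butlast us). bridge A B v \<and> abnormal_weak_bridge v"
    "bridge A B (last us)" "iterated_comp A B ws u" "\<forall>w\<in>set ws. bridge A B w"
  shows "ws = us"
  using assms
proof (induction us arbitrary: u ws rule: rev_induct)
  case Nil
  then show ?case using iterated_ne by blast
next
  case (snoc x us)
  obtain y ws' where ws: "ws = ws' @ [y]" using iterated_ne[OF snoc.prems(4)] by (metis append_butlast_last_id)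
  have nb: "\<not> bridge A B u" if "is_comp A B a b u" for a b
    using that unfolding bridge_def is_comp_def by blast
  have x: "bridge A B x" using snoc.prems(3) by simp
  have y: "bridge A B y" using snoc.prems(5) ws by simp
  note sx = iterated_snoc[OF snoc.prems(1)] and sy = iterated_snoc[OF snoc.prems(4)[unfolded ws]]
  show ?case
  proof (cases "us = []")
    case True
    then have "x = u" using sx by simp
    \<comment> \<open>A bridge is not a composite, so either both factorizations have length one or
      neither has.\<close>
    then have "ws' = [] \<and> y = u" using sy nb x by blast
    then show ?thesis using ws True \<open>x = u\<close> by simp
  next
    case False
    then obtain v where v: "iterated_comp A B us v" "is_comp A B x v u" using sx by blast
    have "ws' \<noteq> []" using sy y nb[OF v(2)] by auto
    then obtain v' where v': "iterated_comp A B ws' v'" "is_comp A B y v' u" using sy by blast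
    have wu: "weak_bridge A B u" by (rule iterated_weak[OF snoc.prems(1)])
    obtain X p2 p1 where X: "W.bridge_word_of X p2 p1 (syls (wb_tgt u)) (syls (wb_str u)) (syls (wb_src u))"
      using weak_bridge_rep(7)[OF wu] by blast
    have ends: "wb_tgt u = wb_tgt x" "wb_tgt u = wb_tgt y" "wb_src u = wb_src v" "wb_src u = wb_src v'"
      "wb_src x = wb_tgt v" "wb_src y = wb_tgt v'"
      using v(2) v'(2) unfolding is_comp_def by auto
    obtain r c d where
      V: "W.bridge_word_of (join r (power_word (syls (wb_tgt v)) c) X) c p1 (syls (wb_tgt v)) (syls (wb_str v)) (syls (wb_src v))"
      and U: "W.bridge_word_of (join r X (power_word (syls (wb_tgt v)) c)) p2 d (syls (wb_tgt x)) (syls (wb_str x)) (syls (wb_src x))"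
      and cd: "power_word (syls (wb_tgt v)) d = power_word (syls (wb_tgt v)) c" "syls (wb_src x) = syls (wb_tgt v)"
      by (rule comp_rep[OF v(2) X])
    obtain r' c' d' where
      V': "W.bridge_word_of (join r' (power_word (syls (wb_tgt v')) c') X) c' p1 (syls (wb_tgt v')) (syls (wb_str v')) (syls (wb_src v'))"
      and U': "W.bridge_word_of (join r' X (power_word (syls (wb_tgt v')) c')) p2 d' (syls (wb_tgt y)) (syls (wb_str y)) (syls (wb_src y))"
      and cd': "power_word (syls (wb_tgt v')) d' = power_word (syls (wb_tgt v')) c'" "syls (wb_src y) = syls (wb_tgt v')"
      by (rule comp_rep[OF v'(2) X])
    have ab: "\<forall>z\<in>set us. bridge A B z \<and> abnormal_weak_bridge z" using snoc.prems(2) by simp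
    \<comment> \<open>Abnormality enters here: all factors of v are abnormal, while x need only be a
      bridge.\<close>
    have ch: "W.chain (join r (power_word (syls (wb_tgt v)) c) X) (power_word (syls (wb_tgt v)) c)"
      by (rule iterated_chain[OF v(1) _ V]) (use ab in blast)
    have nf: "\<not> W.factors (join r X (power_word (syls (wb_tgt v)) c)) p2 d (syls (wb_tgt u)) (syls (wb_tgt v))"
      using bridge_not_factors[OF x U] ends cd(2) by simp
    have nf': "\<not> W.factors (join r' X (power_word (syls (wb_tgt v')) c')) p2 d' (syls (wb_tgt u)) (syls (wb_tgt v'))"
      using bridge_not_factors[OF y U'] ends cd'(2) by simp
    have "syls (wb_tgt v) = syls (wb_tgt v') \<and> syls (wb_str v) = syls (wb_str v') \<and> syls (wb_str x) = syls (wb_str y)"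
    proof (rule W.last_factor_unique[OF X[unfolded W.bridge_word_of_def, THEN conjunct1] _ _ cd(1) _ _ cd'(1) ch nf nf'])
      show "W.bridge_word_of (join r (power_word (syls (wb_tgt v)) c) X) c p1 (syls (wb_tgt v)) (syls (wb_str v)) (syls (wb_src u))"
        using V ends by simp
      show "W.bridge_word_of (join r' (power_word (syls (wb_tgt v')) c') X) c' p1 (syls (wb_tgt v')) (syls (wb_str v')) (syls (wb_src u))"
        using V' ends by simp
      show "W.bridge_word_of (join r X (power_word (syls (wb_tgt v)) c)) p2 d (syls (wb_tgt u)) (syls (wb_str x)) (syls (wb_tgt v))"
        using U ends cd(2) by simp
      show "W.bridge_word_of (join r' X (power_word (syls (wb_tgt v')) c')) p2 d' (syls (wb_tgt u)) (syls (wb_str y)) (syls (wb_tgt v'))"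
        using U' ends cd'(2) by simp
    qed
    moreover have "weak_bridge A B x" "weak_bridge A B y" using x y unfolding bridge_def by blast+
    ultimately have "x = y" "v = v'"
      using ends cd(2) cd'(2) iterated_weak[OF v(1)] iterated_weak[OF v'(1)]
      by (auto intro!: weak_bridge_eqI)
    have "ws' = us"
    proof (rule snoc.IH[OF v(1)])
      show "\<forall>z\<in>set (butlast us). bridge A B z \<and> abnormal_weak_bridge z" using ab by (meson in_set_butlastD)
      show "bridge A B (last us)" using ab False by simp
      show "iterated_comp A B ws' v" using v'(1) \<open>v = v'\<close> by simp
      show "\<forall>w\<in>set ws'. bridge A B w" using snoc.prems(5) ws by simp
    qed
    then show ?thesis using ws \<open>x = y\<close> by simp
  qed
qed

end

theorem corollary4p19:
  fixes A :: "('k, 'v, 'a) presentation"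
    and B :: "('v, 'a) str set"
    and u :: "('v, 'a) arrow_of_bands"
    and us ws :: "('v, 'a) arrow_of_bands list"
  assumes "string_algebra A"
    and "sign_functions A"
    and "domestic A"
    and "band_representatives A B"
    and "weak_bridge A B u"
    and "iterated_comp A B us u"
    and "\<forall>v \<in> set (butlast us). bridge A B v \<and> abnormal_weak_bridge v"
    and "bridge A B (last us)"
    and "iterated_comp A B ws u"
    and "\<forall>w \<in> set ws. bridge A B w"
  shows "length ws = length us \<and> (\<forall>j < length us. ws ! j = us ! j)"
proof -
  interpret presented A B by unfold_locales (fact assms)+
  have "ws = us" by (rule factorization_unique) (fact assms)+
  then show ?thesis by simp
qed

end
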